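(* Let $(\bar X,\varphi_X)$ and $(\bar Y,\varphi_Y)$ be normal-crossing orbifolds (of complex dimension $1$ or $2$), and let $\pi:(\bar Y,\varphi_Y)\to(\bar X,\varphi_X)$ be a finite abelian Galois orbifold unbranched covering; that is, with $G_{\varphi_X}:=\pi_1^{\mathrm{orb}}(\bar X,\varphi_X)$ and $G_{\varphi_Y}$ the image of $\pi_1^{\mathrm{orb}}(\bar Y,\varphi_Y)$ in $G_{\varphi_X}$ under the (injective) homomorphism $\pi_*$, the subgroup $G_{\varphi_Y}$ is normal in $G_{\varphi_X}$ and $G_\varphi:=G_{\varphi_X}/G_{\varphi_Y}$ is a finite abelian group. Then $$ b_1^{\mathrm{orb}}(\bar Y,\varphi_Y)=b_1^{\mathrm{orb}}(\bar X,\varphi_X)+\sum_{\xi\in\mathrm{Hom}(G_\varphi,\mathbb{C}^* )\setminus\{1\}}\mathrm{null}^{\mathrm{orb}}(\bar X,\xi), $$ where $\mathrm{null}^{\mathrm{orb}}(\bar X,\xi)$ is the depth of $\xi$, considered as a character of $\pi_1^{\mathrm{orb}}(\bar X,\varphi_X)$ via the projection $G_{\varphi_X}\to G_\varphi$.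
   Context: Orbifolds. An orbifold is a pair $(\bar X,\varphi)$ where $\bar X$ is a complex projective variety (normal, with at most abelian quotient singularities), $\mathcal D=\bigcup_{j=1}^rD_j$ is a hypersurface with irreducible components $D_j$, and $\varphi:\{D_1,\dots,D_r\}\to\mathbb{Z}_{\ge0}$ is a function; $n_j:=\varphi(D_j)$. In dimension $1$ (orbicurve), $\bar X$ is a compact Riemann surface and the $D_j$ are finitely many points. Put $X_\varphi^+:=\bar X\setminus\bigcup_{n_j=0}D_j$ and $\mathring X_\varphi:=\bar X\setminus\mathcal D$. The orbifold is normal-crossing if $\mathcal D$ is a normal crossing divisor with smooth components (in the sense of quotient singularities: near a point $p$ with $(\bar X,p)\cong(\mathbb{C}^2/A,0)$, $A$ a small finite abelian linear group, the components of $\mathcal D$ through $p$ are images of coordinate axes). $\mathrm{Reg}$ denotes the set of smooth points. Orbifold fundamental group. $\pi_1^{\mathrm{orb}}(\bar X,\varphi)$ is the quotient of $\pi_1(\mathrm{Reg}(\mathring X_\varphi))$ by the subgroup normally generated by $\mu_j^{n_j}$, $1\le j\le r$, with $\mu_j$ a meridian of $D_j$. The number $b_1^{\mathrm{orb}}(\bar X,\varphi)$ is the rank of the abelianization of $\pi_1^{\mathrm{orb}}(\bar X,\varphi)$. Orbifold index. For $p\in X_\varphi^+$, $\nu_{(\bar X,\varphi)}(p)=\iota_p\prod_{j:\,p\in D_j}n_j$, where $\iota_p=|A|$ if $(\bar X,p)\cong(\mathbb{C}^2/A,0)$ with $A\subset GL(2;\mathbb{C})$ small abelian (and $\iota_p=1$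 iff $p$ is a smooth point). Orbifold morphisms. Let $(\bar Y,\varphi_Y)$, $(\bar X,\varphi_X)$ be orbifolds with divisors $\bigcup_j E_j$ and $\bigcup_kD_k$, indices $m_j=\varphi_Y(E_j)$ and $n_k=\varphi_X(D_k)$. A dominant holomorphic map $\pi:Y_{\varphi_Y}^+\to X_{\varphi_X}^+$ defines an orbifold morphism if for each $k$ with $n_k>0$ the divisor $\pi^*(D_k)$ can be written as $\sum_jh_{j,k}E_j+n_kH_k$ where $n_k$ divides $m_jh_{j,k}$ for all $j$ and $H_k$ is a divisor in $Y_{\varphi_Y}^+$. It induces a homomorphism $\pi_*$ of orbifold fundamental groups. Orbifold unbranched covering. An orbifold morphism $\pi:(\bar Y,\varphi_Y)\to(\bar X,\varphi_X)$ that is finite (proper and surjective from $Y_{\varphi_Y}^+$ onto $X_{\varphi_X}^+$, with finite fibres) is an orbifold unbranched covering if $\nu_{(\bar Y,\varphi_Y)}(y)\cdot\deg\pi_y=\nu_{(\bar X,\varphi_X)}(x)$ for all $x\in X_{\varphi_X}^+$ and all $y\in\pi^{-1}(x)$, where $\deg\pi_y$ is the local degree of $\pi$ at $y$. Such a covering induces an injective homomorphism $\pi_*$ on orbifold fundamental groups. Depth/nullity. Let $G$ be a finitely presented group and $M$ the $\mathbb{C}[H_1(G)]$-module $(G'/G'')\otimes\mathbb{C}$, where $H_1(G)=G/G'$ acts by conjugation. Let $\mathbb{C}[H_1(G)]^m\xrightarrow{\phi}\mathbb{C}[H_1(G)]^n\to M\to0$ be a presentation. The $k$-th Fitting ideal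 $F_k(M)$ is $0$ if $k\le\max\{0,n-m\}$, the unit ideal if $k>n$, and otherwise the ideal generated by the minors of order $n-k+1$ of the matrix of $\phi$. Let $\mathcal V_k(M)\subset\mathrm{Hom}(G,\mathbb{C}^* )$ be the zero set of $F_k(M)$ (characters are identified with the closed points of $\mathrm{Spec}\,\mathbb{C}[H_1(G)]$). The nullity or depth of a character $\xi$ is the maximal $k$ with $\xi\in\mathcal V_k(M)$. For $G=\pi_1^{\mathrm{orb}}(\bar X,\varphi_X)$ it is denoted $\mathrm{null}^{\mathrm{orb}}(\bar X,\xi)$. *)

theory Defs
  imports
    "HOL-Analysis.Analysis"
    "HOL-Algebra.Generated_Groups"
    "HOL-Algebra.Ideal"
    "HOL-Algebra.Module"
    "HOL-Combinatorics.Permutations"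
    "HOL-Library.Extended_Nat"
begin

section \<open>Complex projective space and its algebraic subsets\<close>

text \<open>The points of projective space of dimension \<open>CARD('n) - 1\<close> are the complex lines in
  \<open>\<complex>\<close>-space with coordinates indexed by \<open>'n\<close>; the topology is the quotient topology.\<close>

typedef (overloaded) 'n cproj =
  "{range (\<lambda>c::complex. c *s v) | v :: complex^'n::finite. v \<noteq> 0}"
proof -
  have "(vec 1 :: complex^'n) \<noteq> 0" by (simp add: vec_eq_iff)
  then show ?thesis by blast
qed

definition pt :: "complex^'n::finite \<Rightarrow> 'n cproj"
  where "pt v = Abs_cproj (range (\<lambda>c::complex. c *s v))"

definition aff_cone :: "'n::finite cproj set \<Rightarrow> (complex^'n) set"
  where "aff_cone W = {v. v \<noteq> 0 \<and> pt v \<in> W}"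

instantiation cproj :: (finite) topological_space
begin

definition open_cproj :: "'a cproj set \<Rightarrow> bool"
  where "open_cproj W = open (aff_cone W)"

instance
proof
  have "aff_cone (UNIV :: 'a cproj set) = - {0}" by (auto simp: aff_cone_def)
  then show "open (UNIV :: 'a cproj set)"
    by (simp add: open_cproj_def open_Compl closed_singleton)
next
  fix S T :: "'a cproj set" assume "open S" "open T"
  moreover have "aff_cone (S \<inter> T) = aff_cone S \<inter> aff_cone T" by (auto simp: aff_cone_def)
  ultimately show "open (S \<inter> T)" by (simp add: open_cproj_def open_Int)
next
  fix K :: "'a cproj set set" assume "\<forall>S\<in>K. open S"
  moreover have "aff_cone (\<Union>K) = (\<Union>S\<in>K. aff_cone S)" by (auto simp: aff_cone_def)
  ultimately show "open (\<Union>K)" by (auto simp: open_cproj_def)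
qed

end

definition homogeneous_poly :: "nat \<Rightarrow> (complex^'n::finite \<Rightarrow> complex) \<Rightarrow> bool"
  where "homogeneous_poly d f \<longleftrightarrow>
    (\<exists>(A :: ('n \<Rightarrow> nat) set) c. finite A \<and> (\<forall>\<alpha>\<in>A. (\<Sum>i\<in>UNIV. \<alpha> i) = d) \<and>
       f = (\<lambda>v. \<Sum>\<alpha>\<in>A. c \<alpha> * (\<Prod>i\<in>UNIV. (v $ i) ^ \<alpha> i)))"

definition algebraic_set :: "'n::finite cproj set \<Rightarrow> bool"
  where "algebraic_set Z \<longleftrightarrow>
    (\<exists>F. (\<forall>f\<in>F. \<exists>d. homogeneous_poly d f) \<and> aff_cone Z = {v. v \<noteq> 0 \<and> (\<forall>f\<in>F. f v = 0)})"

text \<open>Irreducibility with respect to a class \<open>P\<close> of closed sets (algebraic or analytic ones).\<close>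

definition irreducible_in :: "('a set \<Rightarrow> bool) \<Rightarrow> 'a set \<Rightarrow> bool"
  where "irreducible_in P Z \<longleftrightarrow> P Z \<and> Z \<noteq> {} \<and>
    \<not> (\<exists>A B. P A \<and> P B \<and> Z = A \<union> B \<and> A \<noteq> Z \<and> B \<noteq> Z)"

section \<open>Holomorphic functions and quotient charts\<close>

text \<open>Holomorphy in several variables: the Frechet derivative is complex linear.\<close>

definition holo :: "(complex^'d::finite) set \<Rightarrow> (complex^'d \<Rightarrow> complex) \<Rightarrow> bool"
  where "holo S f \<longleftrightarrow>
    (\<forall>z\<in>S. \<exists>f'. (f has_derivative f') (at z) \<and> (\<forall>c v. f' (c *s v) = c * f' v))"

definition rel_open :: "'a::topological_space set \<Rightarrow> 'a set \<Rightarrow> bool"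
  where "rel_open X V \<longleftrightarrow> (\<exists>W. open W \<and> V = X \<inter> W)"

text \<open>Sections over \<open>V\<close> of the structure sheaf of the reduced analytic space \<open>X\<close>: functions that
  locally extend to holomorphic functions on open sets of projective space.\<close>

definition holo_on :: "'n::finite cproj set \<Rightarrow> ('n cproj \<Rightarrow> complex) \<Rightarrow> bool"
  where "holo_on V f \<longleftrightarrow>
    (\<forall>p\<in>V. \<exists>W g. open W \<and> p \<in> W \<and> holo (aff_cone W) (\<lambda>v. g (pt v)) \<and> (\<forall>x\<in>V \<inter> W. f x = g x))"

text \<open>Small finite abelian linear groups; small means that no nontrivial element fixes a hyperplane
  pointwise (no pseudo-reflections). In dimension 1 only the trivial group is small.\<close>

definition small_abelian :: "(complex^'d^'d::finite) set \<Rightarrow> bool"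
  where "small_abelian A \<longleftrightarrow> finite A \<and> mat 1 \<in> A \<and>
    (\<forall>a\<in>A. invertible a \<and> matrix_inv a \<in> A) \<and>
    (\<forall>a\<in>A. \<forall>b\<in>A. a ** b \<in> A \<and> a ** b = b ** a) \<and>
    (\<forall>a\<in>A. a \<noteq> mat 1 \<longrightarrow> vec.dim {v. a *v v = v} \<noteq> CARD('d) - 1)"

text \<open>\<open>q\<close> identifies the germ of \<open>X\<close> at \<open>q 0\<close> with the germ of the quotient space \<open>\<complex>\<^sup>d/A\<close> at 0:
  it induces a homeomorphism from \<open>B/A\<close> onto an open subset of \<open>X\<close>, under which the
  holomorphic functions are exactly the \<open>A\<close>-invariant holomorphic functions upstairs.\<close>

definition quotient_chart ::
    "'n::finite cproj set \<Rightarrow> (complex^'d^'d::finite) set \<Rightarrow> (complex^'d) set \<Rightarrow>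
     (complex^'d \<Rightarrow> 'n cproj) \<Rightarrow> bool"
  where "quotient_chart X A B q \<longleftrightarrow>
    small_abelian A \<and> open B \<and> connected B \<and> 0 \<in> B \<and> (\<forall>a\<in>A. \<forall>z\<in>B. a *v z \<in> B) \<and>
    continuous_on B q \<and>
    (\<forall>S. open S \<and> S \<subseteq> B \<longrightarrow> rel_open X (q ` S)) \<and>
    (\<forall>z\<in>B. \<forall>w\<in>B. q z = q w \<longleftrightarrow> (\<exists>a\<in>A. w = a *v z)) \<and>
    (\<forall>V f. rel_open X V \<and> V \<subseteq> q ` B \<longrightarrow>
       (holo_on V f \<longleftrightarrow> holo {z\<in>B. q z \<in> V} (f \<circ> q)))"

abbreviation smooth_chart ::
    "'n::finite cproj set \<Rightarrow> (complex^'d::finite) set \<Rightarrow> (complex^'d \<Rightarrow> 'n cproj) \<Rightarrow> bool"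
  where "smooth_chart X B q \<equiv> quotient_chart X {mat 1} B q"

text \<open>A smooth chart of \<open>X\<close> in which \<open>Z\<close> is the coordinate hyperplane \<open>z\<^sub>i = 0\<close>.\<close>

definition adapted_chart ::
    "'n::finite cproj set \<Rightarrow> 'n cproj set \<Rightarrow> (complex^'d::finite) set \<Rightarrow>
     (complex^'d \<Rightarrow> 'n cproj) \<Rightarrow> 'd \<Rightarrow> bool"
  where "adapted_chart X Z B q i \<longleftrightarrow>
    smooth_chart X B q \<and> {z\<in>B. q z \<in> Z} = {z\<in>B. z $ i = 0}"

section \<open>Orbifolds\<close>

text \<open>\<open>comps\<close> is the set of components \<open>D\<^sub>j\<close> and \<open>idx\<close> is the function \<open>\<phi>\<close>, which is only relevant
  on \<open>comps\<close>. The phantom field \<open>cdim\<close> records the complex dimension \<open>CARD('d)\<close>.\<close>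

record ('n, 'd) orbi =
  pts :: "'n cproj set"
  comps :: "'n cproj set set"
  idx :: "'n cproj set \<Rightarrow> nat"
  cdim :: "'d itself"

text \<open>An irreducible closed set is a hypersurface iff it is one at some smooth point of \<open>X\<close>, since it
  is of pure dimension. Normality of \<open>X\<close> follows from the existence of the quotient charts.\<close>

definition orbifold :: "('n::finite, 'd::finite) orbi \<Rightarrow> bool"
  where "orbifold X \<longleftrightarrow>
    irreducible_in algebraic_set (pts X) \<and>
    (\<forall>p\<in>pts X. \<exists>A (B :: (complex^'d) set) q. quotient_chart (pts X) A B q \<and> q 0 = p) \<and>
    finite (comps X) \<and>
    (\<forall>D\<in>comps X. irreducible_in algebraic_set D \<and> D \<subseteq> pts X \<and>
       (\<exists>(B :: (complex^'d) set) q i. adapted_chart (pts X) D B q i))"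

text \<open>Normal crossings: near each point \<open>p\<close> the components through \<open>p\<close> are images of distinct
  coordinate axes. Their full preimages are required to be the axes, i.e. the axes are
  \<open>A\<close>-invariant; this is automatic in coordinates diagonalizing the finite abelian group \<open>A\<close>.\<close>

definition nc_orbifold :: "('n::finite, 'd::finite) orbi \<Rightarrow> bool"
  where "nc_orbifold X \<longleftrightarrow> orbifold X \<and>
    (\<forall>p\<in>pts X. \<exists>A (B :: (complex^'d) set) q \<sigma>.
       quotient_chart (pts X) A B q \<and> q 0 = p \<and>
       inj_on \<sigma> {D\<in>comps X. p \<in> D} \<and>
       (\<forall>D\<in>comps X. p \<in> D \<longrightarrow> {z\<in>B. q z \<in> D} = {z\<in>B. z $ \<sigma> D = 0}))"

definition orb_plus :: "('n::finite, 'd::finite) orbi \<Rightarrow> 'n cproj set"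
  where "orb_plus X = pts X - \<Union>{D\<in>comps X. idx X D = 0}"

definition orb_ring :: "('n::finite, 'd::finite) orbi \<Rightarrow> 'n cproj set"
  where "orb_ring X = pts X - \<Union>(comps X)"

definition reg_ring :: "('n::finite, 'd::finite) orbi \<Rightarrow> 'n cproj set"
  where "reg_ring X =
    {p\<in>orb_ring X. \<exists>(B :: (complex^'d) set) q. smooth_chart (pts X) B q \<and> q 0 = p}"

definition sing_index :: "('n::finite, 'd::finite) orbi \<Rightarrow> 'n cproj \<Rightarrow> nat"
  where "sing_index X p =
    (THE k. \<exists>A (B :: (complex^'d) set) q. quotient_chart (pts X) A B q \<and> q 0 = p \<and> k = card A)"

definition orb_index :: "('n::finite, 'd::finite) orbi \<Rightarrow> 'n cproj \<Rightarrow> nat"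
  where "orb_index X p = sing_index X p * (\<Prod>D\<in>{D\<in>comps X. p \<in> D}. idx X D)"

section \<open>Orbifold fundamental group\<close>

definition loop_at :: "'a::topological_space set \<Rightarrow> 'a \<Rightarrow> (real \<Rightarrow> 'a) \<Rightarrow> bool"
  where "loop_at S x \<gamma> \<longleftrightarrow>
    path \<gamma> \<and> path_image \<gamma> \<subseteq> S \<and> pathstart \<gamma> = x \<and> pathfinish \<gamma> = x"

definition hclass :: "'a::topological_space set \<Rightarrow> (real \<Rightarrow> 'a) \<Rightarrow> (real \<Rightarrow> 'a) set"
  where "hclass S \<gamma> = {\<eta>. homotopic_paths S \<gamma> \<eta>}"

definition pi1 :: "'a::topological_space set \<Rightarrow> 'a \<Rightarrow> (real \<Rightarrow> 'a) set monoid"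
  where "pi1 S x =
    \<lparr>carrier = hclass S ` {\<gamma>. loop_at S x \<gamma>},
     mult = (\<lambda>a b. {\<eta>. \<exists>\<gamma>\<in>a. \<exists>\<delta>\<in>b. homotopic_paths S (\<gamma> +++ \<delta>) \<eta>}),
     one = hclass S (\<lambda>t. x)\<rparr>"

text \<open>Based meridians of \<open>D\<close>: a small positively oriented circle around a general point of \<open>D\<close>, in a
  chart not meeting the other components, joined to the base point by a path.\<close>

definition meridian :: "('n::finite, 'd::finite) orbi \<Rightarrow> 'n cproj \<Rightarrow> 'n cproj set \<Rightarrow>
    (real \<Rightarrow> 'n cproj) \<Rightarrow> bool"
  where "meridian X x D \<eta> \<longleftrightarrow>
    (\<exists>(B :: (complex^'d) set) q i r \<alpha> \<delta>.
       adapted_chart (pts X) D B q i \<and> (\<forall>E\<in>comps X - {D}. q ` B \<inter> E = {}) \<and>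
       0 < r \<and> (\<forall>c::complex. cmod c \<le> r \<longrightarrow> axis i c \<in> B) \<and>
       \<delta> = (\<lambda>t. q (axis i (complex_of_real r * cis (2 * pi * t)))) \<and>
       path \<alpha> \<and> path_image \<alpha> \<subseteq> reg_ring X \<and> pathstart \<alpha> = x \<and> pathfinish \<alpha> = pathstart \<delta> \<and>
       \<eta> = \<alpha> +++ (\<delta> +++ reversepath \<alpha>))"

definition normal_closure :: "('a, 'b) monoid_scheme \<Rightarrow> 'a set \<Rightarrow> 'a set"
  where "normal_closure G S = \<Inter>{N. N \<lhd> G \<and> S \<subseteq> N}"

text \<open>All meridians of \<open>D\<close> are conjugate, so using all of them gives the same normal subgroup as
  choosing one for each component.\<close>

definition orb_relators :: "('n::finite, 'd::finite) orbi \<Rightarrow> 'n cproj \<Rightarrow> (real \<Rightarrow> 'n cproj) set set"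
  where "orb_relators X x =
    {hclass (reg_ring X) \<eta> [^]\<^bsub>pi1 (reg_ring X) x\<^esub> idx X D | \<eta> D. D \<in> comps X \<and> meridian X x D \<eta>}"

definition orb_pi1 :: "('n::finite, 'd::finite) orbi \<Rightarrow> 'n cproj \<Rightarrow> (real \<Rightarrow> 'n cproj) set set monoid"
  where "orb_pi1 X x =
    pi1 (reg_ring X) x Mod normal_closure (pi1 (reg_ring X) x) (orb_relators X x)"

definition orb_class :: "('n::finite, 'd::finite) orbi \<Rightarrow> 'n cproj \<Rightarrow> (real \<Rightarrow> 'n cproj) \<Rightarrow>
    (real \<Rightarrow> 'n cproj) set set"
  where "orb_class X x \<gamma> =
    normal_closure (pi1 (reg_ring X) x) (orb_relators X x)
      #>\<^bsub>pi1 (reg_ring X) x\<^esub> hclass (reg_ring X) \<gamma>"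

definition abelianization :: "('a, 'b) monoid_scheme \<Rightarrow> 'a set monoid"
  where "abelianization G = G Mod derived G (carrier G)"

definition int_independent :: "('a, 'b) monoid_scheme \<Rightarrow> 'a set \<Rightarrow> bool"
  where "int_independent Q S \<longleftrightarrow> finite S \<and> S \<subseteq> carrier Q \<and>
    (\<forall>k :: 'a \<Rightarrow> int. finprod Q (\<lambda>x. x [^]\<^bsub>Q\<^esub> k x) S = \<one>\<^bsub>Q\<^esub> \<longrightarrow> (\<forall>x\<in>S. k x = 0))"

definition abelian_rank :: "('a, 'b) monoid_scheme \<Rightarrow> enat"
  where "abelian_rank Q = Sup {enat (card S) | S. int_independent Q S}"

definition b1_orb :: "('n::finite, 'd::finite) orbi \<Rightarrow> 'n cproj \<Rightarrow> enat"
  where "b1_orb X x = abelian_rank (abelianization (orb_pi1 X x))"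

section \<open>Divisors and orbifold morphisms\<close>

definition analytic_subset :: "'n::finite cproj set \<Rightarrow> 'n cproj set \<Rightarrow> bool"
  where "analytic_subset Y Z \<longleftrightarrow> Z \<subseteq> Y \<and>
    (\<forall>p\<in>Y. \<exists>V F. rel_open Y V \<and> p \<in> V \<and> finite F \<and> (\<forall>f\<in>F. holo_on V f) \<and>
       Z \<inter> V = {x\<in>V. \<forall>f\<in>F. f x = 0})"

definition prime_divisor :: "('n::finite, 'd::finite) orbi \<Rightarrow> 'n cproj set \<Rightarrow> bool"
  where "prime_divisor Y F \<longleftrightarrow>
    irreducible_in (analytic_subset (orb_plus Y)) F \<and>
    (\<exists>(B :: (complex^'d) set) q i. adapted_chart (orb_plus Y) F B q i)"

text \<open>Weil divisors on \<open>Y\<^sup>+\<close>, as locally finite integer functions on the prime divisors.\<close>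

definition divisor :: "('n::finite, 'd::finite) orbi \<Rightarrow> ('n cproj set \<Rightarrow> int) \<Rightarrow> bool"
  where "divisor Y H \<longleftrightarrow> (\<forall>F. H F \<noteq> 0 \<longrightarrow> prime_divisor Y F) \<and>
    (\<forall>p\<in>orb_plus Y. \<exists>V. open V \<and> p \<in> V \<and> finite {F. H F \<noteq> 0 \<and> F \<inter> V \<noteq> {}})"

definition van_order :: "(complex^'d::finite) set \<Rightarrow> 'd \<Rightarrow> (complex^'d \<Rightarrow> complex) \<Rightarrow> nat \<Rightarrow> bool"
  where "van_order B i u s \<longleftrightarrow>
    (\<exists>w. holo B w \<and> (\<forall>z\<in>B. w z \<noteq> 0 \<and> u z = (z $ i) ^ s * w z))"

text \<open>\<open>g\<close> is an equation on \<open>V\<close> of the multiple \<open>r D\<close>; on a quotient singularity only a multiple of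
  \<open>D\<close> need be Cartier.\<close>

definition local_equation :: "('n::finite, 'd::finite) orbi \<Rightarrow> 'n cproj set \<Rightarrow> 'n cproj set \<Rightarrow>
    ('n cproj \<Rightarrow> complex) \<Rightarrow> nat \<Rightarrow> bool"
  where "local_equation X D V g r \<longleftrightarrow>
    rel_open (pts X) V \<and> 0 < r \<and> holo_on V g \<and> (\<forall>x\<in>V. g x = 0 \<longleftrightarrow> x \<in> D) \<and>
    (\<forall>(B :: (complex^'d) set) q i. adapted_chart (pts X) D B q i \<and> q ` B \<subseteq> V \<longrightarrow>
       van_order B i (g \<circ> q) r)"

text \<open>The multiplicity of the pulled back divisor \<open>\<pi>\<^sup>*(D)\<close> along a prime divisor \<open>F\<close>, computed at a
  general point of \<open>F\<close>. It is rational in general, as \<open>F\<close> may be contracted to a singular point.\<close>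

definition pullback_mult :: "('m::finite, 'd::finite) orbi \<Rightarrow> ('n::finite, 'd) orbi \<Rightarrow>
    ('m cproj \<Rightarrow> 'n cproj) \<Rightarrow> 'n cproj set \<Rightarrow> 'm cproj set \<Rightarrow> real"
  where "pullback_mult Y X \<pi> D F =
    (THE \<mu>. \<exists>(B :: (complex^'d) set) q i V g r s.
       adapted_chart (orb_plus Y) F B q i \<and> local_equation X D V g r \<and> \<pi> ` q ` B \<subseteq> V \<and>
       van_order B i (g \<circ> \<pi> \<circ> q) s \<and> \<mu> = real s / real r)"

definition holomorphic_map :: "'m::finite cproj set \<Rightarrow> 'n::finite cproj set \<Rightarrow>
    ('m cproj \<Rightarrow> 'n cproj) \<Rightarrow> bool"
  where "holomorphic_map Y X \<pi> \<longleftrightarrow> \<pi> ` Y \<subseteq> X \<and> continuous_on Y \<pi> \<and>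
    (\<forall>V f. rel_open X V \<and> holo_on V f \<longrightarrow> holo_on {y\<in>Y. \<pi> y \<in> V} (f \<circ> \<pi>))"

definition orb_morphism :: "('m::finite, 'd::finite) orbi \<Rightarrow> ('n::finite, 'd) orbi \<Rightarrow>
    ('m cproj \<Rightarrow> 'n cproj) \<Rightarrow> bool"
  where "orb_morphism Y X \<pi> \<longleftrightarrow>
    holomorphic_map (orb_plus Y) (orb_plus X) \<pi> \<and>
    orb_plus X \<subseteq> closure (\<pi> ` orb_plus Y) \<and>
    (\<forall>D\<in>comps X. 0 < idx X D \<longrightarrow>
       (\<exists>(h :: 'm cproj set \<Rightarrow> int) H. divisor Y H \<and>
          (\<forall>E\<in>comps Y. int (idx X D) dvd int (idx Y E) * h E) \<and>
          (\<forall>F. prime_divisor Y F \<longrightarrow>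
             pullback_mult Y X \<pi> D F =
             of_int ((\<Sum>E\<in>{E\<in>comps Y. E \<inter> orb_plus Y = F}. h E) + int (idx X D) * H F))))"

section \<open>Unbranched and Galois coverings\<close>

definition finite_map :: "'a::topological_space set \<Rightarrow> 'b::topological_space set \<Rightarrow>
    ('a \<Rightarrow> 'b) \<Rightarrow> bool"
  where "finite_map Y X \<pi> \<longleftrightarrow> \<pi> ` Y = X \<and>
    (\<forall>K. compact K \<and> K \<subseteq> X \<longrightarrow> compact {y\<in>Y. \<pi> y \<in> K}) \<and>
    (\<forall>x\<in>X. finite {y\<in>Y. \<pi> y = x})"

text \<open>The local degree is the number of preimages, close to \<open>y\<close>, of a general point close to \<open>\<pi> y\<close>;
  the points that are not general form a closed nowhere dense set \<open>T\<close>.\<close>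

definition local_degree :: "'a::topological_space set \<Rightarrow> 'b::topological_space set \<Rightarrow>
    ('a \<Rightarrow> 'b) \<Rightarrow> 'a \<Rightarrow> nat"
  where "local_degree Y X \<pi> y =
    (THE d. \<forall>W. open W \<and> y \<in> W \<longrightarrow>
       (\<exists>W' V T. open W' \<and> y \<in> W' \<and> W' \<subseteq> W \<and> open V \<and> \<pi> y \<in> V \<and>
          closed T \<and> X \<subseteq> closure (X - T) \<and>
          (\<forall>x\<in>X \<inter> V - T. card {y'\<in>Y \<inter> W'. \<pi> y' = x} = d)))"

definition unbranched_covering :: "('m::finite, 'd::finite) orbi \<Rightarrow> ('n::finite, 'd) orbi \<Rightarrow>
    ('m cproj \<Rightarrow> 'n cproj) \<Rightarrow> bool"
  where "unbranched_covering Y X \<pi> \<longleftrightarrow>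
    orb_morphism Y X \<pi> \<and> finite_map (orb_plus Y) (orb_plus X) \<pi> \<and>
    (\<forall>y\<in>orb_plus Y. orb_index Y y * local_degree (orb_plus Y) (orb_plus X) \<pi> y = orb_index X (\<pi> y))"

text \<open>\<open>h\<close> is the homomorphism \<open>\<pi>\<^sub>*\<close>. Only loops that \<open>\<pi>\<close> maps into the regular part of the complement of
  the divisor have a class downstairs; these loops generate the orbifold group upstairs, because
  the points removed from it have real codimension at least two.\<close>

definition induced_hom :: "('m::finite, 'd::finite) orbi \<Rightarrow> 'm cproj \<Rightarrow> ('n::finite, 'd) orbi \<Rightarrow>
    'n cproj \<Rightarrow> ('m cproj \<Rightarrow> 'n cproj) \<Rightarrow>
    ((real \<Rightarrow> 'm cproj) set set \<Rightarrow> (real \<Rightarrow> 'n cproj) set set) \<Rightarrow> bool"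
  where "induced_hom Y y X x \<pi> h \<longleftrightarrow> h \<in> hom (orb_pi1 Y y) (orb_pi1 X x) \<and>
    (\<forall>\<gamma>. loop_at {u\<in>reg_ring Y. \<pi> u \<in> reg_ring X} y \<gamma> \<longrightarrow>
       h (orb_class Y y \<gamma>) = orb_class X x (\<pi> \<circ> \<gamma>))"

text \<open>\<open>N\<close> is the image of the injective homomorphism \<open>\<pi>\<^sub>*\<close>.\<close>

definition abelian_galois_covering :: "('m::finite, 'd::finite) orbi \<Rightarrow> 'm cproj \<Rightarrow>
    ('n::finite, 'd) orbi \<Rightarrow> 'n cproj \<Rightarrow> ('m cproj \<Rightarrow> 'n cproj) \<Rightarrow>
    (real \<Rightarrow> 'n cproj) set set set \<Rightarrow> bool"
  where "abelian_galois_covering Y y X x \<pi> N \<longleftrightarrow>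
    unbranched_covering Y X \<pi> \<and>
    (\<exists>h. induced_hom Y y X x \<pi> h \<and> inj_on h (carrier (orb_pi1 Y y)) \<and>
         N = h ` carrier (orb_pi1 Y y)) \<and>
    N \<lhd> orb_pi1 X x \<and>
    comm_group (orb_pi1 X x Mod N) \<and> finite (carrier (orb_pi1 X x Mod N))"

section \<open>Characters\<close>

definition Cstar :: "complex monoid"
  where "Cstar = \<lparr>carrier = - {0}, mult = (*), one = 1\<rparr>"

definition characters :: "('a, 'b) monoid_scheme \<Rightarrow> ('a \<Rightarrow> complex) set"
  where "characters G = hom G Cstar \<inter> extensional (carrier G)"

definition trivial_char :: "('a, 'b) monoid_scheme \<Rightarrow> 'a \<Rightarrow> complex"
  where "trivial_char G = (\<lambda>g\<in>carrier G. 1)"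

definition inflate :: "('a, 'b) monoid_scheme \<Rightarrow> 'a set \<Rightarrow> ('a set \<Rightarrow> complex) \<Rightarrow> 'a \<Rightarrow> complex"
  where "inflate G N \<xi> = (\<lambda>g\<in>carrier G. \<xi> (N #>\<^bsub>G\<^esub> g))"

section \<open>The Alexander module, Fitting ideals and depth\<close>

definition fin_supp :: "'a set \<Rightarrow> ('a \<Rightarrow> complex) set"
  where "fin_supp S = {f. finite {x. f x \<noteq> 0} \<and> {x. f x \<noteq> 0} \<subseteq> S}"

definition delta :: "'a \<Rightarrow> 'a \<Rightarrow> complex"
  where "delta a = (\<lambda>x. if x = a then 1 else 0)"

definition group_algebra :: "('a, 'b) monoid_scheme \<Rightarrow> ('a \<Rightarrow> complex) ring"
  where "group_algebra H =
    \<lparr>carrier = fin_supp (carrier H),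
     mult = (\<lambda>f g x. if x \<in> carrier H
                     then \<Sum>a\<in>{a. f a \<noteq> 0}. f a * g (inv\<^bsub>H\<^esub> a \<otimes>\<^bsub>H\<^esub> x) else 0),
     one = delta \<one>\<^bsub>H\<^esub>,
     zero = (\<lambda>x. 0),
     add = (\<lambda>f g x. f x + g x)\<rparr>"

text \<open>For an abelian group \<open>Q\<close>, written multiplicatively, \<open>Q \<otimes> \<complex>\<close> is the vector space with basis \<open>Q\<close>
  modulo the subspace spanned by the relations \<open>[a b] - [a] - [b]\<close>.\<close>

inductive_set tensor_relations :: "('a, 'b) monoid_scheme \<Rightarrow> ('a \<Rightarrow> complex) set"
  for Q :: "('a, 'b) monoid_scheme"
  where
    "(\<lambda>x. 0) \<in> tensor_relations Q"
  | "f \<in> tensor_relations Q \<Longrightarrow> a \<in> carrier Q \<Longrightarrow> b \<in> carrier Q \<Longrightarrow>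
     (\<lambda>x. f x + c * (delta (a \<otimes>\<^bsub>Q\<^esub> b) x - delta a x - delta b x)) \<in> tensor_relations Q"

definition second_quotient :: "('a, 'b) monoid_scheme \<Rightarrow> 'a set monoid"
  where "second_quotient G =
    G\<lparr>carrier := derived G (carrier G)\<rparr> Mod derived G (derived G (carrier G))"

text \<open>Conjugation \<open>g a g\<^sup>-\<^sup>1\<close>, on cosets \<open>h = g G'\<close> and \<open>c = a G''\<close>.\<close>

definition conj_act :: "('a, 'b) monoid_scheme \<Rightarrow> 'a set \<Rightarrow> 'a set \<Rightarrow> 'a set"
  where "conj_act G h c = {g \<otimes>\<^bsub>G\<^esub> a \<otimes>\<^bsub>G\<^esub> inv\<^bsub>G\<^esub> g | g a. g \<in> h \<and> a \<in> c}"

definition algebra_act :: "('a, 'b) monoid_scheme \<Rightarrow> ('a set \<Rightarrow> complex) \<Rightarrow> ('a set \<Rightarrow> complex) \<Rightarrow>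
    'a set \<Rightarrow> complex"
  where "algebra_act G r f =
    (\<lambda>c. if c \<in> carrier (second_quotient G)
         then \<Sum>h\<in>{h. r h \<noteq> 0}. r h * f (conj_act G (inv\<^bsub>abelianization G\<^esub> h) c) else 0)"

text \<open>The \<open>\<complex>[G/G']\<close>-module \<open>(G'/G'') \<otimes> \<complex>\<close>. The fields \<open>mult\<close> and \<open>one\<close> of the record are irrelevant
  for modules.\<close>

definition alexander_module ::
    "('a, 'b) monoid_scheme \<Rightarrow> ('a set \<Rightarrow> complex, ('a set \<Rightarrow> complex) set) module"
  where "alexander_module G =
    (let Q = second_quotient G; R = tensor_relations Q in
     \<lparr>carrier = {{(\<lambda>x. f x + s x) | s. s \<in> R} | f. f \<in> fin_supp (carrier Q)},
      mult = undefined, one = undefined,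
      zero = R,
      add = (\<lambda>K L. {(\<lambda>x. f x + g x) | f g. f \<in> K \<and> g \<in> L}),
      smult = (\<lambda>r K. {(\<lambda>x. algebra_act G r f x + s x) | f s. f \<in> K \<and> s \<in> R})\<rparr>)"

text \<open>\<open>S\<^sup>m \<rightarrow> S\<^sup>n \<rightarrow> M \<rightarrow> 0\<close> is exact, where the first map sends the \<open>i\<close>-th basis vector to the
  \<open>i\<close>-th row of \<open>\<Phi>\<close> and the second one the \<open>j\<close>-th basis vector to \<open>e j\<close>.\<close>

definition presentation ::
    "('r, 'c) ring_scheme \<Rightarrow> ('r, 'v) module \<Rightarrow> nat \<Rightarrow> nat \<Rightarrow> (nat \<Rightarrow> nat \<Rightarrow> 'r) \<Rightarrow> bool"
  where "presentation S M m n \<Phi> \<longleftrightarrow>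
    (\<forall>i<m. \<forall>j<n. \<Phi> i j \<in> carrier S) \<and>
    (\<exists>e. (\<forall>j<n. e j \<in> carrier M) \<and>
       (\<forall>v\<in>carrier M. \<exists>s\<in>{..<n} \<rightarrow> carrier S. v = (\<Oplus>\<^bsub>M\<^esub>j\<in>{..<n}. s j \<odot>\<^bsub>M\<^esub> e j)) \<and>
       (\<forall>s\<in>{..<n} \<rightarrow> carrier S.
          (\<Oplus>\<^bsub>M\<^esub>j\<in>{..<n}. s j \<odot>\<^bsub>M\<^esub> e j) = \<zero>\<^bsub>M\<^esub> \<longleftrightarrow>
          (\<exists>t\<in>{..<m} \<rightarrow> carrier S. \<forall>j<n. s j = (\<Oplus>\<^bsub>S\<^esub>i\<in>{..<m}. t i \<otimes>\<^bsub>S\<^esub> \<Phi> i j))))"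

definition ring_det :: "('r, 'c) ring_scheme \<Rightarrow> nat \<Rightarrow> (nat \<Rightarrow> nat \<Rightarrow> 'r) \<Rightarrow> 'r"
  where "ring_det S k A =
    (\<Oplus>\<^bsub>S\<^esub>p\<in>{p. p permutes {..<k}}.
       if evenperm p then (\<Otimes>\<^bsub>S\<^esub>i\<in>{..<k}. A i (p i)) else \<ominus>\<^bsub>S\<^esub> (\<Otimes>\<^bsub>S\<^esub>i\<in>{..<k}. A i (p i)))"

definition minors :: "('r, 'c) ring_scheme \<Rightarrow> nat \<Rightarrow> nat \<Rightarrow> (nat \<Rightarrow> nat \<Rightarrow> 'r) \<Rightarrow> nat \<Rightarrow> 'r set"
  where "minors S m n \<Phi> k =
    {ring_det S k (\<lambda>i j. \<Phi> (\<rho> i) (\<sigma> j)) | \<rho> \<sigma>.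
       strict_mono_on {..<k} \<rho> \<and> \<rho> ` {..<k} \<subseteq> {..<m} \<and>
       strict_mono_on {..<k} \<sigma> \<and> \<sigma> ` {..<k} \<subseteq> {..<n}}"

text \<open>The truncated difference \<open>n - m\<close> of natural numbers is \<open>max {0, n - m}\<close>.\<close>

definition fitting_ideal :: "('r, 'c) ring_scheme \<Rightarrow> nat \<Rightarrow> nat \<Rightarrow> (nat \<Rightarrow> nat \<Rightarrow> 'r) \<Rightarrow> nat \<Rightarrow> 'r set"
  where "fitting_ideal S m n \<Phi> k =
    (if k \<le> n - m then {\<zero>\<^bsub>S\<^esub>}
     else if n < k then carrier S
     else Idl\<^bsub>S\<^esub> (minors S m n \<Phi> (n - k + 1)))"

text \<open>The value of an element of \<open>\<complex>[G/G']\<close> at a character of \<open>G\<close>, which is constant on the cosets \<open>h\<close>.\<close>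

definition eval_char :: "('a \<Rightarrow> complex) \<Rightarrow> ('a set \<Rightarrow> complex) \<Rightarrow> complex"
  where "eval_char \<xi> f = (\<Sum>h\<in>{h. f h \<noteq> 0}. f h * the_elem (\<xi> ` h))"

definition char_variety :: "('a, 'b) monoid_scheme \<Rightarrow> nat \<Rightarrow> nat \<Rightarrow>
    (nat \<Rightarrow> nat \<Rightarrow> 'a set \<Rightarrow> complex) \<Rightarrow> nat \<Rightarrow> ('a \<Rightarrow> complex) set"
  where "char_variety G m n \<Phi> k =
    {\<xi>\<in>characters G. \<forall>f\<in>fitting_ideal (group_algebra (abelianization G)) m n \<Phi> k. eval_char \<xi> f = 0}"

text \<open>\<open>\<Phi>\<close> is the \<open>m\<close> by \<open>n\<close> matrix of a finite presentation of \<open>(G'/G'') \<otimes> \<complex>\<close>; the depth does not depend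
  on its choice.\<close>

definition depth :: "('a, 'b) monoid_scheme \<Rightarrow> nat \<Rightarrow> nat \<Rightarrow>
    (nat \<Rightarrow> nat \<Rightarrow> 'a set \<Rightarrow> complex) \<Rightarrow> ('a \<Rightarrow> complex) \<Rightarrow> nat"
  where "depth G m n \<Phi> \<xi> = Max {k. \<xi> \<in> char_variety G m n \<Phi> k}"

definition null_orb :: "('n::finite, 'd::finite) orbi \<Rightarrow> 'n cproj \<Rightarrow> nat \<Rightarrow> nat \<Rightarrow>
    (nat \<Rightarrow> nat \<Rightarrow> (real \<Rightarrow> 'n cproj) set set set \<Rightarrow> complex) \<Rightarrow>
    ((real \<Rightarrow> 'n cproj) set set \<Rightarrow> complex) \<Rightarrow> nat"
  where "null_orb X x m n \<Phi> \<xi> = depth (orb_pi1 X x) m n \<Phi> \<xi>"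

end

theory Submission
  imports
    Defs
    "HOL-Library.Function_Algebras"
    "HOL-Algebra.Multiplicative_Group"
    "Jordan_Normal_Form.Determinant"
begin

text \<open>Only the groups matter: write \<open>G\<close> for the orbifold group of \<open>X\<close> and \<open>N\<close> for the image of that of \<open>Y\<close>.
  The rank of the abelianization of a group is the dimension of the space of its additive
  homomorphisms to \<open>\<complex>\<close>, because partial homomorphisms to the divisible group \<open>\<complex>\<close> extend. The finite abelian
  group \<open>G/N\<close> acts on \<open>Hom(N, \<complex>)\<close>, which is therefore the direct sum of the eigenspaces \<open>W\<^sub>\<xi>\<close>, where \<open>\<xi>\<close>
  runs through the characters of \<open>G/N\<close>. Restriction identifies \<open>Hom(G, \<complex>)\<close> with the invariants \<open>W\<^sub>1\<close>,
  and for \<open>\<xi> \<noteq> 1\<close> it identifies \<open>W\<^sub>\<xi>\<close> with the \<open>\<xi>\<close>-equivariant homomorphisms \<open>G' \<rightarrow> \<complex>\<close>, that is with the dual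
  of the fibre at \<open>\<xi>\<close> of the Alexander module. This dual is the nullspace of the presentation matrix
  evaluated at \<open>\<xi>\<close>, whose dimension is the depth of \<open>\<xi>\<close>. Homomorphisms are used in place of homology
  since they are plain functions.\<close>

section \<open>Dimension of spaces of complex functions\<close>

text \<open>Ranks and dimensions are extended naturals, both suprema over finite independent sets,
  so finite and infinite values are handled alike; torsion is invisible to both, because
  homomorphisms to \<complex> kill it. Divisibility is used twice: for \<complex> under addition to
  compare rank and dimension, and for the nonzero numbers under multiplication to produce enough
  characters of \<open>G/N\<close>. Restriction from \<open>G\<close> to \<open>N\<close> is
  invertible on invariants since, with \<open>n\<close> the order of \<open>G/N\<close>, every
  \<open>x^n\<close> lies in \<open>N\<close> and \<open>x \<mapsto> f(x^n)/n\<close> extends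
  \<open>f\<close>. Depth is a nullity because the minors of order \<open>n - k + 1\<close> all
  vanish at a character exactly when the evaluated matrix has rank at most \<open>n - k\<close>; the
  conventions at the two ends agree with this, as the nullity lies between \<open>n - m\<close> and
  \<open>n\<close>. The module consists of classes of finitely supported functions on cosets. To
  keep this manageable, identities in the group algebra and in the module are tested by pairing both
  sides with arbitrary functions.\<close>

interpretation cfun: vector_space "\<lambda>(c::complex) (f :: 'a \<Rightarrow> complex) x. c * f x"
  by unfold_locales (auto simp: fun_eq_iff algebra_simps)

text \<open>A supremum in \<open>enat\<close>, parallel to \<open>abelian_rank\<close>, since spaces
  of homomorphisms may have infinite dimension.\<close>

definition fdim :: "('a \<Rightarrow> complex) set \<Rightarrow> enat"
  where "fdim W = Sup {enat (card S) | S. finite S \<and> S \<subseteq> W \<and> cfun.independent S}"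

lemma fdim_ge:
  assumes "finite S" "S \<subseteq> W" "cfun.independent S"
  shows "enat (card S) \<le> fdim W"
  unfolding fdim_def by (rule Sup_upper) (use assms in blast)

lemma fdim_leI:
  assumes "\<And>S. finite S \<Longrightarrow> S \<subseteq> W \<Longrightarrow> cfun.independent S \<Longrightarrow> enat (card S) \<le> k"
  shows "fdim W \<le> k"
  unfolding fdim_def by (rule Sup_least) (use assms in blast)

lemma fdim_basis:
  assumes "B \<subseteq> W" "W \<subseteq> cfun.span B" "cfun.independent B"
  shows "fdim W = (if finite B then enat (card B) else \<infinity>)"
proof (cases "finite B")
  case True
  have "fdim W \<le> enat (card B)"
  proof (rule fdim_leI)
    fix S assume "finite S" "S \<subseteq> W" "cfun.independent S"
    then have "card S \<le> card B"
      using cfun.independent_span_bound[OF True] assms(2) by blast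
    then show "enat (card S) \<le> enat (card B)" by simp
  qed
  moreover have "enat (card B) \<le> fdim W" using True assms by (intro fdim_ge)
  ultimately show ?thesis using True by simp
next
  case False
  have "enat k \<le> fdim W" for k
  proof -
    obtain S where S: "finite S" "S \<subseteq> B" "card S = k"
      using infinite_arbitrarily_large[OF False] by blast
    then have "cfun.independent S" using assms(3) cfun.independent_mono by blast
    then show ?thesis using fdim_ge[of S W] S assms(1) by auto
  qed
  then have "fdim W = \<infinity>"
  proof (cases "fdim W")
    case (enat n)
    then show ?thesis using \<open>\<And>k. enat k \<le> fdim W\<close>[of "Suc n"] by simp
  qed
  then show ?thesis using False by simp
qed

lemma basis_exists:
  obtains B where "B \<subseteq> W" "W \<subseteq> cfun.span B" "cfun.independent B"
  by (rule cfun.maximal_independent_subset)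

lemma fdim_zero: "fdim {0 :: 'a \<Rightarrow> complex} = 0"
  using fdim_basis[OF _ _ cfun.independent_empty, of "{0}"] by (simp add: zero_enat_def)

text \<open>Linearity is stated pointwise, in the form that simplification proves for restriction
  and pullback maps.\<close>

locale fun_linear =
  fixes L :: "('a \<Rightarrow> complex) \<Rightarrow> 'b \<Rightarrow> complex"
  assumes lin_add: "L (\<lambda>x. f x + g x) = (\<lambda>y. L f y + L g y)"
    and lin_scale: "L (\<lambda>x. c * f x) = (\<lambda>y. c * L f y)"

sublocale fun_linear \<subseteq> Vector_Spaces.linear "\<lambda>c f x. c * f x" "\<lambda>c f x. c * f x" L
  by unfold_locales (simp_all add: lin_scale lin_add plus_fun_def)

text \<open>The isomorphisms below are obtained this way: a restriction or evaluation map is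
  injective on one space and has the other one as its image.\<close>

lemma (in fun_linear) fdim_image:
  assumes W: "cfun.subspace W" and inj: "inj_on L W"
  shows "fdim (L ` W) = fdim W"
proof -
  obtain B where B: "B \<subseteq> W" "W \<subseteq> cfun.span B" "cfun.independent B" by (rule basis_exists)
  have sp: "cfun.span B = W" using B W cfun.span_minimal by blast
  have injB: "inj_on L B" using inj B(1) inj_on_subset by blast
  have "L ` B \<subseteq> L ` W" using B by blast
  moreover have "L ` W \<subseteq> cfun.span (L ` B)" using span_image[of B] sp by simp
  moreover have "cfun.independent (L ` B)"
    using independent_injective_image[OF B(3)] inj sp by simp
  ultimately have "fdim (L ` W) = (if finite (L ` B) then enat (card (L ` B)) else \<infinity>)"
    by (rule fdim_basis)
  then show ?thesis using fdim_basis[OF B] injB by (simp add: card_image finite_image_iff)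
qed

text \<open>Bases of the two summands can be united: \<open>0\<close> lies in no independent set, so
  they are disjoint, and the two halves of a linear relation lie in
  \<open>V \<inter> W\<close>.\<close>

lemma fdim_sum:
  fixes V W :: "('a \<Rightarrow> complex) set"
  assumes V: "cfun.subspace V" and W: "cfun.subspace W" and VW: "V \<inter> W \<subseteq> {0}"
  shows "fdim {v + w | v w. v \<in> V \<and> w \<in> W} = fdim V + fdim W"
proof -
  obtain B where B: "B \<subseteq> V" "V \<subseteq> cfun.span B" "cfun.independent B" by (rule basis_exists)
  obtain C where C: "C \<subseteq> W" "W \<subseteq> cfun.span C" "cfun.independent C" by (rule basis_exists)
  have spB: "cfun.span B = V" and spC: "cfun.span C = W"
    using B V C W cfun.span_minimal by blast+
  have disj: "B \<inter> C = {}"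
    using B(1,3) C(1) VW cfun.dependent_zero by blast
  let ?S = "{v + w | v w. v \<in> V \<and> w \<in> W}"
  have sub: "B \<union> C \<subseteq> ?S"
  proof
    fix x assume "x \<in> B \<union> C"
    moreover have "x + 0 = x" "0 + x = x" by simp_all
    ultimately show "x \<in> ?S" using B(1) C(1) cfun.subspace_0[OF V] cfun.subspace_0[OF W]
      by (smt (verit, ccfv_threshold) Un_iff mem_Collect_eq subset_iff)
  qed
  have span: "?S \<subseteq> cfun.span (B \<union> C)"
    using cfun.span_Un[of B C] spB spC by auto
  have ind: "cfun.independent (B \<union> C)"
    unfolding cfun.independent_explicit_finite_subsets
  proof (intro allI impI ballI)
    fix S u v assume S: "S \<subseteq> B \<union> C" "finite S" and 0: "(\<Sum>v\<in>S. (\<lambda>x. u v * v x)) = 0" and v: "v \<in> S"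
    let ?b = "\<Sum>v\<in>S \<inter> B. (\<lambda>x. u v * v x)" and ?c = "\<Sum>v\<in>S \<inter> C. (\<lambda>x. u v * v x)"
    have "S = (S \<inter> B) \<union> (S \<inter> C)" using S by blast
    then have "?b + ?c = 0"
      using 0 sum.union_disjoint[of "S \<inter> B" "S \<inter> C" "\<lambda>v x. u v * v x"] S(2) disj
      by (metis Int_Un_distrib Un_Int_eq(3) disjoint_iff finite_Int inf_commute inf_left_commute inf_bot_right)
    moreover have bV: "?b \<in> V"
      by (rule cfun.subspace_sum[OF V]) (use B(1) cfun.subspace_scale[OF V] in auto)
    moreover have cW: "?c \<in> W"
      by (rule cfun.subspace_sum[OF W]) (use C(1) cfun.subspace_scale[OF W] in auto)
    ultimately have "?b = - ?c" by (simp add: eq_neg_iff_add_eq_0)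
    then have "?b \<in> W" using cW cfun.subspace_neg[OF W, of ?c] by simp
    then have b0: "?b = 0" using bV VW by blast
    then have c0: "?c = 0" using \<open>?b + ?c = 0\<close> by simp
    show "u v = 0"
    proof (cases "v \<in> B")
      case True
      then show ?thesis using B(3)[unfolded cfun.independent_explicit_finite_subsets] b0 S(2) v
        by (meson Int_iff finite_Int inf_le2)
    next
      case False
      then have "v \<in> S \<inter> C" using v S by blast
      then show ?thesis using C(3)[unfolded cfun.independent_explicit_finite_subsets] c0 S(2)
        by (meson finite_Int inf_le2)
    qed
  qed
  have "fdim ?S = (if finite (B \<union> C) then enat (card (B \<union> C)) else \<infinity>)"
    by (rule fdim_basis[OF sub span ind])
  then show ?thesis
    using fdim_basis[OF B] fdim_basis[OF C] card_Un_disjoint[of B C] disj by auto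
qed

text \<open>Points and functions that are biorthogonal under evaluation. \<open>S\<close> indexes
  the functions and is also the set of points: group elements for the rank, columns and rows of a
  matrix for the minors. Such a system witnesses a lower bound of a dimension and exhibits points
  that realize it.\<close>

definition dual_system :: "'a set \<Rightarrow> ('a \<Rightarrow> 'a \<Rightarrow> complex) \<Rightarrow> bool"
  where "dual_system S g \<longleftrightarrow> finite S \<and> (\<forall>s\<in>S. \<forall>t\<in>S. g s t = (if s = t then 1 else 0))"

lemma dual_system_eval:
  assumes "dual_system S g" "t \<in> S"
  shows "(\<Sum>s\<in>S. c s * g s t) = c t"
proof -
  have "(\<Sum>s\<in>S. c s * g s t) = (\<Sum>s\<in>S. if s = t then c s else 0)"
    by (rule sum.cong) (use assms in \<open>auto simp: dual_system_def\<close>)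
  then show ?thesis using assms by (simp add: dual_system_def)
qed

lemma sum_fun_apply: "(\<Sum>i\<in>I. f i :: 'a \<Rightarrow> complex) x = (\<Sum>i\<in>I. f i x)"
  by (induction I rule: infinite_finite_induct) auto

text \<open>Evaluating a linear relation at \<open>t\<close> leaves only the coefficient of
  \<open>g t\<close>.\<close>

lemma fdim_ge_dual_system:
  assumes d: "dual_system S g" and W: "\<And>s. s \<in> S \<Longrightarrow> g s \<in> W"
  shows "enat (card S) \<le> fdim W"
proof -
  have inj: "inj_on g S"
    using d by (intro inj_onI) (metis dual_system_def zero_neq_one)
  have "cfun.independent (g ` S)"
  proof (rule cfun.independent_if_scalars_zero)
    show "finite (g ` S)" using d by (simp add: dual_system_def)
    fix u v assume 0: "(\<Sum>v\<in>g ` S. (\<lambda>x. u v * v x)) = 0" and "v \<in> g ` S"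
    then obtain t where t: "t \<in> S" "v = g t" by blast
    have "(\<Sum>s\<in>S. (\<lambda>x. u (g s) * g s x)) = 0" using 0 by (simp add: sum.reindex[OF inj])
    from fun_cong[OF this, of t] have "(\<Sum>s\<in>S. u (g s) * g s t) = 0"
      by (simp add: sum_fun_apply)
    then show "u v = 0" using dual_system_eval[OF d t(1), of "\<lambda>s. u (g s)"] t by simp
  qed
  moreover have "card (g ` S) = card S" by (rule card_image[OF inj])
  ultimately show ?thesis using fdim_ge[of "g ` S" W] d W by (auto simp: dual_system_def)
qed

text \<open>Gaussian elimination, one function and one point at a time.\<close>

lemma dual_system_extend:
  assumes W: "cfun.subspace W" and d: "dual_system S g" and gW: "\<And>s. s \<in> S \<Longrightarrow> g s \<in> W"
    and h: "h \<in> W" "h \<noteq> 0" "\<And>t. t \<in> S \<Longrightarrow> h t = 0"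
  shows "\<exists>S' g'. dual_system S' g' \<and> card S' = Suc (card S) \<and> (\<forall>s\<in>S'. g' s \<in> W)"
proof -
  have fin: "finite S" using d by (simp add: dual_system_def)
  obtain x where x: "h x \<noteq> 0" using h(2) by (metis ext zero_fun_apply)
  define h1 where "h1 = (\<lambda>y. (1 / h x) * h y)"
  have h1: "h1 \<in> W" "h1 x = 1" "\<And>t. t \<in> S \<Longrightarrow> h1 t = 0"
    using cfun.subspace_scale[OF W h(1), of "1 / h x"] x h(3) by (auto simp: h1_def)
  have xS: "x \<notin> S" using h(3) x by blast
  \<comment> \<open>Subtracting a multiple of \<open>h1\<close> makes the old functions vanish at
    the new point \<open>x\<close>; their values at the old points are kept because
    \<open>h1\<close> vanishes there.\<close>
  define g' where "g' = (\<lambda>s. if s = x then h1 else g s - (\<lambda>y. g s x * h1 y))"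
  have "dual_system (insert x S) g'"
    using d h1 xS by (auto simp: dual_system_def g'_def)
  moreover have "card (insert x S) = Suc (card S)" using xS fin by simp
  moreover have "g' s \<in> W" if "s \<in> insert x S" for s
    using that h1(1) gW cfun.subspace_diff[OF W] cfun.subspace_scale[OF W h1(1)]
    by (auto simp: g'_def)
  ultimately show ?thesis by blast
qed

lemma dual_system_exists:
  assumes W: "cfun.subspace W" and k: "enat k \<le> fdim W"
  shows "\<exists>S g. dual_system S g \<and> card S = k \<and> (\<forall>s\<in>S. g s \<in> W)"
  using k
proof (induction k)
  case 0
  show ?case by (rule exI[of _ "{}"]) (simp add: dual_system_def)
next
  case (Suc k)
  have "enat k \<le> fdim W" using Suc.prems by (metis Suc_n_not_le_n enat_ord_simps(1) nle_le order_trans)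
  then obtain S g where S: "dual_system S g" "card S = k" "\<And>s. s \<in> S \<Longrightarrow> g s \<in> W"
    using Suc.IH by blast
  have fin: "finite S" using S by (simp add: dual_system_def)
  have "\<not> W \<subseteq> cfun.span (g ` S)"
  proof
    assume W: "W \<subseteq> cfun.span (g ` S)"
    have "fdim W \<le> enat k"
    proof (rule fdim_leI)
      fix T assume "finite T" "T \<subseteq> W" "cfun.independent T"
      then have "card T \<le> card (g ` S)"
        using cfun.independent_span_bound[of "g ` S" T] fin W by blast
      then show "enat (card T) \<le> enat k" using card_image_le[OF fin, of g] S(2) by simp
    qed
    then have "enat (Suc k) \<le> enat k" using Suc.prems order_trans by blast
    then show False by simp
  qed
  then obtain f where f: "f \<in> W" "f \<notin> cfun.span (g ` S)" by blast
  \<comment> \<open>\<open>p\<close> interpolates \<open>f\<close> at the points of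
    \<open>S\<close>, so \<open>f - p\<close> vanishes there; it is nonzero because \<open>f\<close>
    is outside the span.\<close>
  define p where "p = (\<Sum>s\<in>S. (\<lambda>x. f s * g s x))"
  have p: "p \<in> cfun.span (g ` S)" unfolding p_def
    by (intro cfun.span_sum cfun.span_scale cfun.span_base) blast
  have pW: "p \<in> W" unfolding p_def
    by (intro cfun.subspace_sum[OF W] cfun.subspace_scale[OF W]) (use S in blast)
  define h where "h = f - p"
  have hW: "h \<in> W" unfolding h_def using f pW cfun.subspace_diff[OF W] by blast
  have h0: "h t = 0" if "t \<in> S" for t
    using dual_system_eval[OF S(1) that, of f] by (simp add: h_def p_def sum_fun_apply)
  have "h \<noteq> 0" using f p unfolding h_def by auto
  then show ?case using dual_system_extend[OF W S(1,3) hW _ h0] S(2) by simp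
qed

text \<open>Each point \<open>s\<close> of a dual system satisfies \<open>g s s = 1\<close> and
  therefore lies in the common support \<open>T\<close>.\<close>

lemma fdim_finite_support:
  assumes "finite T" "\<And>f x. f \<in> W \<Longrightarrow> x \<notin> T \<Longrightarrow> f x = 0" "cfun.subspace W"
  shows "fdim W \<le> enat (card T)"
proof (rule ccontr)
  assume "\<not> ?thesis"
  then have "enat (Suc (card T)) \<le> fdim W" by (metis not_le eSuc_enat ileI1)
  then obtain S g where S: "dual_system S g" "card S = Suc (card T)" "\<forall>s\<in>S. g s \<in> W"
    using dual_system_exists[OF assms(3)] by blast
  have "S \<subseteq> T" using S assms(2) by (auto simp: dual_system_def) (metis zero_neq_one)
  then show False using card_mono[OF assms(1), of S] S by simp
qed

section \<open>Extension of homomorphisms and the rank of an abelian group\<close>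

lemma (in comm_monoid) m_interchange:
  assumes "a \<in> carrier G" "b \<in> carrier G" "c \<in> carrier G" "d \<in> carrier G"
  shows "(a \<otimes> b) \<otimes> (c \<otimes> d) = (a \<otimes> c) \<otimes> (b \<otimes> d)"
  using assms by (simp add: m_ac)

lemma DirProd_int_pow:
  assumes "group Q" "group D" "a \<in> carrier Q" "b \<in> carrier D"
  shows "(a, b) [^]\<^bsub>Q \<times>\<times> D\<^esub> (k::int) = (a [^]\<^bsub>Q\<^esub> k, b [^]\<^bsub>D\<^esub> k)"
proof -
  have "fst \<in> hom (Q \<times>\<times> D) Q" "snd \<in> hom (Q \<times>\<times> D) D" by (auto simp: hom_def)
  then have "fst ((a, b) [^]\<^bsub>Q \<times>\<times> D\<^esub> k) = a [^]\<^bsub>Q\<^esub> k" "snd ((a, b) [^]\<^bsub>Q \<times>\<times> D\<^esub> k) = b [^]\<^bsub>D\<^esub> k"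
    using hom_int_pow[of fst "Q \<times>\<times> D" Q "(a, b)" k] hom_int_pow[of snd "Q \<times>\<times> D" D "(a, b)" k]
      DirProd_group assms by auto
  then show ?thesis by (metis prod.collapse)
qed

text \<open>Dividing the two pairs gives the neutral element in the first coordinate, so the fibre
  over it controls all fibres: \<open>M\<close> is the graph of a partial function.\<close>

lemma functional_subgroup_unique:
  assumes Q: "group Q" and D: "group D" and M: "subgroup M (Q \<times>\<times> D)"
    and fn: "\<And>d. (\<one>\<^bsub>Q\<^esub>, d) \<in> M \<Longrightarrow> d = \<one>\<^bsub>D\<^esub>" and ab: "(a, b) \<in> M" "(a, b') \<in> M"
  shows "b = b'"
proof -
  interpret Q: group Q by fact
  interpret D: group D by fact
  interpret M: subgroup M "Q \<times>\<times> D" by fact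
  have C: "a \<in> carrier Q" "b \<in> carrier D" "b' \<in> carrier D" using M.subset ab by auto
  have "inv\<^bsub>Q \<times>\<times> D\<^esub> (a, b') = (inv\<^bsub>Q\<^esub> a, inv\<^bsub>D\<^esub> b')"
    using inv_DirProd[OF Q D] C by simp
  then have "(inv\<^bsub>Q\<^esub> a, inv\<^bsub>D\<^esub> b') \<in> M"
    using M.m_inv_closed[OF ab(2)] by simp
  from M.m_closed[OF ab(1) this] have "b \<otimes>\<^bsub>D\<^esub> inv\<^bsub>D\<^esub> b' = \<one>\<^bsub>D\<^esub>" using fn C by simp
  then show ?thesis using C by (metis D.inv_equality D.inv_inv D.inv_closed)
qed

text \<open>Partial homomorphisms are encoded by their graphs, i.e. by subgroups of \<open>Q \<times> D\<close> that meet the second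
  factor trivially. Divisibility of \<open>D\<close> provides the value at a point outside the domain.\<close>

lemma partial_hom_step:
  assumes Q: "comm_group Q" and D: "comm_group D"
    and div: "\<And>d n. d \<in> carrier D \<Longrightarrow> n > (0::nat) \<Longrightarrow> \<exists>e\<in>carrier D. e [^]\<^bsub>D\<^esub> n = d"
    and M: "subgroup M (Q \<times>\<times> D)" and fn: "\<And>d. (\<one>\<^bsub>Q\<^esub>, d) \<in> M \<Longrightarrow> d = \<one>\<^bsub>D\<^esub>"
    and q: "q \<in> carrier Q"
  shows "\<exists>c\<in>carrier D. \<forall>j::int. \<forall>e. (q [^]\<^bsub>Q\<^esub> j, e) \<in> M \<longrightarrow> e = c [^]\<^bsub>D\<^esub> j"
proof -
  interpret Q: comm_group Q by fact
  interpret D: comm_group D by fact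
  interpret P: group "Q \<times>\<times> D" by (rule DirProd_group) unfold_locales
  interpret M: subgroup M "Q \<times>\<times> D" by fact
  have MC: "a \<in> carrier Q" "b \<in> carrier D" if "(a, b) \<in> M" for a b
    using M.subset that by auto
  have mult: "(a \<otimes>\<^bsub>Q\<^esub> a', b \<otimes>\<^bsub>D\<^esub> b') \<in> M" if "(a, b) \<in> M" "(a', b') \<in> M" for a b a' b'
    using M.m_closed[OF that] by simp
  have uniq: "b = b'" if "(a, b) \<in> M" "(a, b') \<in> M" for a b b'
    using functional_subgroup_unique[OF Q.group_axioms D.group_axioms M] fn that by blast
  have pow: "(a [^]\<^bsub>Q\<^esub> k, b [^]\<^bsub>D\<^esub> k) \<in> M" if "(a, b) \<in> M" for a b and k :: int
    using P.subgroup_int_pow_closed[OF M that, of k] DirProd_int_pow[OF Q.group_axioms D.group_axioms] MC[OF that] by simp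
  \<comment> \<open>The exponents of the powers of \<open>q\<close> in the domain of
    \<open>M\<close> form a subgroup of the integers; \<open>J\<close> is its positive part.\<close>
  define J where "J = {n::nat. n > 0 \<and> (\<exists>e. (q [^]\<^bsub>Q\<^esub> int n, e) \<in> M)}"
  show ?thesis
  proof (cases "J = {}")
    case True
    \<comment> \<open>Only the exponent 0 occurs, so every value for \<open>q\<close> is admissible;
      the neutral element is taken.\<close>
    have "e = \<one>\<^bsub>D\<^esub> [^]\<^bsub>D\<^esub> j" if e: "(q [^]\<^bsub>Q\<^esub> j, e) \<in> M" for j :: int and e
    proof -
      have "j = 0"
      proof (rule ccontr)
        assume "j \<noteq> 0"
        have "(q [^]\<^bsub>Q\<^esub> \<bar>j\<bar>, e [^]\<^bsub>D\<^esub> sgn j) \<in> M"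
          using pow[OF e, of "sgn j"] q Q.int_pow_pow by (simp add: abs_sgn)
        then have "nat \<bar>j\<bar> \<in> J" using \<open>j \<noteq> 0\<close> by (auto simp: J_def)
        then show False using True by blast
      qed
      then show ?thesis using fn[of e] e by simp
    qed
    then show ?thesis by blast
  next
    case False
    define n where "n = (LEAST n. n \<in> J)"
    have "n \<in> J" unfolding n_def using False by (meson LeastI ex_in_conv)
    then obtain e0 where n: "n > 0" and e0: "(q [^]\<^bsub>Q\<^esub> int n, e0) \<in> M" by (auto simp: J_def)
    \<comment> \<open>The least element \<open>n\<close> generates the group of exponents, so it is
      enough that \<open>c\<close> be an \<open>n\<close>-th root of the value at the
      \<open>n\<close>-th power of \<open>q\<close>.\<close>
    obtain c where c: "c \<in> carrier D" "c [^]\<^bsub>D\<^esub> n = e0" using div[OF MC(2)[OF e0] n] by blast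
    have "e = c [^]\<^bsub>D\<^esub> j" if e: "(q [^]\<^bsub>Q\<^esub> j, e) \<in> M" for j :: int and e
    proof -
      define k where "k = j div int n"
      have e0k: "(q [^]\<^bsub>Q\<^esub> (int n * k), c [^]\<^bsub>D\<^esub> (int n * k)) \<in> M"
      proof -
        have "e0 = c [^]\<^bsub>D\<^esub> int n" using c(2) by (simp only: int_pow_int)
        then show ?thesis
          using pow[OF e0, of k] Q.int_pow_pow[OF q, of "int n" k] D.int_pow_pow[OF c(1), of "int n" k]
          by simp
      qed
      \<comment> \<open>Dividing the pair at \<open>j\<close> by the \<open>k\<close>-th power of
        the pair at \<open>n\<close> would make a nonzero remainder a smaller element of
        \<open>J\<close>.\<close>
      have "j mod int n = 0"
      proof (rule ccontr)
        assume nz: "j mod int n \<noteq> 0"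
        have "(q [^]\<^bsub>Q\<^esub> (- (int n * k)), inv\<^bsub>D\<^esub> (c [^]\<^bsub>D\<^esub> (int n * k))) \<in> M"
          using pow[OF e0k, of "-1"] q c by (simp add: Q.int_pow_pow D.int_pow_neg)
        from mult[OF e this] have "(q [^]\<^bsub>Q\<^esub> (j mod int n), e \<otimes>\<^bsub>D\<^esub> inv\<^bsub>D\<^esub> (c [^]\<^bsub>D\<^esub> (int n * k))) \<in> M"
          using q by (simp add: Q.int_pow_mult[symmetric] k_def minus_mult_div_eq_mod)
        then have "nat (j mod int n) \<in> J" using nz n
          by (auto simp: J_def) (metis n nat_int of_nat_0_less_iff pos_mod_sign not_less zero_less_nat_eq order_le_less)
        then have "n \<le> nat (j mod int n)" unfolding n_def by (rule Least_le)
        moreover have "j mod int n < int n" using n by simp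
        moreover have "0 \<le> j mod int n" using n by simp
        ultimately show False by linarith
      qed
      then have "j = int n * k" unfolding k_def by (simp add: mult_div_mod_eq[symmetric] mod_0_imp_dvd)
      then show ?thesis using uniq[OF e] e0k by simp
    qed
    then show ?thesis using c by blast
  qed
qed

text \<open>Divisible abelian groups are injective: by \<open>partial_hom_step\<close>, a graph that
  is not total can be enlarged, so a maximal one is total. Used with \<open>Cadd\<close> to extend
  coordinate functions and with \<open>Cstar\<close> to extend characters.\<close>

lemma partial_hom_extension:
  assumes Q: "comm_group Q" and D: "comm_group D"
    and div: "\<And>d n. d \<in> carrier D \<Longrightarrow> n > (0::nat) \<Longrightarrow> \<exists>e\<in>carrier D. e [^]\<^bsub>D\<^esub> n = d"
    and R: "subgroup R (Q \<times>\<times> D)" and fn: "\<And>d. (\<one>\<^bsub>Q\<^esub>, d) \<in> R \<Longrightarrow> d = \<one>\<^bsub>D\<^esub>"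
  shows "\<exists>F\<in>hom Q D. \<forall>q d. (q, d) \<in> R \<longrightarrow> F q = d"
proof -
  interpret Q: comm_group Q by fact
  interpret D: comm_group D by fact
  interpret P: group "Q \<times>\<times> D" by (rule DirProd_group) unfold_locales
  interpret P: comm_group "Q \<times>\<times> D"
    by (rule P.group_comm_groupI) (auto simp: Q.m_comm D.m_comm)
  define \<A> where "\<A> = {M. subgroup M (Q \<times>\<times> D) \<and> R \<subseteq> M \<and> (\<forall>d. (\<one>\<^bsub>Q\<^esub>, d) \<in> M \<longrightarrow> d = \<one>\<^bsub>D\<^esub>)}"
  have "\<exists>M\<in>\<A>. \<forall>X\<in>\<A>. M \<subseteq> X \<longrightarrow> X = M"
  proof (rule subset_Zorn_nonempty)
    show "\<A> \<noteq> {}" using R fn unfolding \<A>_def by blast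
    fix \<C> assume ne: "\<C> \<noteq> {}" and ch: "subset.chain \<A> \<C>"
    then have CA: "\<And>M. M \<in> \<C> \<Longrightarrow> M \<in> \<A>" by (auto simp: subset.chain_def)
    have CS: "subgroup M (Q \<times>\<times> D)" if "M \<in> \<C>" for M using CA[OF that] unfolding \<A>_def by blast
    have sub: "subgroup (\<Union>\<C>) (Q \<times>\<times> D)"
    proof (rule P.subgroupI)
      show "\<Union>\<C> \<subseteq> carrier (Q \<times>\<times> D)" using subgroup.subset[OF CS] by blast
      show "\<Union>\<C> \<noteq> {}" using ne subgroup.one_closed[OF CS] by blast
      show "inv\<^bsub>Q \<times>\<times> D\<^esub> a \<in> \<Union>\<C>" if "a \<in> \<Union>\<C>" for a
        using that subgroup.m_inv_closed[OF CS] by blast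
      fix a b assume "a \<in> \<Union>\<C>" "b \<in> \<Union>\<C>"
      then obtain A B where AB: "A \<in> \<C>" "B \<in> \<C>" "a \<in> A" "b \<in> B" by blast
      then have "A \<subseteq> B \<or> B \<subseteq> A" using ch by (auto simp: subset.chain_def)
      then show "a \<otimes>\<^bsub>Q \<times>\<times> D\<^esub> b \<in> \<Union>\<C>"
        using AB subgroup.m_closed[OF CS[OF AB(1)], of a b] subgroup.m_closed[OF CS[OF AB(2)], of a b]
        by blast
    qed
    show "\<Union>\<C> \<in> \<A>" unfolding \<A>_def using sub ne CA unfolding \<A>_def by blast
  qed
  then obtain M where MA: "M \<in> \<A>" and max: "\<And>X. X \<in> \<A> \<Longrightarrow> M \<subseteq> X \<Longrightarrow> X = M" by blast
  then have M: "subgroup M (Q \<times>\<times> D)" and RM: "R \<subseteq> M"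
    and Mfun: "\<And>d. (\<one>\<^bsub>Q\<^esub>, d) \<in> M \<Longrightarrow> d = \<one>\<^bsub>D\<^esub>" unfolding \<A>_def by blast+
  interpret M: subgroup M "Q \<times>\<times> D" by fact
  have MC: "a \<in> carrier Q" "b \<in> carrier D" if "(a, b) \<in> M" for a b
    using M.subset that by auto
  have total: "\<exists>d. (q, d) \<in> M" if q: "q \<in> carrier Q" for q
  proof -
    obtain c where c: "c \<in> carrier D" "\<And>j e. (q [^]\<^bsub>Q\<^esub> (j::int), e) \<in> M \<Longrightarrow> e = c [^]\<^bsub>D\<^esub> j"
      using partial_hom_step[OF Q D div M Mfun q] by blast
    let ?z = "(q, c)"
    have z: "?z \<in> carrier (Q \<times>\<times> D)" using q c by simp
    \<comment> \<open>The subgroup generated by the maximal graph and the new pair.\<close>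
    define M' where "M' = {m \<otimes>\<^bsub>Q \<times>\<times> D\<^esub> ?z [^]\<^bsub>Q \<times>\<times> D\<^esub> j | m j. m \<in> M \<and> (j::int) \<in> UNIV}"
    have sub: "subgroup M' (Q \<times>\<times> D)"
    proof (rule P.subgroupI)
      show "M' \<subseteq> carrier (Q \<times>\<times> D)"
        unfolding M'_def using P.m_closed P.int_pow_closed[OF z] M.mem_carrier by blast
      show "M' \<noteq> {}" unfolding M'_def using M.one_closed by blast
    next
      fix a assume "a \<in> M'"
      then obtain m and j :: int where a: "a = m \<otimes>\<^bsub>Q \<times>\<times> D\<^esub> ?z [^]\<^bsub>Q \<times>\<times> D\<^esub> j" "m \<in> M"
        unfolding M'_def by blast
      then have "inv\<^bsub>Q \<times>\<times> D\<^esub> a = inv\<^bsub>Q \<times>\<times> D\<^esub> m \<otimes>\<^bsub>Q \<times>\<times> D\<^esub> ?z [^]\<^bsub>Q \<times>\<times> D\<^esub> (- j)"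
        using P.inv_mult[OF M.mem_carrier P.int_pow_closed[OF z]] P.int_pow_neg[OF z] by simp
      then show "inv\<^bsub>Q \<times>\<times> D\<^esub> a \<in> M'" unfolding M'_def using M.m_inv_closed[OF a(2)] by blast
    next
      fix a b assume "a \<in> M'" "b \<in> M'"
      then obtain m m' and j j' :: int where a: "a = m \<otimes>\<^bsub>Q \<times>\<times> D\<^esub> ?z [^]\<^bsub>Q \<times>\<times> D\<^esub> j" "m \<in> M"
        and b: "b = m' \<otimes>\<^bsub>Q \<times>\<times> D\<^esub> ?z [^]\<^bsub>Q \<times>\<times> D\<^esub> j'" "m' \<in> M"
        unfolding M'_def by blast
      have "a \<otimes>\<^bsub>Q \<times>\<times> D\<^esub> b = (m \<otimes>\<^bsub>Q \<times>\<times> D\<^esub> m') \<otimes>\<^bsub>Q \<times>\<times> D\<^esub> ?z [^]\<^bsub>Q \<times>\<times> D\<^esub> (j + j')"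
        unfolding a(1) b(1) P.int_pow_mult[OF z]
        by (rule P.m_interchange)
          (use M.mem_carrier[OF a(2)] M.mem_carrier[OF b(2)] P.int_pow_closed[OF z] in blast)+
      then show "a \<otimes>\<^bsub>Q \<times>\<times> D\<^esub> b \<in> M'" unfolding M'_def using M.m_closed[OF a(2) b(2)] by blast
    qed
    have MM': "M \<subseteq> M'"
    proof
      fix m assume m: "m \<in> M"
      then have "m = m \<otimes>\<^bsub>Q \<times>\<times> D\<^esub> ?z [^]\<^bsub>Q \<times>\<times> D\<^esub> (0::int)"
        using P.r_one[OF M.mem_carrier[OF m]] by (simp only: int_pow_0)
      then show "m \<in> M'" unfolding M'_def using m by blast
    qed
    have "d = \<one>\<^bsub>D\<^esub>" if "(\<one>\<^bsub>Q\<^esub>, d) \<in> M'" for d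
    proof -
      obtain a b and j :: int where ab: "(\<one>\<^bsub>Q\<^esub>, d) = (a, b) \<otimes>\<^bsub>Q \<times>\<times> D\<^esub> ?z [^]\<^bsub>Q \<times>\<times> D\<^esub> j" "(a, b) \<in> M"
        using \<open>(\<one>\<^bsub>Q\<^esub>, d) \<in> M'\<close> unfolding M'_def by auto
      then have 1: "a \<otimes>\<^bsub>Q\<^esub> q [^]\<^bsub>Q\<^esub> j = \<one>\<^bsub>Q\<^esub>" "d = b \<otimes>\<^bsub>D\<^esub> c [^]\<^bsub>D\<^esub> j"
        using DirProd_int_pow[OF Q.group_axioms D.group_axioms q c(1), of j] by simp_all
      \<comment> \<open>The part from \<open>M\<close> of a pair over the neutral element lies over
        a power of \<open>q\<close>, where the choice of \<open>c\<close> prescribes the value; the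
        two contributions cancel.\<close>
      then have "a = q [^]\<^bsub>Q\<^esub> (- j)" using MC[OF ab(2)] q
        by (metis Q.int_pow_closed Q.int_pow_neg Q.inv_equality Q.inv_inv Q.m_comm)
      then have "b = c [^]\<^bsub>D\<^esub> (- j)" using c(2) ab(2) by blast
      then show ?thesis using 1 c(1) by (simp add: D.int_pow_neg)
    qed
    then have "M' \<in> \<A>" unfolding \<A>_def using sub MM' RM by blast
    then have "M' = M" using max MM' by blast
    moreover have "?z \<in> M'"
    proof -
      have "?z = \<one>\<^bsub>Q \<times>\<times> D\<^esub> \<otimes>\<^bsub>Q \<times>\<times> D\<^esub> ?z [^]\<^bsub>Q \<times>\<times> D\<^esub> (1::int)"
        using P.int_pow_1[OF z] P.l_one[OF z] by (simp only:)
      then show ?thesis unfolding M'_def using M.one_closed by blast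
    qed
    ultimately show ?thesis by blast
  qed
  have mult: "(a \<otimes>\<^bsub>Q\<^esub> a', b \<otimes>\<^bsub>D\<^esub> b') \<in> M" if "(a, b) \<in> M" "(a', b') \<in> M" for a b a' b'
    using M.m_closed[OF that] by simp
  have uniq: "b = b'" if "(a, b) \<in> M" "(a, b') \<in> M" for a b b'
    using functional_subgroup_unique[OF Q.group_axioms D.group_axioms M] Mfun that by blast
  define F where "F q = (SOME d. (q, d) \<in> M)" for q
  have F: "(q, F q) \<in> M" if "q \<in> carrier Q" for q
    unfolding F_def using total[OF that] by (rule someI_ex)
  have "F \<in> hom Q D"
  proof (rule homI)
    show "F q \<in> carrier D" if "q \<in> carrier Q" for q using F[OF that] MC by blast
    show "F (p \<otimes>\<^bsub>Q\<^esub> q) = F p \<otimes>\<^bsub>D\<^esub> F q" if "p \<in> carrier Q" "q \<in> carrier Q" for p q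
      using uniq[OF F mult[OF F F]] that by simp
  qed
  moreover have "F q = d" if "(q, d) \<in> R" for q d
    using uniq[OF F] that RM MC by blast
  ultimately show ?thesis by blast
qed

definition Cadd :: "complex monoid"
  where "Cadd = \<lparr>carrier = UNIV, mult = (+), one = 0\<rparr>"

lemma Cadd_simps [simp]:
  "carrier Cadd = UNIV" "a \<otimes>\<^bsub>Cadd\<^esub> b = a + b" "\<one>\<^bsub>Cadd\<^esub> = 0"
  by (simp_all add: Cadd_def)

lemma comm_group_Cadd: "comm_group Cadd"
  by (rule comm_groupI) (auto simp: algebra_simps intro: exI[of _ "- _"])

lemma Cadd_nat_pow [simp]: "z [^]\<^bsub>Cadd\<^esub> (n::nat) = of_nat n * z"
  by (induction n) (simp_all add: nat_pow_def algebra_simps)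

lemma Cadd_inv [simp]: "inv\<^bsub>Cadd\<^esub> z = - z"
proof -
  interpret comm_group Cadd by (rule comm_group_Cadd)
  show ?thesis by (rule inv_equality) auto
qed

lemma Cadd_int_pow [simp]: "z [^]\<^bsub>Cadd\<^esub> (n::int) = of_int n * z"
  by (simp add: int_pow_def2)

text \<open>Additive homomorphisms from \<open>P\<close> to \<complex>. \<open>P\<close> is a subset
  of an ambient \<open>G\<close>, and the value \<open>0\<close> off \<open>P\<close> makes equal
  homomorphisms equal as functions; all these sets thus become subspaces of one function
  space.\<close>

definition ahom :: "('a, 'b) monoid_scheme \<Rightarrow> 'a set \<Rightarrow> ('a \<Rightarrow> complex) set"
  where "ahom G P = {f. (\<forall>x\<in>P. \<forall>y\<in>P. f (x \<otimes>\<^bsub>G\<^esub> y) = f x + f y) \<and> (\<forall>x. x \<notin> P \<longrightarrow> f x = 0)}"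

lemma ahomI:
  assumes "\<And>x y. x \<in> P \<Longrightarrow> y \<in> P \<Longrightarrow> f (x \<otimes>\<^bsub>G\<^esub> y) = f x + f y" "\<And>x. x \<notin> P \<Longrightarrow> f x = 0"
  shows "f \<in> ahom G P"
  using assms by (simp add: ahom_def)

lemma ahom_mult: "f \<in> ahom G P \<Longrightarrow> x \<in> P \<Longrightarrow> y \<in> P \<Longrightarrow> f (x \<otimes>\<^bsub>G\<^esub> y) = f x + f y"
  by (simp add: ahom_def)

lemma ahom_outside: "f \<in> ahom G P \<Longrightarrow> x \<notin> P \<Longrightarrow> f x = 0"
  by (simp add: ahom_def)

lemma ahom_one:
  assumes "group G" "subgroup P G" "f \<in> ahom G P"
  shows "f \<one>\<^bsub>G\<^esub> = 0"
proof -
  interpret group G by fact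
  have "f (\<one>\<^bsub>G\<^esub> \<otimes>\<^bsub>G\<^esub> \<one>\<^bsub>G\<^esub>) = f \<one>\<^bsub>G\<^esub> + f \<one>\<^bsub>G\<^esub>"
    using ahom_mult[OF assms(3)] subgroup.one_closed[OF assms(2)] by blast
  then show ?thesis by simp
qed

lemma ahom_inv:
  assumes "group G" "subgroup P G" "f \<in> ahom G P" "x \<in> P"
  shows "f (inv\<^bsub>G\<^esub> x) = - f x"
proof -
  interpret group G by fact
  have "f (x \<otimes>\<^bsub>G\<^esub> inv\<^bsub>G\<^esub> x) = f x + f (inv\<^bsub>G\<^esub> x)"
    using ahom_mult[OF assms(3)] subgroup.m_inv_closed[OF assms(2)] assms(4) by blast
  then show ?thesis
    using ahom_one[OF assms(1-3)] subgroup.mem_carrier[OF assms(2,4)] by (simp add: eq_neg_iff_add_eq_0 add.commute)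
qed

lemma subspace_ahom: "cfun.subspace (ahom G P)"
  unfolding ahom_def by (rule cfun.subspaceI) (auto simp: algebra_simps)

lemma ahom_hom: "f \<in> ahom Q (carrier Q) \<Longrightarrow> f \<in> hom Q Cadd"
  by (auto simp: hom_def ahom_def)

lemma hom_finprod_int_pow:
  assumes Q: "comm_group Q" and f: "f \<in> hom Q Cadd" and S: "finite S" "S \<subseteq> carrier Q"
  shows "f (finprod Q (\<lambda>x. x [^]\<^bsub>Q\<^esub> (k x :: int)) S) = (\<Sum>x\<in>S. of_int (k x) * f x)"
proof -
  interpret Q: comm_group Q by fact
  interpret C: comm_group Cadd by (rule comm_group_Cadd)
  interpret group_hom Q Cadd f by unfold_locales (rule f)
  show ?thesis using S
  proof (induction S rule: finite_induct)
    case empty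
    then show ?case using hom_one by simp
  next
    case (insert x S)
    then have "(\<lambda>x. x [^]\<^bsub>Q\<^esub> k x) \<in> S \<rightarrow> carrier Q" "x \<in> carrier Q" by auto
    then show ?case using insert hom_int_pow[of x "k x"] by simp
  qed
qed

text \<open>Independence makes the coordinates well defined on the subgroup generated by
  \<open>S\<close>, and divisibility of \<complex> extends them to \<open>Q\<close>.\<close>

lemma int_independent_dual_system:
  assumes Q: "comm_group Q" and S: "int_independent Q S"
  shows "\<exists>g. dual_system S g \<and> (\<forall>s\<in>S. g s \<in> ahom Q (carrier Q))"
proof -
  interpret Q: comm_group Q by fact
  interpret C: comm_group Cadd by (rule comm_group_Cadd)
  interpret P: group "Q \<times>\<times> Cadd" by (rule DirProd_group) unfold_locales
  have fin: "finite S" and SQ: "S \<subseteq> carrier Q"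
    and ind: "\<And>k::_ \<Rightarrow> int. finprod Q (\<lambda>x. x [^]\<^bsub>Q\<^esub> k x) S = \<one>\<^bsub>Q\<^esub> \<Longrightarrow> \<forall>x\<in>S. k x = 0"
    using S unfolding int_independent_def by blast+
  let ?p = "\<lambda>k :: _ \<Rightarrow> int. finprod Q (\<lambda>x. x [^]\<^bsub>Q\<^esub> k x) S"
  have pow: "(\<lambda>x. x [^]\<^bsub>Q\<^esub> k x) \<in> S \<rightarrow> carrier Q" for k :: "_ \<Rightarrow> int" using SQ by auto
  have pcl: "?p k \<in> carrier Q" for k using pow by simp
  have padd: "?p k \<otimes>\<^bsub>Q\<^esub> ?p l = ?p (\<lambda>x. k x + l x)" for k l
  proof -
    have "?p (\<lambda>x. k x + l x) = finprod Q (\<lambda>x. x [^]\<^bsub>Q\<^esub> k x \<otimes>\<^bsub>Q\<^esub> x [^]\<^bsub>Q\<^esub> l x) S"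
      using SQ by (intro Q.finprod_cong') (auto simp: Q.int_pow_mult)
    then show ?thesis using Q.finprod_multf[OF pow[of k] pow[of l]] by simp
  qed
  have p0: "?p (\<lambda>x. 0) = \<one>\<^bsub>Q\<^esub>" by simp
  have pneg: "inv\<^bsub>Q\<^esub> (?p k) = ?p (\<lambda>x. - k x)" for k
    using padd[of "\<lambda>x. - k x" k] p0 pcl by (intro Q.inv_equality) auto
  have "\<exists>f\<in>ahom Q (carrier Q). \<forall>t\<in>S. f t = (if s = t then 1 else 0)" if s: "s \<in> S" for s
  proof -
    \<comment> \<open>The graph of the \<open>s\<close>-th coordinate: the product with exponents
      \<open>k\<close> is sent to \<open>k s\<close>.\<close>
    define R where "R = range (\<lambda>k :: _ \<Rightarrow> int. (?p k, of_int (k s) :: complex))"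
    have sub: "subgroup R (Q \<times>\<times> Cadd)"
    proof (rule P.subgroupI)
      show "R \<subseteq> carrier (Q \<times>\<times> Cadd)" using pcl by (auto simp: R_def)
      show "R \<noteq> {}" by (auto simp: R_def)
    next
      fix a assume "a \<in> R"
      then obtain k where a: "a = (?p k, of_int (k s))" by (auto simp: R_def)
      then have "inv\<^bsub>Q \<times>\<times> Cadd\<^esub> a = (?p (\<lambda>x. - k x), of_int (- k s))"
        using inv_DirProd[OF Q.group_axioms C.group_axioms pcl] by (simp add: pneg)
      then show "inv\<^bsub>Q \<times>\<times> Cadd\<^esub> a \<in> R"
        unfolding R_def by (intro range_eqI[where x = "\<lambda>x. - k x"]) simp
    next
      fix a b assume "a \<in> R" "b \<in> R"
      then obtain k l where a: "a = (?p k, of_int (k s))" and b: "b = (?p l, of_int (l s))"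
        by (auto simp: R_def)
      have "a \<otimes>\<^bsub>Q \<times>\<times> Cadd\<^esub> b = (?p (\<lambda>x. k x + l x), of_int (k s + l s))"
        by (simp add: a b padd)
      then show "a \<otimes>\<^bsub>Q \<times>\<times> Cadd\<^esub> b \<in> R"
        unfolding R_def by (intro range_eqI[where x = "\<lambda>x. k x + l x"]) simp
    qed
    have "d = \<one>\<^bsub>Cadd\<^esub>" if d: "(\<one>\<^bsub>Q\<^esub>, d) \<in> R" for d
    proof -
      obtain k where "?p k = \<one>\<^bsub>Q\<^esub>" "d = of_int (k s)" using d by (auto simp: R_def)
      then show ?thesis using ind[of k] s by simp
    qed
    moreover have "\<exists>e\<in>carrier Cadd. e [^]\<^bsub>Cadd\<^esub> n = d" if "n > 0" for d and n :: nat
      using that by (intro bexI[of _ "d / of_nat n"]) auto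
    ultimately obtain F where F: "F \<in> hom Q Cadd" "\<And>q d. (q, d) \<in> R \<Longrightarrow> F q = d"
      using partial_hom_extension[OF Q comm_group_Cadd _ sub] by blast
    define f where "f = (\<lambda>x. if x \<in> carrier Q then F x else 0)"
    have "f \<in> ahom Q (carrier Q)" using F(1) by (auto simp: f_def ahom_def hom_def)
    moreover have "f t = (if s = t then 1 else 0)" if t: "t \<in> S" for t
    proof -
      \<comment> \<open>The exponent vector supported at \<open>t\<close> represents
        \<open>t\<close> itself.\<close>
      have "?p (\<lambda>x. if x = t then 1 else 0) = finprod Q (\<lambda>x. if t = x then x else \<one>\<^bsub>Q\<^esub>) S"
        using SQ by (intro Q.finprod_cong') auto
      also have "\<dots> = t" using Q.finprod_singleton[OF t fin, of "\<lambda>x. x"] SQ by blast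
      finally have "(t, of_int (if s = t then 1 else 0)) \<in> R"
        unfolding R_def by (intro range_eqI[where x = "\<lambda>x. if x = t then 1 else 0"]) simp
      then show ?thesis using F(2) t SQ by (auto simp: f_def)
    qed
    ultimately show ?thesis by blast
  qed
  then obtain g where "\<forall>s\<in>S. g s \<in> ahom Q (carrier Q) \<and> (\<forall>t\<in>S. g s t = (if s = t then 1 else 0))"
    by metis
  then show ?thesis using fin by (intro exI[of _ g]) (auto simp: dual_system_def)
qed

text \<open>Dual systems mediate between the two suprema. An independent set carries one by
  extension of its coordinates; conversely the points of one are independent, because
  \<open>g t\<close> applied to an integer relation leaves the exponent at \<open>t\<close>.\<close>

lemma abelian_rank_eq_fdim:
  assumes Q: "comm_group Q"
  shows "abelian_rank Q = fdim (ahom Q (carrier Q))"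
proof (rule antisym)
  show "abelian_rank Q \<le> fdim (ahom Q (carrier Q))"
    unfolding abelian_rank_def
    using int_independent_dual_system[OF Q] fdim_ge_dual_system by (intro Sup_least) blast
  have "int_independent Q S"
    if S: "dual_system S g" "\<forall>s\<in>S. g s \<in> ahom Q (carrier Q)" for S g
  proof -
    have fin: "finite S" using S by (simp add: dual_system_def)
    have SQ: "S \<subseteq> carrier Q" using S by (auto simp: dual_system_def ahom_def) (metis zero_neq_one)
    have "k t = 0" if 1: "finprod Q (\<lambda>x. x [^]\<^bsub>Q\<^esub> k x) S = \<one>\<^bsub>Q\<^esub>" and t: "t \<in> S" for k :: "_ \<Rightarrow> int" and t
    proof -
      have gt: "g t \<in> hom Q Cadd" using S t by (auto intro: ahom_hom)
      interpret group_hom Q Cadd "g t"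
        using Q comm_group_Cadd gt by (simp add: group_hom_def group_hom_axioms_def comm_group.axioms)
      have "(\<Sum>x\<in>S. of_int (k x) * g t x) = 0"
        using hom_finprod_int_pow[OF Q gt fin SQ, of k] 1 hom_one by simp
      moreover have "(\<Sum>x\<in>S. of_int (k x) * g t x) = (\<Sum>x\<in>S. if t = x then of_int (k x) else 0)"
        by (rule sum.cong) (use S t in \<open>auto simp: dual_system_def\<close>)
      ultimately show ?thesis using fin t by simp
    qed
    then show ?thesis unfolding int_independent_def using fin SQ by blast
  qed
  then have le: "enat (card S) \<le> abelian_rank Q"
    if "dual_system S g" "\<forall>s\<in>S. g s \<in> ahom Q (carrier Q)" for S g
    unfolding abelian_rank_def using that by (intro Sup_upper) blast
  show "fdim (ahom Q (carrier Q)) \<le> abelian_rank Q"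
  proof (rule fdim_leI)
    fix S assume "finite S" "S \<subseteq> ahom Q (carrier Q)" "cfun.independent S"
    then have "enat (card S) \<le> fdim (ahom Q (carrier Q))" by (rule fdim_ge)
    then show "enat (card S) \<le> abelian_rank Q"
      using dual_system_exists[OF subspace_ahom] le by metis
  qed
qed

section \<open>Characters of finite abelian groups and the eigenspace decomposition\<close>

lemma Cstar_simps [simp]:
  "carrier Cstar = - {0}" "a \<otimes>\<^bsub>Cstar\<^esub> b = a * b" "\<one>\<^bsub>Cstar\<^esub> = 1"
  by (simp_all add: Cstar_def)

lemma comm_group_Cstar: "comm_group Cstar"
proof (rule comm_groupI)
  show "\<exists>y\<in>carrier Cstar. y \<otimes>\<^bsub>Cstar\<^esub> x = \<one>\<^bsub>Cstar\<^esub>" if "x \<in> carrier Cstar" for x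
    using that by (intro bexI[of _ "inverse x"]) auto
qed auto

lemma Cstar_nat_pow [simp]: "z [^]\<^bsub>Cstar\<^esub> (n::nat) = z ^ n"
  by (induction n) (simp_all add: nat_pow_def mult.commute)

lemma Cstar_divisible:
  assumes "d \<in> carrier Cstar" "n > (0::nat)"
  shows "\<exists>e\<in>carrier Cstar. e [^]\<^bsub>Cstar\<^esub> n = d"
proof
  show "exp (Ln d / of_nat n) \<in> carrier Cstar" by simp
  show "exp (Ln d / of_nat n) [^]\<^bsub>Cstar\<^esub> n = d"
    using assms by (simp add: exp_of_nat_mult[symmetric])
qed

lemma characters_mult:
  "\<xi> \<in> characters H \<Longrightarrow> a \<in> carrier H \<Longrightarrow> b \<in> carrier H \<Longrightarrow> \<xi> (a \<otimes>\<^bsub>H\<^esub> b) = \<xi> a * \<xi> b"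
  by (simp add: characters_def hom_def)

lemma characters_nonzero: "\<xi> \<in> characters H \<Longrightarrow> a \<in> carrier H \<Longrightarrow> \<xi> a \<noteq> 0"
  by (auto simp: characters_def hom_def)

lemma characters_one: "group H \<Longrightarrow> \<xi> \<in> characters H \<Longrightarrow> \<xi> \<one>\<^bsub>H\<^esub> = 1"
  using characters_mult[of \<xi> H "\<one>\<^bsub>H\<^esub>" "\<one>\<^bsub>H\<^esub>"] characters_nonzero[of \<xi> H "\<one>\<^bsub>H\<^esub>"]
    group.is_monoid monoid.one_closed monoid.l_one by fastforce

lemma characters_inv:
  assumes "group H" "\<xi> \<in> characters H" "a \<in> carrier H"
  shows "\<xi> (inv\<^bsub>H\<^esub> a) = inverse (\<xi> a)"
proof -
  interpret group H by fact
  have "\<xi> a * \<xi> (inv\<^bsub>H\<^esub> a) = 1"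
    using characters_mult[OF assms(2,3), of "inv\<^bsub>H\<^esub> a"] characters_one[OF assms(1,2)] assms(3) by simp
  then show ?thesis by (simp add: inverse_unique)
qed

lemma trivial_char_in: "group H \<Longrightarrow> trivial_char H \<in> characters H"
  by (auto simp: trivial_char_def characters_def hom_def group.is_monoid monoid.m_closed)

lemma characters_prod:
  assumes "group H" "\<xi> \<in> characters H" "\<eta> \<in> characters H"
  shows "(\<lambda>a\<in>carrier H. \<xi> a * \<eta> a) \<in> characters H"
  using assms by (auto simp: characters_def hom_def group.is_monoid monoid.m_closed)

lemma characters_inverse:
  assumes "group H" "\<xi> \<in> characters H"
  shows "(\<lambda>a\<in>carrier H. inverse (\<xi> a)) \<in> characters H"
  using assms by (auto simp: characters_def hom_def group.is_monoid monoid.m_closed)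

text \<open>The character is prescribed on the cyclic subgroup of \<open>a\<close>, sending
  \<open>a\<close> to a root of unity other than \<open>1\<close> whose order divides that of
  \<open>a\<close>, and is then extended by divisibility of \<open>Cstar\<close>.\<close>

lemma characters_separate:
  assumes A: "comm_group A" and fin: "finite (carrier A)" and a: "a \<in> carrier A" "a \<noteq> \<one>\<^bsub>A\<^esub>"
  shows "\<exists>\<xi>\<in>characters A. \<xi> a \<noteq> 1"
proof -
  interpret A: comm_group A by fact
  interpret C: comm_group Cstar by (rule comm_group_Cstar)
  interpret P: group "A \<times>\<times> Cstar" by (rule DirProd_group) unfold_locales
  define n where "n = A.ord a"
  have n: "n \<ge> 1" using A.ord_ge_1[OF fin a(1)] by (simp add: n_def)
  have n1: "n \<noteq> 1" using A.ord_eq_1[OF a(1)] a(2) by (simp add: n_def)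
  \<comment> \<open>There are exactly \<open>n\<close> roots of unity of exponent \<open>n\<close>,
    and \<open>n\<close> is not \<open>1\<close>.\<close>
  have "\<exists>\<zeta>::complex. \<zeta> ^ n = 1 \<and> \<zeta> \<noteq> 1"
  proof (rule ccontr)
    assume "\<not> ?thesis"
    then have "{z::complex. z ^ n = 1} = {1}" by auto
    then show False using card_complex_roots_unity[OF n] n1 by simp
  qed
  then obtain \<zeta> :: complex where \<zeta>: "\<zeta> ^ n = 1" "\<zeta> \<noteq> 1" by blast
  have \<zeta>C: "\<zeta> \<in> carrier Cstar" using \<zeta>(1) n by (auto simp: power_0_left)
  define R where "R = range (\<lambda>k::int. (a [^]\<^bsub>A\<^esub> k, \<zeta> [^]\<^bsub>Cstar\<^esub> k))"
  have R: "R = range (\<lambda>k::int. (a, \<zeta>) [^]\<^bsub>A \<times>\<times> Cstar\<^esub> k)"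
    unfolding R_def using DirProd_int_pow[OF A.group_axioms C.group_axioms a(1) \<zeta>C] by simp
  have z: "(a, \<zeta>) \<in> carrier (A \<times>\<times> Cstar)" using a \<zeta>C by simp
  have sub: "subgroup R (A \<times>\<times> Cstar)"
  proof (rule P.subgroupI)
    show "R \<subseteq> carrier (A \<times>\<times> Cstar)" unfolding R using P.int_pow_closed[OF z] by blast
    show "R \<noteq> {}" unfolding R by blast
    fix x assume "x \<in> R"
    then obtain k :: int where x: "x = (a, \<zeta>) [^]\<^bsub>A \<times>\<times> Cstar\<^esub> k" unfolding R by blast
    show "inv\<^bsub>A \<times>\<times> Cstar\<^esub> x \<in> R"
      unfolding R x using P.int_pow_neg[OF z, of k] by (metis rangeI)
    fix y assume "y \<in> R"
    then obtain l :: int where y: "y = (a, \<zeta>) [^]\<^bsub>A \<times>\<times> Cstar\<^esub> l" unfolding R by blast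
    show "x \<otimes>\<^bsub>A \<times>\<times> Cstar\<^esub> y \<in> R"
      unfolding R x y using P.int_pow_mult[OF z, of k l] by (metis rangeI)
  qed
  \<comment> \<open>Every exponent that kills \<open>a\<close> is a multiple of \<open>n\<close> and
    so also kills \<open>\<zeta>\<close>: the graph is functional.\<close>
  have "d = \<one>\<^bsub>Cstar\<^esub>" if d: "(\<one>\<^bsub>A\<^esub>, d) \<in> R" for d
  proof -
    obtain k :: int where k: "a [^]\<^bsub>A\<^esub> k = \<one>\<^bsub>A\<^esub>" "d = \<zeta> [^]\<^bsub>Cstar\<^esub> k" using d unfolding R_def by auto
    then have "int n dvd k" using A.int_pow_eq_id[OF a(1)] by (simp add: n_def)
    then obtain l where l: "k = int n * l" by blast
    have "d = (\<zeta> [^]\<^bsub>Cstar\<^esub> int n) [^]\<^bsub>Cstar\<^esub> l"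
      using k(2) l C.int_pow_pow[OF \<zeta>C, of "int n" l] by simp
    also have "\<zeta> [^]\<^bsub>Cstar\<^esub> int n = \<one>\<^bsub>Cstar\<^esub>" using \<zeta>(1) by (simp add: int_pow_int)
    finally show ?thesis by (simp only: C.int_pow_one)
  qed
  then obtain F where F: "F \<in> hom A Cstar" "\<And>q d. (q, d) \<in> R \<Longrightarrow> F q = d"
    using partial_hom_extension[OF A comm_group_Cstar Cstar_divisible sub] by blast
  have "(a, \<zeta>) \<in> R" unfolding R using P.int_pow_1[OF z] by (metis rangeI)
  then have "F a \<noteq> 1" using F(2) \<zeta>(2) by auto
  moreover have "restrict F (carrier A) \<in> characters A"
    using F(1) by (auto simp: characters_def hom_def Pi_def)
  ultimately show ?thesis using a(1) by (metis restrict_apply')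
qed

text \<open>All values are roots of unity of exponent \<open>order A\<close>, which leaves finitely
  many extensional functions.\<close>

lemma finite_characters:
  assumes A: "group A" and fin: "finite (carrier A)"
  shows "finite (characters A)"
proof -
  interpret group A by fact
  define n where "n = order A"
  have n: "n > 0" using fin order_gt_0_iff_finite by (simp add: n_def)
  have "\<xi> \<in> carrier A \<rightarrow>\<^sub>E {z. z ^ n = 1}" if \<xi>: "\<xi> \<in> characters A" for \<xi>
  proof -
    interpret C: comm_group Cstar by (rule comm_group_Cstar)
    have h: "\<xi> \<in> hom A Cstar" using \<xi> by (simp add: characters_def)
    interpret group_hom A Cstar \<xi> by unfold_locales (rule h)
    have "\<xi> a ^ n = 1" if a: "a \<in> carrier A" for a
      using hom_nat_pow[OF a, of n] pow_order_eq_1[OF a] hom_one by (simp add: n_def)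
    then show ?thesis using \<xi> by (auto simp: characters_def PiE_def)
  qed
  then have "characters A \<subseteq> carrier A \<rightarrow>\<^sub>E {z::complex. z ^ n = 1}" by blast
  moreover have "finite (carrier A \<rightarrow>\<^sub>E {z::complex. z ^ n = 1})"
    using fin n by (intro finite_PiE finite_roots_unity) auto
  ultimately show ?thesis by (rule finite_subset)
qed

text \<open>Translation by \<open>b\<close> permutes the group and multiplies the sum by
  \<open>\<xi> b\<close>.\<close>

lemma sum_character_eq_0:
  assumes A: "comm_group A" and \<xi>: "\<xi> \<in> characters A" "b \<in> carrier A" "\<xi> b \<noteq> 1"
  shows "(\<Sum>a\<in>carrier A. \<xi> a) = 0"
proof -
  interpret comm_group A by fact
  have "(\<Sum>a\<in>carrier A. \<xi> a) = (\<Sum>a\<in>carrier A. \<xi> (b \<otimes>\<^bsub>A\<^esub> a))"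
    by (rule sum.reindex_bij_witness[of _ "\<lambda>a. b \<otimes>\<^bsub>A\<^esub> a" "\<lambda>a. inv\<^bsub>A\<^esub> b \<otimes>\<^bsub>A\<^esub> a"])
      (use \<xi>(2) in \<open>auto simp: m_assoc[symmetric]\<close>)
  also have "\<dots> = \<xi> b * (\<Sum>a\<in>carrier A. \<xi> a)"
    using characters_mult[OF \<xi>(1,2)] by (simp add: sum_distrib_left)
  finally show ?thesis using \<xi>(3) by simp
qed

text \<open>The dual orthogonality relation: here the translation is by a character
  \<open>\<eta>\<close> with \<open>\<eta> a \<noteq> 1\<close>. Inverse values are summed because
  these occur in the projectors.\<close>

lemma sum_characters_eq_0:
  assumes A: "comm_group A" and fin: "finite (carrier A)" and a: "a \<in> carrier A" "a \<noteq> \<one>\<^bsub>A\<^esub>"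
  shows "(\<Sum>\<xi>\<in>characters A. inverse (\<xi> a)) = 0"
proof -
  interpret comm_group A by fact
  obtain \<eta> where \<eta>: "\<eta> \<in> characters A" "\<eta> a \<noteq> 1" using characters_separate[OF assms] by blast
  let ?p = "\<lambda>\<xi>. \<lambda>a\<in>carrier A. \<eta> a * \<xi> a"
  let ?q = "\<lambda>\<xi>. \<lambda>a\<in>carrier A. inverse (\<eta> a) * \<xi> a"
  have q: "?q \<xi> \<in> characters A" if "\<xi> \<in> characters A" for \<xi>
    using characters_prod[OF group_axioms characters_inverse[OF group_axioms \<eta>(1)] that]
    by (simp add: restrict_def cong: if_cong)
  have pq: "?p (?q \<xi>) = \<xi>" "?q (?p \<xi>) = \<xi>" if "\<xi> \<in> characters A" for \<xi>
    using characters_nonzero[OF \<eta>(1)] that by (auto simp: characters_def fun_eq_iff extensional_def)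
  have "(\<Sum>\<xi>\<in>characters A. inverse (\<xi> a)) = (\<Sum>\<xi>\<in>characters A. inverse (?p \<xi> a))"
    by (rule sum.reindex_bij_witness[of _ ?p ?q])
      (use q pq characters_prod[OF group_axioms \<eta>(1)] in auto)
  also have "\<dots> = inverse (\<eta> a) * (\<Sum>\<xi>\<in>characters A. inverse (\<xi> a))"
    using a(1) by (simp add: sum_distrib_left)
  finally show ?thesis using \<eta>(2) by simp
qed

text \<open>Directness is expressed through projectors \<open>P i\<close>, which are at hand for
  eigenspaces: an element of \<open>E j\<close> that is also a sum of elements of the other spaces
  is both fixed and annihilated by \<open>P j\<close>.\<close>

lemma fdim_direct_sum:
  fixes E :: "'i \<Rightarrow> ('a \<Rightarrow> complex) set"
  assumes fin: "finite S" and E: "\<And>i. i \<in> S \<Longrightarrow> cfun.subspace (E i)"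
    and P_add: "\<And>i v w. P i (v + w) = P i v + P i w"
    and P_self: "\<And>i v. i \<in> S \<Longrightarrow> v \<in> E i \<Longrightarrow> P i v = v"
    and P_other: "\<And>i j v. i \<in> S \<Longrightarrow> j \<in> S \<Longrightarrow> i \<noteq> j \<Longrightarrow> v \<in> E j \<Longrightarrow> P i v = 0"
  shows "cfun.subspace {\<Sum>i\<in>S. F i | F. \<forall>i\<in>S. F i \<in> E i} \<and>
    fdim {\<Sum>i\<in>S. F i | F. \<forall>i\<in>S. F i \<in> E i} = (\<Sum>i\<in>S. fdim (E i))"
  using fin E P_self P_other
proof (induction S rule: finite_induct)
  case empty
  have "{\<Sum>i\<in>{}. F i | F. \<forall>i\<in>{}. F i \<in> E i} = {0 :: 'a \<Rightarrow> complex}" by auto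
  then show ?case by (simp only: fdim_zero cfun.subspace_single_0 sum.empty simp_thms)
next
  case (insert j S)
  let ?V = "{\<Sum>i\<in>S. F i | F. \<forall>i\<in>S. F i \<in> E i}"
  have V: "cfun.subspace ?V" "fdim ?V = (\<Sum>i\<in>S. fdim (E i))"
  proof -
    have "cfun.subspace ?V \<and> fdim ?V = (\<Sum>i\<in>S. fdim (E i))"
      by (rule insert.IH)
        (use insert.prems(1) in blast, use insert.prems(2) in blast, use insert.prems(3) in blast)
    then show "cfun.subspace ?V" "fdim ?V = (\<Sum>i\<in>S. fdim (E i))" by blast+
  qed
  have Ej: "cfun.subspace (E j)" using insert.prems by blast
  have eq: "{\<Sum>i\<in>insert j S. F i | F. \<forall>i\<in>insert j S. F i \<in> E i} = {v + w | v w. v \<in> E j \<and> w \<in> ?V}"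
    (is "?L = ?R")
  proof
    show "?L \<subseteq> ?R" using insert.hyps by auto
    show "?R \<subseteq> ?L"
    proof
      fix f assume "f \<in> ?R"
      then obtain v F where f: "f = v + (\<Sum>i\<in>S. F i)" "v \<in> E j" "\<forall>i\<in>S. F i \<in> E i" by blast
      have "(\<Sum>i\<in>S. (F(j := v)) i) = (\<Sum>i\<in>S. F i)"
        using insert.hyps by (intro sum.cong) auto
      then have "f = (\<Sum>i\<in>insert j S. (F(j := v)) i)" using f(1) insert.hyps by simp
      moreover have "\<forall>i\<in>insert j S. (F(j := v)) i \<in> E i" using f insert.hyps by auto
      ultimately show "f \<in> ?L" by blast
    qed
  qed
  have P0: "P j 0 = 0" using P_add[of j 0 0] by simp
  have "w = 0" if w: "w \<in> E j" "w \<in> ?V" for w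
  proof -
    obtain F where F: "w = (\<Sum>i\<in>S. F i)" "\<forall>i\<in>S. F i \<in> E i" using w(2) by blast
    have "P j (\<Sum>i\<in>T. F i) = (\<Sum>i\<in>T. P j (F i))" for T
      by (induction T rule: infinite_finite_induct)
        (simp_all only: P0 P_add sum.infinite sum.empty sum.insert not_False_eq_True)
    moreover have "(\<Sum>i\<in>S. P j (F i)) = 0"
      using F(2) insert.hyps insert.prems(3) by (intro sum.neutral ballI) (metis insertCI)
    moreover have "P j w = w" by (rule insert.prems(2)) (use w(1) in simp_all)
    ultimately show ?thesis unfolding F(1) by metis
  qed
  then have "E j \<inter> ?V \<subseteq> {0}" by blast
  from fdim_sum[OF Ej V(1) this] show ?case
    unfolding eq using V(2) insert.hyps cfun.subspace_sums[OF Ej V(1)] by simp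
qed

text \<open>For \<open>P = N\<close> these are the eigenspaces \<open>W\<^sub>\<xi>\<close>. The
  eigenvalue \<open>\<theta>\<close> is a function on \<open>G\<close> rather than on
  \<open>G/N\<close>, so that the same definition with \<open>P = G'\<close> gives the equivariant
  homomorphisms.\<close>

definition eigenhom :: "('a, 'b) monoid_scheme \<Rightarrow> 'a set \<Rightarrow> ('a \<Rightarrow> complex) \<Rightarrow> ('a \<Rightarrow> complex) set"
  where "eigenhom G P \<theta> =
    {f\<in>ahom G P. \<forall>g\<in>carrier G. \<forall>x\<in>P. f (g \<otimes>\<^bsub>G\<^esub> x \<otimes>\<^bsub>G\<^esub> inv\<^bsub>G\<^esub> g) = \<theta> g * f x}"

lemma eigenhomD: "f \<in> eigenhom G P \<theta> \<Longrightarrow> f \<in> ahom G P"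
  and eigenhom_conj: "f \<in> eigenhom G P \<theta> \<Longrightarrow> g \<in> carrier G \<Longrightarrow> x \<in> P \<Longrightarrow>
    f (g \<otimes>\<^bsub>G\<^esub> x \<otimes>\<^bsub>G\<^esub> inv\<^bsub>G\<^esub> g) = \<theta> g * f x"
  by (auto simp: eigenhom_def)

lemma subspace_eigenhom: "cfun.subspace (eigenhom G P \<theta>)"
  unfolding eigenhom_def ahom_def by (rule cfun.subspaceI) (auto simp: algebra_simps)

lemma (in group) inv_mult_cancel:
  "x \<in> carrier G \<Longrightarrow> y \<in> carrier G \<Longrightarrow> inv x \<otimes> (x \<otimes> y) = y"
  by (simp add: m_assoc[symmetric])

section \<open>The action of the finite quotient on the homomorphisms of the normal subgroup\<close>

locale finite_abelian_quotient = normal N G for N and G (structure) +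
  assumes comm_quot: "comm_group (G Mod N)" and fin_quot: "finite (carrier (G Mod N))"
begin

lemma coset_closed: "g \<in> carrier G \<Longrightarrow> N #> g \<in> carrier (G Mod N)"
  by (auto simp: carrier_FactGroup)

lemma coset_mult: "g \<in> carrier G \<Longrightarrow> h \<in> carrier G \<Longrightarrow> (N #> g) \<otimes>\<^bsub>G Mod N\<^esub> (N #> h) = N #> (g \<otimes> h)"
  by (simp add: rcos_sum)

text \<open>Representatives turn conjugation by elements of \<open>G\<close> into an action of
  \<open>G Mod N\<close> on \<open>ahom G N\<close>; by \<open>ahom_conj_coset\<close> their choice
  does not matter.\<close>

definition rep :: "'a set \<Rightarrow> 'a"
  where "rep c = (SOME g. g \<in> carrier G \<and> N #> g = c)"

lemma rep: "c \<in> carrier (G Mod N) \<Longrightarrow> rep c \<in> carrier G \<and> N #> rep c = c"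
  unfolding rep_def by (rule someI_ex) (auto simp: carrier_FactGroup)

text \<open>An element \<open>k\<close> of \<open>N\<close> acts trivially because the values
  commute: \<open>f k + f y - f k = f y\<close>.\<close>

lemma ahom_conj_coset:
  assumes f: "f \<in> ahom G N" and x: "x \<in> N" and gh: "g \<in> carrier G" "h \<in> carrier G" "N #> g = N #> h"
  shows "f (g \<otimes> x \<otimes> inv g) = f (h \<otimes> x \<otimes> inv h)"
proof -
  have "g \<in> N #> h" using gh rcos_self[OF gh(1) subgroup_axioms] by simp
  then obtain k where k: "k \<in> N" "g = k \<otimes> h" by (auto simp: r_coset_def)
  have kC: "k \<in> carrier G" "x \<in> carrier G" using k x by auto
  define y where "y = h \<otimes> x \<otimes> inv h"
  have y: "y \<in> N" unfolding y_def using inv_op_closed2[OF gh(2) x] .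
  have "g \<otimes> x \<otimes> inv g = k \<otimes> (y \<otimes> inv k)"
    unfolding y_def k(2) using kC gh by (simp add: inv_mult_group m_assoc)
  also have "f \<dots> = f k + (f y + f (inv k))"
    using ahom_mult[OF f] k y by simp
  finally show ?thesis using ahom_inv[OF is_group subgroup_axioms f k(1)] by (simp add: y_def)
qed

text \<open>The standard projector onto the \<open>\<xi>\<close>-eigenspace: the average over the
  quotient of its action, twisted by the inverse of \<open>\<xi>\<close>.\<close>

definition proj :: "('a set \<Rightarrow> complex) \<Rightarrow> ('a \<Rightarrow> complex) \<Rightarrow> 'a \<Rightarrow> complex"
  where "proj \<xi> f x = (if x \<in> N then
    (\<Sum>c\<in>carrier (G Mod N). inverse (\<xi> c) * f (rep c \<otimes> x \<otimes> inv (rep c))) / of_nat (order (G Mod N))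
    else 0)"

lemma order_pos: "order (G Mod N) > 0"
  using fin_quot factorgroup_is_group group.is_monoid monoid.one_closed
  by (force simp: order_def card_gt_0_iff)

lemma proj_add: "proj \<xi> (v + w) = proj \<xi> v + proj \<xi> w"
  by (auto simp: proj_def fun_eq_iff algebra_simps sum.distrib add_divide_distrib)

text \<open>On the eigenspace of \<open>\<eta>\<close> the average becomes multiplication by the
  mean of \<open>\<eta> / \<xi>\<close>, to which orthogonality of characters applies.\<close>

lemma proj_eigenhom:
  assumes \<xi>: "\<xi> \<in> characters (G Mod N)" and \<eta>: "\<eta> \<in> characters (G Mod N)"
    and f: "f \<in> eigenhom G N (inflate G N \<eta>)"
  shows "proj \<xi> f = (if \<xi> = \<eta> then f else 0)"
proof
  fix x
  interpret A: comm_group "G Mod N" by (rule comm_quot)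
  let ?A = "carrier (G Mod N)"
  show "proj \<xi> f x = (if \<xi> = \<eta> then f else 0) x"
  proof (cases "x \<in> N")
    case False
    then show ?thesis using ahom_outside[OF eigenhomD[OF f]] by (simp add: proj_def)
  next
    case True
    have "f (rep c \<otimes> x \<otimes> inv (rep c)) = \<eta> c * f x" if "c \<in> ?A" for c
      using eigenhom_conj[OF f _ True] rep[OF that] by (simp add: inflate_def)
    then have "(\<Sum>c\<in>?A. inverse (\<xi> c) * f (rep c \<otimes> x \<otimes> inv (rep c))) =
        (\<Sum>c\<in>?A. (inverse (\<xi> c) * \<eta> c) * f x)"
      by (intro sum.cong) auto
    also have "\<dots> = (\<Sum>c\<in>?A. inverse (\<xi> c) * \<eta> c) * f x" by (simp add: sum_distrib_right)
    also have "(\<Sum>c\<in>?A. inverse (\<xi> c) * \<eta> c) = (if \<xi> = \<eta> then of_nat (order (G Mod N)) else 0)"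
    proof (cases "\<xi> = \<eta>")
      case True
      have "(\<Sum>c\<in>?A. inverse (\<xi> c) * \<eta> c) = (\<Sum>c\<in>?A. 1)"
        using characters_nonzero[OF \<xi>] True by (intro sum.cong) auto
      then show ?thesis using True by (simp add: order_def)
    next
      case False
      then obtain c where c: "c \<in> ?A" "\<xi> c \<noteq> \<eta> c"
        using \<xi> \<eta> by (auto simp: characters_def fun_eq_iff extensional_def) metis
      let ?\<rho> = "\<lambda>a\<in>?A. (\<lambda>a\<in>?A. inverse (\<xi> a)) a * \<eta> a"
      have \<rho>: "?\<rho> \<in> characters (G Mod N)"
        using characters_prod[OF A.group_axioms characters_inverse[OF A.group_axioms \<xi>] \<eta>] .
      have "?\<rho> c \<noteq> 1" using c characters_nonzero[OF \<xi> c(1)] by (simp add: field_simps)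
      from sum_character_eq_0[OF comm_quot \<rho> c(1) this]
      have "(\<Sum>a\<in>?A. inverse (\<xi> a) * \<eta> a) = 0" by (simp cong: sum.cong)
      then show ?thesis using False by simp
    qed
    finally show ?thesis using True order_pos by (simp add: proj_def)
  qed
qed

lemma proj_in_eigenhom:
  assumes \<xi>: "\<xi> \<in> characters (G Mod N)" and f: "f \<in> ahom G N"
  shows "proj \<xi> f \<in> eigenhom G N (inflate G N \<xi>)"
proof -
  interpret A: comm_group "G Mod N" by (rule comm_quot)
  let ?A = "carrier (G Mod N)"
  let ?n = "of_nat (order (G Mod N)) :: complex"
  have conj: "h \<otimes> x \<otimes> inv h \<in> N" if "h \<in> carrier G" "x \<in> N" for h x
    using inv_op_closed2[OF that] .
  have "proj \<xi> f \<in> ahom G N"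
  proof (rule ahomI)
    fix x y assume xy: "x \<in> N" "y \<in> N"
    have "f (rep c \<otimes> (x \<otimes> y) \<otimes> inv (rep c)) =
        f (rep c \<otimes> x \<otimes> inv (rep c)) + f (rep c \<otimes> y \<otimes> inv (rep c))" if "c \<in> ?A" for c
    proof -
      have r: "rep c \<in> carrier G" using rep[OF that] by blast
      have "rep c \<otimes> (x \<otimes> y) \<otimes> inv (rep c) =
          (rep c \<otimes> x \<otimes> inv (rep c)) \<otimes> (rep c \<otimes> y \<otimes> inv (rep c))"
        using r xy mem_carrier by (simp add: m_assoc inv_mult_cancel)
      then show ?thesis using ahom_mult[OF f conj[OF r xy(1)] conj[OF r xy(2)]] by simp
    qed
    then have "(\<Sum>c\<in>?A. inverse (\<xi> c) * f (rep c \<otimes> (x \<otimes> y) \<otimes> inv (rep c))) =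
       (\<Sum>c\<in>?A. inverse (\<xi> c) * f (rep c \<otimes> x \<otimes> inv (rep c)) + inverse (\<xi> c) * f (rep c \<otimes> y \<otimes> inv (rep c)))"
      by (intro sum.cong) (auto simp: algebra_simps)
    then show "proj \<xi> f (x \<otimes> y) = proj \<xi> f x + proj \<xi> f y"
      using xy by (simp add: proj_def sum.distrib add_divide_distrib)
  qed (simp add: proj_def)
  moreover have "proj \<xi> f (g \<otimes> x \<otimes> inv g) = inflate G N \<xi> g * proj \<xi> f x"
    if g: "g \<in> carrier G" and x: "x \<in> N" for g x
  proof -
    let ?g = "N #> g"
    have gA: "?g \<in> ?A" using coset_closed[OF g] .
    have "(\<Sum>c\<in>?A. inverse (\<xi> c) * f (rep c \<otimes> (g \<otimes> x \<otimes> inv g) \<otimes> inv (rep c))) =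
        (\<Sum>c\<in>?A. \<xi> ?g * (inverse (\<xi> c) * f (rep c \<otimes> x \<otimes> inv (rep c))))"
    \<comment> \<open>Multiplying the cosets by that of \<open>g\<close> absorbs the conjugation by
      \<open>g\<close> into the representative and releases the factor
      \<open>\<xi> ?g\<close>.\<close>
    proof (rule sum.reindex_bij_witness[of _ "\<lambda>c. c \<otimes>\<^bsub>G Mod N\<^esub> inv\<^bsub>G Mod N\<^esub> ?g" "\<lambda>c. c \<otimes>\<^bsub>G Mod N\<^esub> ?g"])
      fix c assume c: "c \<in> ?A"
      let ?d = "c \<otimes>\<^bsub>G Mod N\<^esub> ?g"
      have d: "?d \<in> ?A" using c gA by (rule A.m_closed)
      have r: "rep c \<in> carrier G" "N #> rep c = c" "rep ?d \<in> carrier G" "N #> rep ?d = ?d"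
        using rep[OF c] rep[OF d] by auto
      have "N #> (rep c \<otimes> g) = N #> rep ?d" using coset_mult[OF r(1) g] r by simp
      then have "f (rep ?d \<otimes> x \<otimes> inv (rep ?d)) = f ((rep c \<otimes> g) \<otimes> x \<otimes> inv (rep c \<otimes> g))"
        using ahom_conj_coset[OF f x r(3), of "rep c \<otimes> g"] r(1) g by simp
      also have "(rep c \<otimes> g) \<otimes> x \<otimes> inv (rep c \<otimes> g) = rep c \<otimes> (g \<otimes> x \<otimes> inv g) \<otimes> inv (rep c)"
        using r(1) g mem_carrier[OF x] by (simp add: m_assoc inv_mult_group)
      finally show "\<xi> ?g * (inverse (\<xi> ?d) * f (rep ?d \<otimes> x \<otimes> inv (rep ?d))) =
          inverse (\<xi> c) * f (rep c \<otimes> (g \<otimes> x \<otimes> inv g) \<otimes> inv (rep c))"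
        using characters_mult[OF \<xi> c gA] characters_nonzero[OF \<xi> c] characters_nonzero[OF \<xi> gA]
        by (simp add: field_simps)
      show "?d \<otimes>\<^bsub>G Mod N\<^esub> inv\<^bsub>G Mod N\<^esub> ?g = c"
        using c gA by (metis A.inv_closed A.m_assoc A.r_inv A.r_one)
      show "?d \<in> ?A" by (rule d)
    next
      fix c assume c: "c \<in> ?A"
      show "c \<otimes>\<^bsub>G Mod N\<^esub> inv\<^bsub>G Mod N\<^esub> ?g \<otimes>\<^bsub>G Mod N\<^esub> ?g = c"
        using c gA by (metis A.inv_closed A.m_assoc A.l_inv A.r_one)
      show "c \<otimes>\<^bsub>G Mod N\<^esub> inv\<^bsub>G Mod N\<^esub> ?g \<in> ?A"
        using c gA A.m_closed A.inv_closed by blast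
    qed
    then show ?thesis
      using g x conj[OF g x] by (simp add: proj_def inflate_def sum_distrib_left)
  qed
  ultimately show ?thesis by (simp add: eigenhom_def)
qed

text \<open>Summed over all characters, only the term of the coset \<open>N\<close> survives. The
  factor in front is inverted when the decomposition is formed.\<close>

lemma sum_proj:
  assumes f: "f \<in> ahom G N"
  shows "(\<Sum>\<xi>\<in>characters (G Mod N). proj \<xi> f) =
    (\<lambda>x. of_nat (card (characters (G Mod N))) / of_nat (order (G Mod N)) * f x)"
proof
  fix x
  interpret A: comm_group "G Mod N" by (rule comm_quot)
  let ?A = "carrier (G Mod N)" and ?X = "characters (G Mod N)"
  let ?n = "of_nat (order (G Mod N)) :: complex"
  show "(\<Sum>\<xi>\<in>?X. proj \<xi> f) x = of_nat (card ?X) / ?n * f x"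
  proof (cases "x \<in> N")
    case False
    then show ?thesis using ahom_outside[OF f] by (simp add: sum_fun_apply proj_def)
  next
    case True
    have one: "N \<in> ?A" using A.one_closed by simp
    have f1: "f (rep N \<otimes> x \<otimes> inv (rep N)) = f x"
      using ahom_conj_coset[OF f True, of "rep N" \<one>] rep[OF one] mem_carrier[OF True] subset
      by (simp add: coset_mult_one)
    have "(\<Sum>\<xi>\<in>?X. proj \<xi> f) x =
        (\<Sum>\<xi>\<in>?X. \<Sum>c\<in>?A. inverse (\<xi> c) * f (rep c \<otimes> x \<otimes> inv (rep c))) / ?n"
      using True by (simp add: sum_fun_apply proj_def sum_divide_distrib)
    also have "(\<Sum>\<xi>\<in>?X. \<Sum>c\<in>?A. inverse (\<xi> c) * f (rep c \<otimes> x \<otimes> inv (rep c))) =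
        (\<Sum>c\<in>?A. (\<Sum>\<xi>\<in>?X. inverse (\<xi> c)) * f (rep c \<otimes> x \<otimes> inv (rep c)))"
      by (subst sum.swap) (simp add: sum_distrib_right)
    also have "\<dots> = (\<Sum>c\<in>?A. if c = N then of_nat (card ?X) * f x else 0)"
    proof (rule sum.cong[OF refl])
      fix c assume c: "c \<in> ?A"
      show "(\<Sum>\<xi>\<in>?X. inverse (\<xi> c)) * f (rep c \<otimes> x \<otimes> inv (rep c)) =
          (if c = N then of_nat (card ?X) * f x else 0)"
      proof (cases "c = N")
        case True
        have "(\<Sum>\<xi>\<in>?X. inverse (\<xi> c)) = (\<Sum>\<xi>\<in>?X. 1)"
          using characters_one[OF A.group_axioms] True by (intro sum.cong) auto
        then show ?thesis using True f1 by simp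
      next
        case False
        then show ?thesis using sum_characters_eq_0[OF comm_quot fin_quot c] by simp
      qed
    qed
    also have "\<dots> = of_nat (card ?X) * f x" using fin_quot one by simp
    finally show ?thesis by simp
  qed
qed

lemma fdim_ahom_decomposition:
  "fdim (ahom G N) = (\<Sum>\<xi>\<in>characters (G Mod N). fdim (eigenhom G N (inflate G N \<xi>)))"
proof -
  let ?X = "characters (G Mod N)"
  let ?E = "\<lambda>\<xi>. eigenhom G N (inflate G N \<xi>)"
  have fin: "finite ?X" using finite_characters[OF factorgroup_is_group fin_quot] .
  have ne: "?X \<noteq> {}" using trivial_char_in[OF factorgroup_is_group] by blast
  have "ahom G N = {\<Sum>\<xi>\<in>?X. F \<xi> | F. \<forall>\<xi>\<in>?X. F \<xi> \<in> ?E \<xi>}" (is "_ = ?R")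
  proof
    show "?R \<subseteq> ahom G N"
    proof clarify
      fix F assume "\<forall>\<xi>\<in>?X. F \<xi> \<in> ?E \<xi>"
      then show "(\<Sum>\<xi>\<in>?X. F \<xi>) \<in> ahom G N"
        by (intro cfun.subspace_sum[OF subspace_ahom] eigenhomD) blast
    qed
    show "ahom G N \<subseteq> ?R"
    proof
      fix f assume f: "f \<in> ahom G N"
      \<comment> \<open>The inverse of the factor in \<open>sum_proj\<close>; it rescales the
        eigencomponents so that they add up to \<open>f\<close>.\<close>
      define d :: complex where "d = of_nat (order (G Mod N)) / of_nat (card ?X)"
      have "d * (of_nat (card ?X) / of_nat (order (G Mod N))) = 1"
        using fin ne order_pos by (simp add: d_def)
      then have "(\<lambda>x. d * (\<Sum>\<xi>\<in>?X. proj \<xi> f) x) = f"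
        unfolding sum_proj[OF f] by (simp add: mult.assoc[symmetric] del: times_divide_eq_left times_divide_eq_right)
      then have "f = (\<Sum>\<xi>\<in>?X. (\<lambda>x. d * proj \<xi> f x))"
        by (auto simp: fun_eq_iff sum_fun_apply sum_distrib_left)
      moreover have "(\<lambda>x. d * proj \<xi> f x) \<in> ?E \<xi>" if "\<xi> \<in> ?X" for \<xi>
        using cfun.subspace_scale[OF subspace_eigenhom proj_in_eigenhom[OF that f]] .
      ultimately show "f \<in> ?R" by blast
    qed
  qed
  moreover have "cfun.subspace {\<Sum>\<xi>\<in>?X. F \<xi> | F. \<forall>\<xi>\<in>?X. F \<xi> \<in> ?E \<xi>} \<and>
      fdim {\<Sum>\<xi>\<in>?X. F \<xi> | F. \<forall>\<xi>\<in>?X. F \<xi> \<in> ?E \<xi>} = (\<Sum>\<xi>\<in>?X. fdim (?E \<xi>))"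
    by (rule fdim_direct_sum[of _ _ proj])
      (simp_all only: fin subspace_eigenhom proj_add proj_eigenhom if_True if_False simp_thms)
  ultimately show ?thesis by simp
qed

end

section \<open>Restriction of eigenhomomorphisms\<close>

lemma (in group) mult_inv_cancel:
  "x \<in> carrier G \<Longrightarrow> y \<in> carrier G \<Longrightarrow> x \<otimes> (inv x \<otimes> y) = y"
  by (simp add: m_assoc[symmetric])

lemmas (in group) word_simps = m_assoc inv_mult_group inv_mult_cancel mult_inv_cancel

lemma restrict_linear: "fun_linear (\<lambda>(f :: 'a \<Rightarrow> complex) x. if x \<in> P then f x else 0)"
  by unfold_locales auto

context group
begin

text \<open>The order of the factors is that of the generators in \<open>derived\<close>.\<close>

definition commutator :: "'a \<Rightarrow> 'a \<Rightarrow> 'a"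
  where "commutator x y = x \<otimes> y \<otimes> inv x \<otimes> inv y"

lemma commutator_closed [simp]: "x \<in> carrier G \<Longrightarrow> y \<in> carrier G \<Longrightarrow> commutator x y \<in> carrier G"
  by (simp add: commutator_def)

lemma commutator_in_derived:
  "x \<in> carrier G \<Longrightarrow> y \<in> carrier G \<Longrightarrow> commutator x y \<in> derived G (carrier G)"
  unfolding derived_def commutator_def by (rule generate.incl) blast

lemma commutator_mult_left:
  "x \<in> carrier G \<Longrightarrow> y \<in> carrier G \<Longrightarrow> z \<in> carrier G \<Longrightarrow>
    commutator (x \<otimes> y) z = (x \<otimes> commutator y z \<otimes> inv x) \<otimes> commutator x z"
  by (simp add: commutator_def word_simps)

lemma commutator_mult_right:
  "x \<in> carrier G \<Longrightarrow> y \<in> carrier G \<Longrightarrow> z \<in> carrier G \<Longrightarrow>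
    commutator x (y \<otimes> z) = commutator x y \<otimes> (y \<otimes> commutator x z \<otimes> inv y)"
  by (simp add: commutator_def word_simps)

lemma derived_subset:
  assumes "subgroup H G" "\<And>x y. x \<in> carrier G \<Longrightarrow> y \<in> carrier G \<Longrightarrow> commutator x y \<in> H"
  shows "derived G (carrier G) \<subseteq> H"
  unfolding derived_def
  by (rule generate_subgroup_incl) (use assms in \<open>auto simp: commutator_def\<close>)

text \<open>Together with \<open>derived_subset\<close> it reduces vanishing on \<open>G'\<close> to
  vanishing on commutators.\<close>

lemma kernel_ahom_subgroup:
  assumes "subgroup P G" "f \<in> ahom G P"
  shows "subgroup {x\<in>P. f x = 0} G"
proof (rule subgroupI)
  show "{x \<in> P. f x = 0} \<subseteq> carrier G" using subgroup.subset[OF assms(1)] by blast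
  show "{x \<in> P. f x = 0} \<noteq> {}"
    using subgroup.one_closed[OF assms(1)] ahom_one[OF is_group assms] by blast
qed (use ahom_inv[OF is_group assms] ahom_mult[OF assms(2)] subgroup.m_inv_closed[OF assms(1)]
    subgroup.m_closed[OF assms(1)] in auto)

lemma ahom_nat_pow:
  assumes "subgroup P G" "f \<in> ahom G P" "x \<in> P"
  shows "f (x [^] (k::nat)) = of_nat k * f x"
proof (induction k)
  case 0
  then show ?case using ahom_one[OF is_group assms(1,2)] by simp
next
  case (Suc k)
  have "x [^] k \<in> P"
  proof (induction k)
    case (Suc k)
    then show ?case using subgroup.m_closed[OF assms(1)] assms(3) by simp
  qed (use subgroup.one_closed[OF assms(1)] in simp)
  then show ?case using Suc ahom_mult[OF assms(2)] assms(3) by (simp add: algebra_simps)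
qed

end

context finite_abelian_quotient
begin

lemma derived_le: "derived G (carrier G) \<subseteq> N"
proof (rule derived_subset[OF subgroup_axioms])
  interpret A: comm_group "G Mod N" by (rule comm_quot)
  fix x y assume xy: "x \<in> carrier G" "y \<in> carrier G"
  have "N #> (x \<otimes> y) = N #> (y \<otimes> x)"
    using A.m_comm[OF coset_closed[OF xy(1)] coset_closed[OF xy(2)]] coset_mult xy by simp
  then have "x \<otimes> y \<in> N #> (y \<otimes> x)" using rcos_self[OF _ subgroup_axioms, of "x \<otimes> y"] xy by simp
  then obtain k where k: "k \<in> N" "x \<otimes> y = k \<otimes> (y \<otimes> x)" by (auto simp: r_coset_def)
  then have "commutator x y = k"
    using xy mem_carrier[OF k(1)] by (simp add: commutator_def word_simps)
  then show "commutator x y \<in> N" using k by simp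
qed

text \<open>Lagrange's theorem in \<open>G Mod N\<close>; this is where the division by the order of
  the quotient originates.\<close>

lemma pow_order_in: 
  assumes "g \<in> carrier G" shows "g [^] order (G Mod N) \<in> N"
proof -
  interpret A: comm_group "G Mod N" by (rule comm_quot)
  have "N #> (g [^] order (G Mod N)) = (N #> g) [^]\<^bsub>G Mod N\<^esub> order (G Mod N)"
    using FactGroup_pow[OF assms] by simp
  also have "\<dots> = N" using A.pow_order_eq_1[OF coset_closed[OF assms]] by simp
  finally show ?thesis
    using rcos_self[OF _ subgroup_axioms, of "g [^] order (G Mod N)"] assms by simp
qed

text \<open>The commutator pairing of an invariant \<open>f\<close> is bimultiplicative, and it vanishes on \<open>N\<close>, which
  contains a power of each element.\<close>

lemma invariant_ahom_derived:
  assumes f: "f \<in> ahom G N" and inv: "\<And>g x. g \<in> carrier G \<Longrightarrow> x \<in> N \<Longrightarrow> f (g \<otimes> x \<otimes> inv g) = f x"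
    and x: "x \<in> derived G (carrier G)"
  shows "f x = 0"
proof -
  have cN: "commutator x y \<in> N" if "x \<in> carrier G" "y \<in> carrier G" for x y
    using commutator_in_derived[OF that] derived_le by blast
  have conj: "h \<otimes> x \<otimes> inv h \<in> N" if "h \<in> carrier G" "x \<in> N" for h x
    using inv_op_closed2[OF that] .
  have "commutator x y \<in> {x\<in>N. f x = 0}" if xy: "x \<in> carrier G" "y \<in> carrier G" for x y
  proof -
    have mult: "f (commutator (u \<otimes> v) y) = f (commutator u y) + f (commutator v y)"
      if "u \<in> carrier G" "v \<in> carrier G" for u v
      using commutator_mult_left[OF that xy(2)] ahom_mult[OF f conj[OF that(1) cN[OF that(2) xy(2)]] cN[OF that(1) xy(2)]]
        inv[OF that(1) cN[OF that(2) xy(2)]] by simp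
    have pow: "f (commutator (x [^] k) y) = of_nat k * f (commutator x y)" for k :: nat
    proof (induction k)
      case 0
      have "commutator \<one> y = \<one>" using xy by (simp add: commutator_def)
      then show ?case using ahom_one[OF is_group subgroup_axioms f] by simp
    next
      case (Suc k)
      then show ?case using mult[of "x [^] k" x] xy by (simp add: algebra_simps)
    qed
    \<comment> \<open>The power \<open>?z\<close> of \<open>x\<close> lies in \<open>N\<close>, so
      its commutator with \<open>y\<close> is \<open>?z\<close> times a conjugate of its inverse,
      which the invariant \<open>f\<close> kills. By \<open>pow\<close> the value there is also a
      nonzero multiple of that at \<open>commutator x y\<close>.\<close>
    let ?z = "x [^] order (G Mod N)"
    have z: "?z \<in> N" using pow_order_in[OF xy(1)] .
    have "commutator ?z y = ?z \<otimes> (y \<otimes> inv ?z \<otimes> inv y)"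
      using mem_carrier[OF z] xy by (simp add: commutator_def m_assoc)
    also have "f \<dots> = 0"
      using ahom_mult[OF f z conj[OF xy(2)]] inv[OF xy(2)] ahom_inv[OF is_group subgroup_axioms f z] z
      by simp
    finally have "f (commutator x y) = 0" using pow[of "order (G Mod N)"] order_pos by simp
    then show ?thesis using cN[OF xy] by simp
  qed
  then have "derived G (carrier G) \<subseteq> {x\<in>N. f x = 0}"
    by (rule derived_subset[OF kernel_ahom_subgroup[OF subgroup_axioms f]])
  then show ?thesis using x by blast
qed

text \<open>Powers are multiplicative in the abelian group \<open>G/G'\<close>; the error
  \<open>d\<close> is invisible to invariant homomorphisms.\<close>

lemma pow_mult_derived:
  assumes "x \<in> carrier G" "y \<in> carrier G"
  shows "\<exists>d\<in>derived G (carrier G). (x \<otimes> y) [^] (n::nat) = d \<otimes> (x [^] n \<otimes> y [^] n)"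
proof -
  let ?D = "derived G (carrier G)"
  interpret D: normal ?D G by (rule derived_self_is_normal)
  interpret Q: comm_group "G Mod ?D" by (rule derived_quot_is_comm_group)
  have cl: "?D #> g \<in> carrier (G Mod ?D)" if "g \<in> carrier G" for g
    using that by (auto simp: carrier_FactGroup)
  have mult: "(?D #> g) \<otimes>\<^bsub>G Mod ?D\<^esub> (?D #> h) = ?D #> (g \<otimes> h)" if "g \<in> carrier G" "h \<in> carrier G" for g h
    using D.rcos_sum[OF that] by simp
  have "?D #> ((x \<otimes> y) [^] n) = ((?D #> x) \<otimes>\<^bsub>G Mod ?D\<^esub> (?D #> y)) [^]\<^bsub>G Mod ?D\<^esub> n"
    using D.FactGroup_pow[of "x \<otimes> y" n] assms mult by simp
  also have "\<dots> = (?D #> x) [^]\<^bsub>G Mod ?D\<^esub> n \<otimes>\<^bsub>G Mod ?D\<^esub> (?D #> y) [^]\<^bsub>G Mod ?D\<^esub> n"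
    by (rule Q.pow_mult_distrib[OF Q.m_comm]) (use cl assms in auto)
  also have "\<dots> = ?D #> (x [^] n \<otimes> y [^] n)"
    using D.FactGroup_pow assms mult by simp
  finally have "(x \<otimes> y) [^] n \<in> ?D #> (x [^] n \<otimes> y [^] n)"
    using rcos_self[OF _ D.subgroup_axioms, of "(x \<otimes> y) [^] n"] assms by simp
  then show ?thesis by (auto simp: r_coset_def)
qed

text \<open>Every element of \<open>G\<close> has a power in \<open>N\<close>, and \<complex> has no
  torsion, so a homomorphism on \<open>G\<close> is determined by its restriction to
  \<open>N\<close>.\<close>

lemma fdim_eigenhom_trivial:
  assumes "\<And>g. g \<in> carrier G \<Longrightarrow> \<theta> g = 1"
  shows "fdim (eigenhom G N \<theta>) = fdim (ahom G (carrier G))"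
proof -
  let ?L = "\<lambda>(f :: 'a \<Rightarrow> complex) x. if x \<in> N then f x else 0"
  let ?n = "order (G Mod N)"
  interpret L: fun_linear ?L by (rule restrict_linear)
  have "inj_on ?L (ahom G (carrier G))"
  proof (rule inj_onI)
    fix f g assume f: "f \<in> ahom G (carrier G)" and g: "g \<in> ahom G (carrier G)" and eq: "?L f = ?L g"
    have "f x = g x" if x: "x \<in> carrier G" for x
    proof -
      have "f (x [^] ?n) = g (x [^] ?n)" using fun_cong[OF eq, of "x [^] ?n"] pow_order_in[OF x] by simp
      then show ?thesis 
        using ahom_nat_pow[OF subgroup_self f x, of ?n] ahom_nat_pow[OF subgroup_self g x, of ?n] order_pos
        by simp
    qed
    then show "f = g" using ahom_outside[OF f] ahom_outside[OF g] by (metis ext)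
  qed
  moreover have "?L ` ahom G (carrier G) = eigenhom G N \<theta>"
  proof
    show "?L ` ahom G (carrier G) \<subseteq> eigenhom G N \<theta>"
    proof (clarsimp simp: eigenhom_def assms)
      fix f assume f: "f \<in> ahom G (carrier G)"
      have "f (g \<otimes> x \<otimes> inv g) = f x" if "g \<in> carrier G" "x \<in> N" for g x
        using that mem_carrier[OF that(2)] ahom_mult[OF f] ahom_inv[OF is_group subgroup_self f] by simp
      moreover have "g \<otimes> x \<otimes> inv g \<in> N" if "g \<in> carrier G" "x \<in> N" for g x
        using inv_op_closed2[OF that] .
      ultimately show "?L f \<in> ahom G N \<and> (\<forall>g\<in>carrier G. \<forall>x\<in>N.
          (g \<otimes> x \<otimes> inv g \<in> N \<longrightarrow> f (g \<otimes> x \<otimes> inv g) = f x) \<and> (g \<otimes> x \<otimes> inv g \<notin> N \<longrightarrow> f x = 0))"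
        using ahom_mult[OF f] by (auto intro!: ahomI)
    qed
    show "eigenhom G N \<theta> \<subseteq> ?L ` ahom G (carrier G)"
    proof
      fix f assume f: "f \<in> eigenhom G N \<theta>"
      have fN: "f \<in> ahom G N" using eigenhomD[OF f] .
      have inv: "f (g \<otimes> x \<otimes> inv g) = f x" if "g \<in> carrier G" "x \<in> N" for g x
        using eigenhom_conj[OF f that] assms that by simp
      \<comment> \<open>Forced by \<open>f (x [^] ?n) = ?n * F x\<close>. It is additive because
        powers are multiplicative up to \<open>G'\<close>, where the invariant \<open>f\<close>
        vanishes.\<close>
      define F where "F = (\<lambda>x. if x \<in> carrier G then f (x [^] ?n) / of_nat ?n else 0)"
      have "F \<in> ahom G (carrier G)"
      proof (rule ahomI)
        fix x y assume xy: "x \<in> carrier G" "y \<in> carrier G"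
        obtain d where d: "d \<in> derived G (carrier G)" "(x \<otimes> y) [^] ?n = d \<otimes> (x [^] ?n \<otimes> y [^] ?n)"
          using pow_mult_derived[OF xy] by blast
        note px = pow_order_in[OF xy(1)] and py = pow_order_in[OF xy(2)]
        have "f ((x \<otimes> y) [^] ?n) = f d + (f (x [^] ?n) + f (y [^] ?n))"
          unfolding d(2) using d(1) derived_le px py subgroup.m_closed[OF subgroup_axioms px py]
          by (simp add: ahom_mult[OF fN] subset_iff)
        moreover have "f d = 0" by (rule invariant_ahom_derived[OF fN inv d(1)])
        ultimately show "F (x \<otimes> y) = F x + F y" using xy by (simp add: F_def add_divide_distrib)
      qed (simp add: F_def)
      moreover have "?L F = f"
      proof
        fix x
        show "?L F x = f x"
          using ahom_outside[OF fN] ahom_nat_pow[OF subgroup_axioms fN] order_pos mem_carrier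
          by (simp add: F_def)
      qed
      ultimately show "f \<in> ?L ` ahom G (carrier G)" by blast
    qed
  qed
  ultimately show ?thesis using L.fdim_image[OF subspace_ahom, of G "carrier G"] by simp
qed

text \<open>An eigenhomomorphism \<open>f\<close> for a nontrivial character is determined by its values on commutators:
  \<open>f [g, x] = (\<theta> g - 1) f x\<close>. The same formula extends it from the derived subgroup.\<close>

lemma fdim_eigenhom_nontrivial:
  assumes N1: "\<And>x. x \<in> N \<Longrightarrow> \<theta> x = 1" and g: "g \<in> carrier G" "\<theta> g \<noteq> 1"
  shows "fdim (eigenhom G N \<theta>) = fdim (eigenhom G (derived G (carrier G)) \<theta>)"
proof -
  let ?D = "derived G (carrier G)"
  interpret D: normal ?D G by (rule derived_self_is_normal)
  let ?L = "\<lambda>(f :: 'a \<Rightarrow> complex) x. if x \<in> ?D then f x else 0"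
  interpret L: fun_linear ?L by (rule restrict_linear)
  have DN: "x \<in> N" if "x \<in> ?D" for x using derived_le that by blast
  have comm: "f (commutator h x) = (\<theta> h - 1) * f x"
    if f: "f \<in> eigenhom G P \<theta>" and P: "P \<lhd> G" and h: "h \<in> carrier G" "x \<in> P" for f h x P
  proof -
    have sP: "subgroup P G" using normal_imp_subgroup[OF P] .
    have x: "x \<in> carrier G" using subgroup.mem_carrier[OF sP h(2)] .
    have "commutator h x = (h \<otimes> x \<otimes> inv h) \<otimes> inv x" by (simp add: commutator_def)
    also have "f \<dots> = f (h \<otimes> x \<otimes> inv h) + f (inv x)"
      by (rule ahom_mult[OF eigenhomD[OF f]])
        (use normal.inv_op_closed2[OF P h] subgroup.m_inv_closed[OF sP h(2)] in auto)
    also have "\<dots> = (\<theta> h - 1) * f x"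
      using eigenhom_conj[OF f h] ahom_inv[OF is_group sP eigenhomD[OF f] h(2)] by (simp add: algebra_simps)
    finally show ?thesis .
  qed
  have "inj_on ?L (eigenhom G N \<theta>)"
  proof (rule inj_onI)
    fix f f' assume f: "f \<in> eigenhom G N \<theta>" "f' \<in> eigenhom G N \<theta>" and eq: "?L f = ?L f'"
    have "f x = f' x" if x: "x \<in> N" for x
    proof -
      have "commutator g x \<in> ?D" using commutator_in_derived g(1) mem_carrier[OF x] by blast
      then have "f (commutator g x) = f' (commutator g x)"
        using fun_cong[OF eq, of "commutator g x"] by simp
      then show ?thesis
        using comm[OF f(1) normal_axioms g(1) x] comm[OF f(2) normal_axioms g(1) x] g(2) by simp
    qed
    then show "f = f'"
      using ahom_outside[OF eigenhomD[OF f(1)]] ahom_outside[OF eigenhomD[OF f(2)]] by (metis ext)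
  qed
  moreover have "?L ` eigenhom G N \<theta> = eigenhom G ?D \<theta>"
  proof
    show "?L ` eigenhom G N \<theta> \<subseteq> eigenhom G ?D \<theta>"
    proof clarify
      fix f assume f: "f \<in> eigenhom G N \<theta>"
      show "?L f \<in> eigenhom G ?D \<theta>"
        unfolding eigenhom_def
        using ahom_mult[OF eigenhomD[OF f]] eigenhom_conj[OF f] D.inv_op_closed2 DN
        by (auto intro!: ahomI)
    qed
    show "eigenhom G ?D \<theta> \<subseteq> ?L ` eigenhom G N \<theta>"
    proof
      fix u assume u: "u \<in> eigenhom G ?D \<theta>"
      have uD: "u \<in> ahom G ?D" using eigenhomD[OF u] .
      \<comment> \<open>The only candidate, read off from \<open>comm\<close> at the fixed
        \<open>g\<close>.\<close>
      define f where "f = (\<lambda>x. if x \<in> N then u (commutator g x) / (\<theta> g - 1) else 0)"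
      have cD: "commutator a b \<in> ?D" if "a \<in> carrier G" "b \<in> carrier G" for a b
        using commutator_in_derived that by blast
      have conjD: "a \<otimes> d \<otimes> inv a \<in> ?D" if "a \<in> carrier G" "d \<in> ?D" for a d
        using D.inv_op_closed2[OF that] .
      \<comment> \<open>The commutator is \<open>d\<close> times a conjugate of its inverse by
        \<open>x\<close>, and elements of \<open>N\<close> act with eigenvalue
        \<open>1\<close>.\<close>
      have 1: "u (commutator d x) = 0" if d: "d \<in> ?D" and x: "x \<in> N" for d x
      proof -
        have dx: "d \<in> carrier G" "x \<in> carrier G" using DN[OF d] x by auto
        have "commutator d x = d \<otimes> (x \<otimes> inv d \<otimes> inv x)"
          using dx by (simp add: commutator_def m_assoc)
        also have "u \<dots> = u d + u (x \<otimes> inv d \<otimes> inv x)"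
          using ahom_mult[OF uD d conjD[OF dx(2) D.m_inv_closed[OF d]]] .
        also have "\<dots> = 0"
          using eigenhom_conj[OF u dx(2) D.m_inv_closed[OF d]] N1[OF x]
            ahom_inv[OF is_group D.subgroup_axioms uD d] by simp
        finally show ?thesis .
      qed
      have "f \<in> ahom G N"
      proof (rule ahomI)
        fix x y assume xy: "x \<in> N" "y \<in> N"
        have C: "x \<in> carrier G" "y \<in> carrier G" using xy by auto
        have "u (commutator g (x \<otimes> y)) = u (commutator g x) + u (x \<otimes> commutator g y \<otimes> inv x)"
          unfolding commutator_mult_right[OF g(1) C]
          by (rule ahom_mult[OF uD cD[OF g(1) C(1)] conjD[OF C(1) cD[OF g(1) C(2)]]])
        also have "u (x \<otimes> commutator g y \<otimes> inv x) = u (commutator g y)"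
          using eigenhom_conj[OF u C(1) cD[OF g(1) C(2)]] N1[OF xy(1)] by simp
        finally show "f (x \<otimes> y) = f x + f y" using xy by (simp add: f_def add_divide_distrib)
      qed (simp add: f_def)
      moreover have "f (h \<otimes> x \<otimes> inv h) = \<theta> h * f x" if h: "h \<in> carrier G" and x: "x \<in> N" for h x
      proof -
        have xC: "x \<in> carrier G" using x by auto
        \<comment> \<open>Chosen so that conjugating \<open>g\<close> by the inverse of
          \<open>h\<close> gives \<open>g \<otimes> d\<close> with \<open>d\<close> in
          \<open>G'\<close>. Conjugating \<open>x\<close> by \<open>h\<close> then amounts to
          replacing \<open>g\<close> by \<open>g \<otimes> d\<close>, up to an outer conjugation
          that yields the eigenvalue \<open>\<theta> h\<close>; by fact \<open>1\<close> the change
          from \<open>g\<close> to \<open>g \<otimes> d\<close> has no effect.\<close>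
        define d where "d = commutator (inv g) (inv h)"
        have d: "d \<in> ?D" "d \<in> carrier G" unfolding d_def using cD g(1) h by auto
        have gd: "inv h \<otimes> g \<otimes> h = g \<otimes> d"
          unfolding d_def commutator_def using g(1) h by (simp add: word_simps)
        have "commutator g (h \<otimes> x \<otimes> inv h) = h \<otimes> commutator (inv h \<otimes> g \<otimes> h) x \<otimes> inv h"
          unfolding commutator_def using g(1) h xC by (simp add: word_simps)
        then have "u (commutator g (h \<otimes> x \<otimes> inv h)) = \<theta> h * u (commutator (g \<otimes> d) x)"
          unfolding gd using eigenhom_conj[OF u h cD[of "g \<otimes> d" x]] g(1) d(2) xC by simp
        also have "u (commutator (g \<otimes> d) x) = u (g \<otimes> commutator d x \<otimes> inv g) + u (commutator g x)"
          unfolding commutator_mult_left[OF g(1) d(2) xC]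
          by (rule ahom_mult[OF uD conjD[OF g(1) cD[OF d(2) xC]] cD[OF g(1) xC]])
        also have "u (g \<otimes> commutator d x \<otimes> inv g) = 0"
          using eigenhom_conj[OF u g(1) cD[OF d(2) xC]] 1[OF d(1) x] by simp
        finally show ?thesis using x inv_op_closed2[OF h x] by (simp add: f_def)
      qed
      ultimately have "f \<in> eigenhom G N \<theta>" by (simp add: eigenhom_def)
      moreover have "?L f = u"
      proof
        fix x
        show "?L f x = u x"
          using ahom_outside[OF uD] comm[OF u D.normal_axioms g(1)] DN g(2) by (simp add: f_def)
      qed
      ultimately show "u \<in> ?L ` eigenhom G N \<theta>" by blast
    qed
  qed
  ultimately show ?thesis using L.fdim_image[OF subspace_eigenhom, of G N \<theta>] by simp
qed

end

section \<open>Group algebras\<close>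

text \<open>The linear extension of \<open>\<phi>\<close> from basis elements to the formal
  combination \<open>f\<close>.\<close>

definition pairing :: "('a \<Rightarrow> complex) \<Rightarrow> ('a \<Rightarrow> complex) \<Rightarrow> complex"
  where "pairing f \<phi> = (\<Sum>a\<in>{a. f a \<noteq> 0}. f a * \<phi> a)"

lemma pairing_superset:
  assumes "finite S" "{a. f a \<noteq> 0} \<subseteq> S"
  shows "pairing f \<phi> = (\<Sum>a\<in>S. f a * \<phi> a)"
  unfolding pairing_def by (rule sum.mono_neutral_left) (use assms in auto)

lemma fin_suppI: "finite {x. f x \<noteq> 0} \<Longrightarrow> (\<And>x. f x \<noteq> 0 \<Longrightarrow> x \<in> S) \<Longrightarrow> f \<in> fin_supp S"
  by (auto simp: fin_supp_def)

lemma fin_supp_finite: "f \<in> fin_supp S \<Longrightarrow> finite {x. f x \<noteq> 0}"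
  and fin_supp_in: "f \<in> fin_supp S \<Longrightarrow> f x \<noteq> 0 \<Longrightarrow> x \<in> S"
  by (auto simp: fin_supp_def)

lemma subspace_fin_supp: "cfun.subspace (fin_supp S)"
proof (rule cfun.subspaceI)
  show "0 \<in> fin_supp S" by (simp add: fin_supp_def)
  fix f g :: "'a \<Rightarrow> complex" assume fg: "f \<in> fin_supp S" "g \<in> fin_supp S"
  have "{x. (f + g) x \<noteq> 0} \<subseteq> {x. f x \<noteq> 0} \<union> {x. g x \<noteq> 0}" by auto
  then show "f + g \<in> fin_supp S" using fg unfolding fin_supp_def
    by (auto intro: finite_subset)
next
  fix c and f :: "'a \<Rightarrow> complex" assume f: "f \<in> fin_supp S"
  have "{x. c * f x \<noteq> 0} \<subseteq> {x. f x \<noteq> 0}" by auto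
  then show "(\<lambda>x. c * f x) \<in> fin_supp S" using f unfolding fin_supp_def
    by (auto intro: finite_subset)
qed

lemma fin_supp_add: "f \<in> fin_supp S \<Longrightarrow> g \<in> fin_supp S \<Longrightarrow> (\<lambda>x. f x + g x) \<in> fin_supp S"
  using cfun.subspace_add[OF subspace_fin_supp, of f S g] by (simp add: plus_fun_def)

lemma fin_supp_scale: "f \<in> fin_supp S \<Longrightarrow> (\<lambda>x. c * f x) \<in> fin_supp S"
  using cfun.subspace_scale[OF subspace_fin_supp] .

lemma fin_supp_zero: "(\<lambda>x. 0) \<in> fin_supp S"
  by (simp add: fin_supp_def)

lemma fin_supp_delta: "a \<in> S \<Longrightarrow> delta a \<in> fin_supp S"
  by (simp add: fin_supp_def delta_def)

lemma pairing_add: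
  assumes "f \<in> fin_supp S" "g \<in> fin_supp S"
  shows "pairing (\<lambda>x. f x + g x) \<phi> = pairing f \<phi> + pairing g \<phi>"
proof -
  let ?T = "{x. f x \<noteq> 0} \<union> {x. g x \<noteq> 0}"
  have T: "finite ?T" using assms fin_supp_finite by blast
  show ?thesis
    by (subst (1 2 3) pairing_superset[OF T]) (auto simp: sum.distrib algebra_simps)
qed

lemma pairing_scale: "pairing (\<lambda>x. c * f x) \<phi> = c * pairing f \<phi>"
  by (cases "c = 0") (simp_all add: pairing_def sum_distrib_left mult.assoc)

lemma pairing_zero [simp]: "pairing (\<lambda>x. 0) \<phi> = 0"
  by (simp add: pairing_def)

lemma pairing_delta [simp]: "pairing (delta a) \<phi> = \<phi> a"
  by (simp add: pairing_def delta_def)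

lemma pairing_cong: "(\<And>a. f a \<noteq> 0 \<Longrightarrow> \<phi> a = \<psi> a) \<Longrightarrow> pairing f \<phi> = pairing f \<psi>"
  unfolding pairing_def by (rule sum.cong) auto

lemma pairing_add_right: "pairing f (\<lambda>x. \<phi> x + \<psi> x) = pairing f \<phi> + pairing f \<psi>"
  by (simp add: pairing_def sum.distrib algebra_simps)

lemma pairing_scale_right: "pairing f (\<lambda>x. c * \<phi> x) = c * pairing f \<phi>"
  by (simp add: pairing_def sum_distrib_left algebra_simps)

lemma pairing_scale_right': "pairing f (\<lambda>x. \<phi> x * c) = pairing f \<phi> * c"
  by (simp add: pairing_def sum_distrib_right mult.assoc)

lemma pairing_swap:
  "pairing f (\<lambda>a. pairing g (\<lambda>b. \<phi> a b)) = pairing g (\<lambda>b. pairing f (\<lambda>a. \<phi> a b))"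
  unfolding pairing_def sum_distrib_left by (subst sum.swap) (simp add: mult.left_commute)

lemma pairing_delta_right:
  assumes "f \<in> fin_supp S"
  shows "pairing f (delta x) = f x"
proof -
  have "pairing f (delta x) = (\<Sum>a\<in>insert x {a. f a \<noteq> 0}. f a * delta x a)"
    by (rule pairing_superset) (use assms fin_supp_finite in auto)
  also have "\<dots> = (\<Sum>a\<in>insert x {a. f a \<noteq> 0}. if a = x then f a else 0)"
    by (rule sum.cong) (auto simp: delta_def)
  also have "\<dots> = f x" using fin_supp_finite[OF assms] by simp
  finally show ?thesis .
qed

text \<open>Pairing with \<open>delta x\<close> reads off the value at \<open>x\<close>. Identities
  between convolutions are thereby tested on functions \<open>\<phi>\<close>, where they become
  substitutions in iterated sums.\<close>

lemma fin_supp_eqI: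
  assumes "f \<in> fin_supp S" "g \<in> fin_supp S" "\<And>\<phi>. pairing f \<phi> = pairing g \<phi>"
  shows "f = g"
  using pairing_delta_right[OF assms(1)] pairing_delta_right[OF assms(2)] assms(3) by (metis ext)

text \<open>The common form of the product of the group algebra and of its action on the module.\<close>

definition convolution :: "('h, 'b) monoid_scheme \<Rightarrow> 'c set \<Rightarrow> ('h \<Rightarrow> 'c \<Rightarrow> 'c) \<Rightarrow>
    ('h \<Rightarrow> complex) \<Rightarrow> ('c \<Rightarrow> complex) \<Rightarrow> 'c \<Rightarrow> complex"
  where "convolution H C \<alpha> f g =
    (\<lambda>x. if x \<in> C then \<Sum>a\<in>{a. f a \<noteq> 0}. f a * g (\<alpha> (inv\<^bsub>H\<^esub> a) x) else 0)"

context
  fixes H :: "('h, 'b) monoid_scheme" and C :: "'c set" and \<alpha> :: "'h \<Rightarrow> 'c \<Rightarrow> 'c"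
  assumes closed: "\<And>h c. h \<in> carrier H \<Longrightarrow> c \<in> C \<Longrightarrow> \<alpha> h c \<in> C"
    and left: "\<And>h c. h \<in> carrier H \<Longrightarrow> c \<in> C \<Longrightarrow> \<alpha> (inv\<^bsub>H\<^esub> h) (\<alpha> h c) = c"
    and right: "\<And>h c. h \<in> carrier H \<Longrightarrow> c \<in> C \<Longrightarrow> \<alpha> h (\<alpha> (inv\<^bsub>H\<^esub> h) c) = c"
begin

lemma convolution_support:
  assumes f: "f \<in> fin_supp (carrier H)" and x: "convolution H C \<alpha> f g x \<noteq> 0"
  shows "x \<in> C \<and> x \<in> (\<lambda>(h, c). \<alpha> h c) ` ({a. f a \<noteq> 0} \<times> {c. g c \<noteq> 0})"
proof -
  have xC: "x \<in> C" using x by (auto simp: convolution_def split: if_splits)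
  then have "(\<Sum>a\<in>{a. f a \<noteq> 0}. f a * g (\<alpha> (inv\<^bsub>H\<^esub> a) x)) \<noteq> 0" using x by (simp add: convolution_def)
  then obtain a where a: "f a \<noteq> 0" "g (\<alpha> (inv\<^bsub>H\<^esub> a) x) \<noteq> 0"
    by (metis (mono_tags, lifting) mem_Collect_eq mult_eq_0_iff sum.neutral)
  then have "x = \<alpha> a (\<alpha> (inv\<^bsub>H\<^esub> a) x)" using right[OF fin_supp_in[OF f] xC] by simp
  then show ?thesis using a xC by (auto intro!: image_eqI[of _ _ "(a, \<alpha> (inv\<^bsub>H\<^esub> a) x)"])
qed

lemma convolution_fin_supp:
  assumes f: "f \<in> fin_supp (carrier H)" and g: "g \<in> fin_supp C"
  shows "convolution H C \<alpha> f g \<in> fin_supp C"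
proof (rule fin_suppI)
  have "finite ((\<lambda>(h, c). \<alpha> h c) ` ({a. f a \<noteq> 0} \<times> {c. g c \<noteq> 0}))"
    using fin_supp_finite[OF f] fin_supp_finite[OF g] by simp
  then show "finite {x. convolution H C \<alpha> f g x \<noteq> 0}"
    by (rule finite_subset[rotated]) (use convolution_support[OF f] in blast)
  show "x \<in> C" if "convolution H C \<alpha> f g x \<noteq> 0" for x
    using convolution_support[OF f that] by blast
qed

text \<open>Substituting \<open>x = \<alpha> h c\<close> removes the inverse from the definition:
  the convolution is the pushforward of the product of \<open>f\<close> and \<open>g\<close> along
  \<open>\<alpha>\<close>.\<close>

lemma pairing_convolution:
  assumes f: "f \<in> fin_supp (carrier H)" and g: "g \<in> fin_supp C"
  shows "pairing (convolution H C \<alpha> f g) \<phi> = pairing f (\<lambda>h. pairing g (\<lambda>c. \<phi> (\<alpha> h c)))"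
proof -
  let ?F = "{a. f a \<noteq> 0}" and ?U = "{c. g c \<noteq> 0}"
  let ?V = "(\<lambda>(h, c). \<alpha> h c) ` (?F \<times> ?U)"
  have fin: "finite ?F" "finite ?U" "finite ?V"
    using fin_supp_finite[OF f] fin_supp_finite[OF g] by simp_all
  have VC: "x \<in> C" if "x \<in> ?V" for x
    using that closed fin_supp_in[OF f] fin_supp_in[OF g] by auto
  have "pairing (convolution H C \<alpha> f g) \<phi> = (\<Sum>x\<in>?V. convolution H C \<alpha> f g x * \<phi> x)"
    by (rule pairing_superset[OF fin(3)]) (use convolution_support[OF f] in blast)
  also have "\<dots> = (\<Sum>x\<in>?V. \<Sum>a\<in>?F. f a * (g (\<alpha> (inv\<^bsub>H\<^esub> a) x) * \<phi> x))"
    by (rule sum.cong) (use VC in \<open>auto simp: convolution_def sum_distrib_right mult.assoc\<close>)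
  also have "\<dots> = (\<Sum>a\<in>?F. f a * (\<Sum>x\<in>?V. g (\<alpha> (inv\<^bsub>H\<^esub> a) x) * \<phi> x))"
    by (subst sum.swap) (simp add: sum_distrib_left)
  also have "\<dots> = (\<Sum>a\<in>?F. f a * (\<Sum>c\<in>?U. g c * \<phi> (\<alpha> a c)))"
  proof (rule sum.cong[OF refl])
    fix a assume a: "a \<in> ?F"
    have aH: "a \<in> carrier H" using fin_supp_in[OF f] a by blast
    have UC: "c \<in> C" if "c \<in> ?U" for c using fin_supp_in[OF g] that by blast
    have inj: "inj_on (\<alpha> a) ?U" by (rule inj_on_inverseI) (rule left[OF aH UC])
    have "(\<Sum>x\<in>?V. g (\<alpha> (inv\<^bsub>H\<^esub> a) x) * \<phi> x) = (\<Sum>x\<in>\<alpha> a ` ?U. g (\<alpha> (inv\<^bsub>H\<^esub> a) x) * \<phi> x)"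
    proof (rule sum.mono_neutral_right[OF fin(3)])
      show "\<alpha> a ` ?U \<subseteq> ?V" using a by auto
      show "\<forall>x\<in>?V - \<alpha> a ` ?U. g (\<alpha> (inv\<^bsub>H\<^esub> a) x) * \<phi> x = 0"
      proof
        fix x assume x: "x \<in> ?V - \<alpha> a ` ?U"
        then have "x = \<alpha> a (\<alpha> (inv\<^bsub>H\<^esub> a) x)" using right[OF aH VC] by simp
        then have "\<alpha> (inv\<^bsub>H\<^esub> a) x \<notin> ?U" using x by blast
        then show "g (\<alpha> (inv\<^bsub>H\<^esub> a) x) * \<phi> x = 0" by simp
      qed
    qed
    also have "\<dots> = (\<Sum>c\<in>?U. g c * \<phi> (\<alpha> a c))"
      using left[OF aH UC] by (simp add: sum.reindex[OF inj])
    finally show "f a * (\<Sum>x\<in>?V. g (\<alpha> (inv\<^bsub>H\<^esub> a) x) * \<phi> x) = f a * (\<Sum>c\<in>?U. g c * \<phi> (\<alpha> a c))"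
      by simp
  qed
  finally show ?thesis by (simp add: pairing_def)
qed

end

lemma group_algebra_simps [simp]:
  "carrier (group_algebra H) = fin_supp (carrier H)"
  "\<one>\<^bsub>group_algebra H\<^esub> = delta \<one>\<^bsub>H\<^esub>" "\<zero>\<^bsub>group_algebra H\<^esub> = (\<lambda>x. 0)"
  "f \<oplus>\<^bsub>group_algebra H\<^esub> g = (\<lambda>x. f x + g x)"
  by (simp_all add: group_algebra_def)

lemma group_algebra_mult:
  "f \<otimes>\<^bsub>group_algebra H\<^esub> g = convolution H (carrier H) (\<lambda>a b. a \<otimes>\<^bsub>H\<^esub> b) f g"
  by (simp add: group_algebra_def convolution_def)

context group
begin

lemma group_algebra_mult_closed:
  assumes "f \<in> fin_supp (carrier G)" "g \<in> fin_supp (carrier G)"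
  shows "f \<otimes>\<^bsub>group_algebra G\<^esub> g \<in> fin_supp (carrier G)"
  unfolding group_algebra_mult by (rule convolution_fin_supp) (use assms word_simps in auto)

lemma pairing_mult:
  assumes "f \<in> fin_supp (carrier G)" "g \<in> fin_supp (carrier G)"
  shows "pairing (f \<otimes>\<^bsub>group_algebra G\<^esub> g) \<phi> = pairing f (\<lambda>a. pairing g (\<lambda>b. \<phi> (a \<otimes> b)))"
  unfolding group_algebra_mult by (rule pairing_convolution) (use assms word_simps in auto)

end

text \<open>Paired with an arbitrary \<open>\<phi>\<close>, each law of the product reduces to the
  same law of \<open>H\<close> under the sums.\<close>

lemma cring_group_algebra:
  assumes H: "comm_group H"
  shows "cring (group_algebra H)"
proof -
  interpret comm_group H by fact
  let ?S = "group_algebra H" and ?F = "fin_supp (carrier H)"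
  have add_inv: "\<exists>g\<in>?F. (\<lambda>x. g x + f x) = (\<lambda>x. 0)" if "f \<in> ?F" for f
    by (rule bexI[of _ "\<lambda>x. - 1 * f x"]) (use fin_supp_scale[OF that, of "-1"] in auto)
  have one: "delta \<one>\<^bsub>H\<^esub> \<in> ?F" by (rule fin_supp_delta) simp
  show ?thesis
  proof (rule cringI)
    show "abelian_group ?S"
      by (rule abelian_groupI) (use add_inv in \<open>auto simp: fin_supp_add fin_supp_zero algebra_simps\<close>)
    show "comm_monoid ?S"
    proof (rule comm_monoidI)
      fix f g h assume "f \<in> carrier ?S" "g \<in> carrier ?S" "h \<in> carrier ?S"
      then have f: "f \<in> ?F" and g: "g \<in> ?F" and h: "h \<in> ?F" by auto
      show fg: "f \<otimes>\<^bsub>?S\<^esub> g \<in> carrier ?S" using group_algebra_mult_closed f g by simp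
      note cl = group_algebra_mult_closed
      show "f \<otimes>\<^bsub>?S\<^esub> g \<otimes>\<^bsub>?S\<^esub> h = f \<otimes>\<^bsub>?S\<^esub> (g \<otimes>\<^bsub>?S\<^esub> h)"
      proof (rule fin_supp_eqI[OF cl[OF cl[OF f g] h] cl[OF f cl[OF g h]]])
        fix \<phi>
        show "pairing (f \<otimes>\<^bsub>?S\<^esub> g \<otimes>\<^bsub>?S\<^esub> h) \<phi> = pairing (f \<otimes>\<^bsub>?S\<^esub> (g \<otimes>\<^bsub>?S\<^esub> h)) \<phi>"
          unfolding pairing_mult[OF cl[OF f g] h] pairing_mult[OF f cl[OF g h]]
            pairing_mult[OF f g] pairing_mult[OF g h]
          by (intro pairing_cong)
            (use fin_supp_in[OF f] fin_supp_in[OF g] fin_supp_in[OF h] in \<open>simp add: m_assoc\<close>)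
      qed
      show "f \<otimes>\<^bsub>?S\<^esub> g = g \<otimes>\<^bsub>?S\<^esub> f"
      proof (rule fin_supp_eqI[OF cl[OF f g] cl[OF g f]])
        fix \<phi>
        show "pairing (f \<otimes>\<^bsub>?S\<^esub> g) \<phi> = pairing (g \<otimes>\<^bsub>?S\<^esub> f) \<phi>"
          unfolding pairing_mult[OF f g] pairing_mult[OF g f]
          by (subst pairing_swap, intro pairing_cong)
            (use fin_supp_in[OF f] fin_supp_in[OF g] in \<open>simp add: m_comm\<close>)
      qed
      show "\<one>\<^bsub>?S\<^esub> \<otimes>\<^bsub>?S\<^esub> f = f"
      proof (rule fin_supp_eqI[OF _ f])
        show "\<one>\<^bsub>?S\<^esub> \<otimes>\<^bsub>?S\<^esub> f \<in> ?F" using cl[OF one f] by simp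
        fix \<phi>
        show "pairing (\<one>\<^bsub>?S\<^esub> \<otimes>\<^bsub>?S\<^esub> f) \<phi> = pairing f \<phi>"
          using pairing_mult[OF one f] by (auto intro!: pairing_cong simp: fin_supp_in[OF f])
      qed
    qed (use one in simp)
    fix f g h assume "f \<in> carrier ?S" "g \<in> carrier ?S" "h \<in> carrier ?S"
    then have f: "f \<in> ?F" and g: "g \<in> ?F" and h: "h \<in> ?F" by auto
    note cl = group_algebra_mult_closed
    show "(f \<oplus>\<^bsub>?S\<^esub> g) \<otimes>\<^bsub>?S\<^esub> h = f \<otimes>\<^bsub>?S\<^esub> h \<oplus>\<^bsub>?S\<^esub> g \<otimes>\<^bsub>?S\<^esub> h"
    proof (rule fin_supp_eqI)
      show "(f \<oplus>\<^bsub>?S\<^esub> g) \<otimes>\<^bsub>?S\<^esub> h \<in> ?F" using cl[OF fin_supp_add[OF f g] h] by simp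
      show "f \<otimes>\<^bsub>?S\<^esub> h \<oplus>\<^bsub>?S\<^esub> g \<otimes>\<^bsub>?S\<^esub> h \<in> ?F" using fin_supp_add[OF cl[OF f h] cl[OF g h]] by simp
      fix \<phi>
      show "pairing ((f \<oplus>\<^bsub>?S\<^esub> g) \<otimes>\<^bsub>?S\<^esub> h) \<phi> = pairing (f \<otimes>\<^bsub>?S\<^esub> h \<oplus>\<^bsub>?S\<^esub> g \<otimes>\<^bsub>?S\<^esub> h) \<phi>"
        using pairing_mult[OF fin_supp_add[OF f g] h] pairing_add[OF cl[OF f h] cl[OF g h]]
          pairing_add[OF f g] pairing_mult[OF f h] pairing_mult[OF g h] by simp
    qed
  qed
qed

section \<open>The relations that define the tensor product with \<complex>\<close>

lemma subspace_tensor_relations: "cfun.subspace (tensor_relations Q)"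
proof (rule cfun.subspaceI)
  show "0 \<in> tensor_relations Q"
    using tensor_relations.intros(1)[of Q] by (simp only: zero_fun_def)
  fix f g assume f: "f \<in> tensor_relations Q" and g: "g \<in> tensor_relations Q"
  show "f + g \<in> tensor_relations Q"
    using g
  proof (induction rule: tensor_relations.induct)
    case 1
    then show ?case using f by (simp add: plus_fun_def)
  next
    case (2 h a b c)
    have "f + (\<lambda>x. h x + c * (delta (a \<otimes>\<^bsub>Q\<^esub> b) x - delta a x - delta b x)) =
        (\<lambda>x. (f + h) x + c * (delta (a \<otimes>\<^bsub>Q\<^esub> b) x - delta a x - delta b x))"
      by (simp add: fun_eq_iff)
    then show ?case using tensor_relations.intros(2)[OF 2(4,2,3), of c] by (simp only:)
  qed
next
  fix c f assume f: "f \<in> tensor_relations Q"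
  then show "(\<lambda>x. c * f x) \<in> tensor_relations Q"
  proof (induction rule: tensor_relations.induct)
    case 1
    then show ?case using tensor_relations.intros(1) by simp
  next
    case (2 h a b d)
    have "(\<lambda>x. c * (h x + d * (delta (a \<otimes>\<^bsub>Q\<^esub> b) x - delta a x - delta b x))) =
        (\<lambda>x. c * h x + (c * d) * (delta (a \<otimes>\<^bsub>Q\<^esub> b) x - delta a x - delta b x))"
      by (simp add: fun_eq_iff algebra_simps)
    then show ?case using tensor_relations.intros(2)[OF 2(4,2,3), of "c * d"] by (simp only:)
  qed
qed

lemma tensor_relations_basic:
  assumes "a \<in> carrier Q" "b \<in> carrier Q"
  shows "(\<lambda>x. delta (a \<otimes>\<^bsub>Q\<^esub> b) x - delta a x - delta b x) \<in> tensor_relations Q"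
  using tensor_relations.intros(2)[OF tensor_relations.intros(1) assms, of 1] by simp

lemma tensor_relations_fin_supp:
  assumes "monoid Q"
  shows "tensor_relations Q \<subseteq> fin_supp (carrier Q)"
proof
  interpret monoid Q by fact
  fix f assume "f \<in> tensor_relations Q"
  then show "f \<in> fin_supp (carrier Q)"
  proof (induction rule: tensor_relations.induct)
    case (2 f a b c)
    have "(\<lambda>x. c * (delta (a \<otimes>\<^bsub>Q\<^esub> b) x + - 1 * (delta a x + delta b x))) \<in> fin_supp (carrier Q)"
      using 2 by (intro fin_supp_scale fin_supp_add fin_supp_delta) auto
    from fin_supp_add[OF 2(4) this] show ?case by (simp add: algebra_simps)
  qed (rule fin_supp_zero)
qed

text \<open>In this way an additive function on \<open>Q\<close> gives a linear form on the tensor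
  product of \<open>Q\<close> with \<complex>.\<close>

lemma pairing_tensor_relations:
  assumes Q: "monoid Q" and \<phi>: "\<And>a b. a \<in> carrier Q \<Longrightarrow> b \<in> carrier Q \<Longrightarrow> \<phi> (a \<otimes>\<^bsub>Q\<^esub> b) = \<phi> a + \<phi> b"
    and s: "s \<in> tensor_relations Q"
  shows "pairing s \<phi> = 0"
  using s
proof (induction rule: tensor_relations.induct)
  case (2 f a b c)
  interpret monoid Q by fact
  \<comment> \<open>The difference is written as a sum with the scalar \<open>-1\<close>, the shape
    covered by \<open>pairing_add\<close> and \<open>pairing_scale\<close>.\<close>
  let ?d = "\<lambda>x. delta (a \<otimes>\<^bsub>Q\<^esub> b) x + - 1 * (delta a x + delta b x)"
  have d: "?d \<in> fin_supp (carrier Q)"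
    using 2 by (intro fin_supp_scale fin_supp_add fin_supp_delta) auto
  have "pairing ?d \<phi> = \<phi> (a \<otimes>\<^bsub>Q\<^esub> b) - (\<phi> a + \<phi> b)"
    using 2 by (subst pairing_add[of _ "carrier Q"], blast intro: fin_supp_delta,
      intro fin_supp_scale fin_supp_add fin_supp_delta, blast, blast,
      subst pairing_scale, subst pairing_add[of _ "carrier Q"]) (auto intro: fin_supp_delta)
  then have "pairing ?d \<phi> = 0" using \<phi> 2 by simp
  moreover have fS: "f \<in> fin_supp (carrier Q)" using tensor_relations_fin_supp[OF Q] 2 by blast
  moreover have "pairing (\<lambda>x. f x + c * ?d x) \<phi> = pairing f \<phi> + c * pairing ?d \<phi>"
    by (simp only: pairing_add[OF fS fin_supp_scale[OF d, of c]] pairing_scale)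
  moreover have "pairing f \<phi> = 0" by (rule 2)
  ultimately have "pairing (\<lambda>x. f x + c * ?d x) \<phi> = 0" by (simp only: mult_zero_right add_0)
  then show ?case by (simp add: algebra_simps)
qed simp

section \<open>The Alexander module\<close>

lemma eval_char_pairing: "eval_char \<theta> f = pairing f (\<lambda>h. the_elem (\<theta> ` h))"
  by (simp add: eval_char_def pairing_def)

text \<open>Descends \<open>u\<close> to cosets by evaluation at a chosen representative, which
  keeps the passage linear in \<open>u\<close> without side conditions; \<open>tilde_coset\<close>
  removes the choice for homomorphisms on \<open>G'\<close>.\<close>

definition tilde :: "('a \<Rightarrow> complex) \<Rightarrow> 'a set \<Rightarrow> complex"
  where "tilde u c = u (SOME x. x \<in> c)"

lemma tilde_add: "tilde (\<lambda>x. u x + v x) = (\<lambda>c. tilde u c + tilde v c)"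
  and tilde_scale: "tilde (\<lambda>x. z * u x) = (\<lambda>c. z * tilde u c)"
  by (simp_all add: tilde_def fun_eq_iff)

text \<open>The class of \<open>f\<close> in the tensor product of \<open>Q\<close> with \<complex>;
  the elements of \<open>alexander_module\<close> have this form.\<close>

definition coset_cl :: "('a, 'b) monoid_scheme \<Rightarrow> ('a \<Rightarrow> complex) \<Rightarrow> ('a \<Rightarrow> complex) set"
  where "coset_cl Q f = {(\<lambda>x. f x + s x) | s. s \<in> tensor_relations Q}"

section \<open>The quotients G/G' and G'/G'' and the conjugation action\<close>

context group
begin

abbreviation "D1 \<equiv> derived G (carrier G)"
abbreviation "D2 \<equiv> derived G (derived G (carrier G))"
abbreviation "Gab \<equiv> abelianization G"
abbreviation "SQ \<equiv> second_quotient G"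

lemma D1_normal: "D1 \<lhd> G" by (rule derived_self_is_normal)

lemma D2_normal: "D2 \<lhd> G" by (rule derived_is_normal[OF derived_self_is_normal])

lemma D1_subgroup: "subgroup D1 G" by (rule normal_imp_subgroup[OF D1_normal])

lemma D2_subgroup: "subgroup D2 G" by (rule normal_imp_subgroup[OF D2_normal])

lemma D1_closed: "x \<in> D1 \<Longrightarrow> x \<in> carrier G"
  by (rule subgroup.mem_carrier[OF D1_subgroup])

lemma D2_le_D1: "D2 \<subseteq> D1"
  by (rule derived_incl[OF subset_refl D1_subgroup])

lemma comm_group_Gab: "comm_group Gab"
  unfolding abelianization_def by (rule derived_quot_is_comm_group)

lemma carrier_Gab: "carrier Gab = (\<lambda>g. D1 #> g) ` carrier G"
  by (simp add: abelianization_def carrier_FactGroup)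

lemma Gab_mult:
  "g \<in> carrier G \<Longrightarrow> h \<in> carrier G \<Longrightarrow> (D1 #> g) \<otimes>\<^bsub>Gab\<^esub> (D1 #> h) = D1 #> (g \<otimes> h)"
  by (simp add: abelianization_def normal.rcos_sum[OF D1_normal])

lemma Gab_one: "\<one>\<^bsub>Gab\<^esub> = D1 #> \<one>"
  using subgroup.subset[OF D1_subgroup] by (simp add: abelianization_def coset_mult_one)

lemma carrier_SQ: "carrier SQ = (\<lambda>x. D2 #> x) ` D1"
  by (simp add: second_quotient_def carrier_FactGroup r_coset_def)

lemma SQ_mult:
  assumes "x \<in> D1" "y \<in> D1"
  shows "(D2 #> x) \<otimes>\<^bsub>SQ\<^esub> (D2 #> y) = D2 #> (x \<otimes> y)"
proof -
  have "(D2 #> x) \<otimes>\<^bsub>SQ\<^esub> (D2 #> y) = (D2 #> x) <#> (D2 #> y)"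
    by (simp add: second_quotient_def set_mult_def)
  then show ?thesis using normal.rcos_sum[OF D2_normal] assms D1_closed by simp
qed

text \<open>\<open>derived_consistent\<close> identifies the derived subgroup taken inside the group
  \<open>G'\<close> with \<open>D2\<close>, which is formed in \<open>G\<close>.\<close>

lemma comm_group_SQ: "comm_group SQ"
  using group.derived_quot_is_comm_group[OF subgroup_imp_group[OF D1_subgroup]]
    derived_consistent[OF _ D1_subgroup, of D1]
  by (simp add: second_quotient_def)

lemma rcos_mem: "x \<in> D2 #> y \<longleftrightarrow> (\<exists>d\<in>D2. x = d \<otimes> y)" "z \<in> D1 #> g \<longleftrightarrow> (\<exists>d\<in>D1. z = d \<otimes> g)"
  by (auto simp: r_coset_def)

lemma commutator_in_D2: "x \<in> D1 \<Longrightarrow> y \<in> D1 \<Longrightarrow> commutator x y \<in> D2"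
  unfolding derived_def[of G "derived G (carrier G)"] commutator_def by (rule generate.incl) blast

text \<open>Replacing \<open>g\<close> by \<open>d \<otimes> g\<close> with
  \<open>d \<in> D1\<close> changes the conjugate by a commutator of two elements of
  \<open>D1\<close>, that is by an element of \<open>D2\<close>. Hence all the products fill a
  single coset.\<close>

lemma conj_act_coset:
  assumes g: "g \<in> carrier G" and x: "x \<in> D1"
  shows "conj_act G (D1 #> g) (D2 #> x) = D2 #> (g \<otimes> x \<otimes> inv g)"
proof -
  have xC: "x \<in> carrier G" using D1_closed[OF x] .
  have y: "g \<otimes> x \<otimes> inv g \<in> D1" using normal.inv_op_closed2[OF D1_normal g x] .
  {
    fix z assume "z \<in> conj_act G (D1 #> g) (D2 #> x)"
    then obtain d e where d: "d \<in> D1" and e: "e \<in> D2" and z: "z = (d \<otimes> g) \<otimes> (e \<otimes> x) \<otimes> inv (d \<otimes> g)"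
      by (auto simp: conj_act_def r_coset_def)
    have C: "d \<in> carrier G" "e \<in> carrier G"
      using D1_closed[OF d] D1_closed D2_le_D1 e by auto
    let ?e' = "d \<otimes> (g \<otimes> e \<otimes> inv g) \<otimes> inv d"
    have "z = (?e' \<otimes> commutator d (g \<otimes> x \<otimes> inv g)) \<otimes> (g \<otimes> x \<otimes> inv g)"
      unfolding z commutator_def using C g xC by (simp add: word_simps)
    moreover have "?e' \<otimes> commutator d (g \<otimes> x \<otimes> inv g) \<in> D2"
      using normal.inv_op_closed2[OF D2_normal C(1) normal.inv_op_closed2[OF D2_normal g e]]
        commutator_in_D2[OF d y] by (rule subgroup.m_closed[OF D2_subgroup])
    ultimately have "z \<in> D2 #> (g \<otimes> x \<otimes> inv g)" unfolding rcos_mem by blast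
  }
  moreover {
    fix z assume "z \<in> D2 #> (g \<otimes> x \<otimes> inv g)"
    then obtain e where e: "e \<in> D2" and z: "z = e \<otimes> (g \<otimes> x \<otimes> inv g)" unfolding rcos_mem by blast
    have eC: "e \<in> carrier G" using D1_closed D2_le_D1 e by auto
    let ?e' = "inv g \<otimes> e \<otimes> g"
    have "z = g \<otimes> (?e' \<otimes> x) \<otimes> inv g" unfolding z using eC g xC by (simp add: word_simps)
    moreover have "?e' \<otimes> x \<in> D2 #> x" unfolding rcos_mem using normal.inv_op_closed1[OF D2_normal g e] by blast
    moreover have "g \<in> D1 #> g" using rcos_self[OF g D1_subgroup] .
    ultimately have "z \<in> conj_act G (D1 #> g) (D2 #> x)" unfolding conj_act_def by blast
  }
  ultimately show ?thesis by blast
qed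

lemma conj_in_D1: "g \<in> carrier G \<Longrightarrow> x \<in> D1 \<Longrightarrow> g \<otimes> x \<otimes> inv g \<in> D1"
  by (rule normal.inv_op_closed2[OF D1_normal])

lemma conj_act_closed: "h \<in> carrier Gab \<Longrightarrow> c \<in> carrier SQ \<Longrightarrow> conj_act G h c \<in> carrier SQ"
  by (auto simp: carrier_Gab carrier_SQ conj_act_coset conj_in_D1)

lemma conj_act_mult:
  assumes "h \<in> carrier Gab" "h' \<in> carrier Gab" "c \<in> carrier SQ"
  shows "conj_act G (h \<otimes>\<^bsub>Gab\<^esub> h') c = conj_act G h (conj_act G h' c)"
proof -
  obtain g g' x where gx: "h = D1 #> g" "h' = D1 #> g'" "c = D2 #> x" "g \<in> carrier G" "g' \<in> carrier G" "x \<in> D1"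
    using assms by (auto simp: carrier_Gab carrier_SQ)
  have "conj_act G h (conj_act G h' c) = D2 #> (g \<otimes> (g' \<otimes> x \<otimes> inv g') \<otimes> inv g)"
    using gx by (simp add: conj_act_coset conj_in_D1)
  also have "g \<otimes> (g' \<otimes> x \<otimes> inv g') \<otimes> inv g = (g \<otimes> g') \<otimes> x \<otimes> inv (g \<otimes> g')"
    using gx D1_closed by (simp add: word_simps)
  finally show ?thesis using gx by (simp add: Gab_mult conj_act_coset)
qed

lemma conj_act_one: "c \<in> carrier SQ \<Longrightarrow> conj_act G \<one>\<^bsub>Gab\<^esub> c = c"
  unfolding Gab_one by (auto simp: carrier_SQ conj_act_coset D1_closed)

lemma conj_act_inv:
  assumes "h \<in> carrier Gab" "c \<in> carrier SQ"
  shows "conj_act G (inv\<^bsub>Gab\<^esub> h) (conj_act G h c) = c" "conj_act G h (conj_act G (inv\<^bsub>Gab\<^esub> h) c) = c"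
proof -
  interpret A: comm_group Gab by (rule comm_group_Gab)
  show "conj_act G (inv\<^bsub>Gab\<^esub> h) (conj_act G h c) = c" "conj_act G h (conj_act G (inv\<^bsub>Gab\<^esub> h) c) = c"
    using assms conj_act_mult[of "inv\<^bsub>Gab\<^esub> h" h c] conj_act_mult[of h "inv\<^bsub>Gab\<^esub> h" c] conj_act_one by simp_all
qed

lemma conj_act_hom:
  assumes "h \<in> carrier Gab" "a \<in> carrier SQ" "b \<in> carrier SQ"
  shows "conj_act G h (a \<otimes>\<^bsub>SQ\<^esub> b) = conj_act G h a \<otimes>\<^bsub>SQ\<^esub> conj_act G h b"
proof -
  obtain g x y where gx: "h = D1 #> g" "a = D2 #> x" "b = D2 #> y" "g \<in> carrier G" "x \<in> D1" "y \<in> D1"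
    using assms by (auto simp: carrier_Gab carrier_SQ)
  have "g \<otimes> (x \<otimes> y) \<otimes> inv g = (g \<otimes> x \<otimes> inv g) \<otimes> (g \<otimes> y \<otimes> inv g)"
    using gx D1_closed by (simp add: word_simps)
  then show ?thesis
    using gx subgroup.m_closed[OF D1_subgroup] by (simp add: conj_act_coset SQ_mult conj_in_D1)
qed

text \<open>This makes \<open>pairing_convolution\<close> available, so the module laws follow in
  the same way as those of the group algebra.\<close>

lemma algebra_act_convolution: "algebra_act G r f = convolution Gab (carrier SQ) (conj_act G) r f"
  by (simp add: algebra_act_def convolution_def)

lemma algebra_act_closed:
  "r \<in> fin_supp (carrier Gab) \<Longrightarrow> f \<in> fin_supp (carrier SQ) \<Longrightarrow> algebra_act G r f \<in> fin_supp (carrier SQ)"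
  unfolding algebra_act_convolution
  by (rule convolution_fin_supp) (auto simp: conj_act_closed conj_act_inv)

lemma pairing_algebra_act:
  "r \<in> fin_supp (carrier Gab) \<Longrightarrow> f \<in> fin_supp (carrier SQ) \<Longrightarrow>
    pairing (algebra_act G r f) \<phi> = pairing r (\<lambda>h. pairing f (\<lambda>c. \<phi> (conj_act G h c)))"
  unfolding algebra_act_convolution
  by (rule pairing_convolution) (auto simp: conj_act_closed conj_act_inv)

lemma algebra_act_add_left:
  assumes "r \<in> fin_supp (carrier Gab)" "r' \<in> fin_supp (carrier Gab)" "f \<in> fin_supp (carrier SQ)"
  shows "algebra_act G (\<lambda>h. r h + r' h) f = (\<lambda>x. algebra_act G r f x + algebra_act G r' f x)"
  by (rule fin_supp_eqI[of _ "carrier SQ"])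
    (use assms in \<open>simp_all add: algebra_act_closed fin_supp_add pairing_algebra_act
      pairing_add[OF algebra_act_closed algebra_act_closed] pairing_add[OF assms(1,2)]\<close>)

lemma algebra_act_scale_left:
  assumes "r \<in> fin_supp (carrier Gab)" "f \<in> fin_supp (carrier SQ)"
  shows "algebra_act G (\<lambda>h. c * r h) f = (\<lambda>x. c * algebra_act G r f x)"
  by (rule fin_supp_eqI[of _ "carrier SQ"])
    (use assms in \<open>simp_all add: algebra_act_closed fin_supp_scale pairing_algebra_act pairing_scale\<close>)

lemma algebra_act_add:
  assumes "r \<in> fin_supp (carrier Gab)" "f \<in> fin_supp (carrier SQ)" "g \<in> fin_supp (carrier SQ)"
  shows "algebra_act G r (\<lambda>x. f x + g x) = (\<lambda>x. algebra_act G r f x + algebra_act G r g x)"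
  by (rule fin_supp_eqI[of _ "carrier SQ"])
    (use assms in \<open>simp_all add: algebra_act_closed fin_supp_add pairing_algebra_act
      pairing_add[OF algebra_act_closed algebra_act_closed] pairing_add[OF assms(2,3)] pairing_add_right\<close>)

lemma algebra_act_scale:
  assumes "r \<in> fin_supp (carrier Gab)" "f \<in> fin_supp (carrier SQ)"
  shows "algebra_act G r (\<lambda>x. c * f x) = (\<lambda>x. c * algebra_act G r f x)"
  by (rule fin_supp_eqI[of _ "carrier SQ"])
    (use assms in \<open>simp_all add: algebra_act_closed fin_supp_scale pairing_algebra_act pairing_scale pairing_scale_right\<close>)

lemma algebra_act_mult:
  assumes r: "r \<in> fin_supp (carrier Gab)" and r': "r' \<in> fin_supp (carrier Gab)" and f: "f \<in> fin_supp (carrier SQ)"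
  shows "algebra_act G r (algebra_act G r' f) = algebra_act G (r \<otimes>\<^bsub>group_algebra Gab\<^esub> r') f"
proof -
  interpret A: comm_group Gab by (rule comm_group_Gab)
  show ?thesis
  proof (rule fin_supp_eqI[of _ "carrier SQ"])
    fix \<phi>
    show "pairing (algebra_act G r (algebra_act G r' f)) \<phi> =
        pairing (algebra_act G (r \<otimes>\<^bsub>group_algebra Gab\<^esub> r') f) \<phi>"
      unfolding pairing_algebra_act[OF r algebra_act_closed[OF r' f]] pairing_algebra_act[OF r' f]
        pairing_algebra_act[OF A.group_algebra_mult_closed[OF r r'] f] A.pairing_mult[OF r r']
      by (intro pairing_cong)
        (simp add: conj_act_mult fin_supp_in[OF r] fin_supp_in[OF r'] fin_supp_in[OF f])
  qed (use assms algebra_act_closed A.group_algebra_mult_closed in auto)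
qed

lemma algebra_act_delta:
  assumes "h \<in> carrier Gab" "c \<in> carrier SQ"
  shows "algebra_act G (delta h) (delta c) = delta (conj_act G h c)"
  by (rule fin_supp_eqI[of _ "carrier SQ"])
    (use assms in \<open>simp_all add: algebra_act_closed fin_supp_delta conj_act_closed pairing_algebra_act\<close>)

lemma algebra_act_one:
  assumes f: "f \<in> fin_supp (carrier SQ)"
  shows "algebra_act G (delta \<one>\<^bsub>Gab\<^esub>) f = f"
proof -
  interpret A: comm_group Gab by (rule comm_group_Gab)
  have d: "delta \<one>\<^bsub>Gab\<^esub> \<in> fin_supp (carrier Gab)" by (rule fin_supp_delta) simp
  show ?thesis
  proof (rule fin_supp_eqI[OF algebra_act_closed[OF d f] f])
    fix \<phi>
    show "pairing (algebra_act G (delta \<one>\<^bsub>Gab\<^esub>) f) \<phi> = pairing f \<phi>"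
      unfolding pairing_algebra_act[OF d f] pairing_delta
      by (rule pairing_cong) (simp add: conj_act_one fin_supp_in[OF f])
  qed
qed

lemma algebra_act_zero: "algebra_act G r (\<lambda>x. 0) = (\<lambda>x. 0)"
  by (simp add: algebra_act_def fun_eq_iff)

text \<open>Conjugation is an automorphism of \<open>G'/G''\<close>, so each \<open>h\<close>
  carries a basic relation to a basic relation; \<open>r\<close> acts by a finite linear combination
  of such \<open>h\<close>.\<close>

lemma algebra_act_tensor_relations:
  assumes r: "r \<in> fin_supp (carrier Gab)" and s: "s \<in> tensor_relations SQ"
  shows "algebra_act G r s \<in> tensor_relations SQ"
  using s
proof (induction rule: tensor_relations.induct)
  case 1
  then show ?case by (simp add: algebra_act_zero tensor_relations.intros(1))
next
  case (2 f a b c)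
  interpret Q: comm_group SQ by (rule comm_group_SQ)
  let ?d = "\<lambda>a b x. delta (a \<otimes>\<^bsub>SQ\<^esub> b) x + - 1 * (delta a x + delta b x)"
  have dS: "?d a b \<in> fin_supp (carrier SQ)" if "a \<in> carrier SQ" "b \<in> carrier SQ" for a b
    using that by (intro fin_supp_scale fin_supp_add fin_supp_delta) auto
  have dR: "?d a b \<in> tensor_relations SQ" if "a \<in> carrier SQ" "b \<in> carrier SQ" for a b
    using tensor_relations_basic[OF that] by (simp add: algebra_simps)
  have "algebra_act G r (?d a b) = (\<Sum>h\<in>{h. r h \<noteq> 0}. (\<lambda>x. r h * ?d (conj_act G h a) (conj_act G h b) x))"
  proof (rule fin_supp_eqI[OF algebra_act_closed[OF r dS[OF 2(2,3)]]])
    show S: "(\<Sum>h\<in>{h. r h \<noteq> 0}. (\<lambda>x. r h * ?d (conj_act G h a) (conj_act G h b) x)) \<in> fin_supp (carrier SQ)"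
      by (intro cfun.subspace_sum[OF subspace_fin_supp] fin_supp_scale dS conj_act_closed)
        (use fin_supp_in[OF r] 2 in auto)
    fix \<phi>
    have pd: "pairing (?d a b) \<psi> = \<psi> (a \<otimes>\<^bsub>SQ\<^esub> b) - \<psi> a - \<psi> b"
      if "a \<in> carrier SQ" "b \<in> carrier SQ" for a b \<psi>
    proof -
      have ab: "delta (a \<otimes>\<^bsub>SQ\<^esub> b) \<in> fin_supp (carrier SQ)" "delta a \<in> fin_supp (carrier SQ)"
        "delta b \<in> fin_supp (carrier SQ)" using that by (auto intro: fin_supp_delta)
      show ?thesis
        by (simp only: pairing_add[OF ab(1) fin_supp_scale[OF fin_supp_add[OF ab(2,3)]]]
            pairing_scale pairing_add[OF ab(2,3)] pairing_delta) simp
    qed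
    have ps: "pairing (\<Sum>h\<in>T. F h) \<psi> = (\<Sum>h\<in>T. pairing (F h) \<psi>)"
      if "finite T" "\<And>h. h \<in> T \<Longrightarrow> F h \<in> fin_supp (carrier SQ)" for T F \<psi>
      using that
    proof (induction T rule: finite_induct)
      case empty
      then show ?case by (simp add: pairing_def)
    next
      case (insert h T)
      then have "pairing (F h + (\<Sum>h\<in>T. F h)) \<psi> = pairing (F h) \<psi> + pairing (\<Sum>h\<in>T. F h) \<psi>"
        unfolding plus_fun_def
        by (intro pairing_add[of _ "carrier SQ"] cfun.subspace_sum[OF subspace_fin_supp]) auto
      moreover have "pairing (\<Sum>h\<in>T. F h) \<psi> = (\<Sum>h\<in>T. pairing (F h) \<psi>)"
        using insert.IH insert.prems by blast
      ultimately show ?case by (simp only: sum.insert[OF insert.hyps])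
    qed
    have "pairing (\<Sum>h\<in>{h. r h \<noteq> 0}. (\<lambda>x. r h * ?d (conj_act G h a) (conj_act G h b) x)) \<phi> =
        (\<Sum>h\<in>{h. r h \<noteq> 0}. pairing (\<lambda>x. r h * ?d (conj_act G h a) (conj_act G h b) x) \<phi>)"
      by (intro ps fin_supp_finite[OF r] fin_supp_scale dS conj_act_closed)
        (use fin_supp_in[OF r] 2 in auto)
    also have "\<dots> = (\<Sum>h\<in>{h. r h \<noteq> 0}. r h * pairing (?d a b) (\<lambda>c. \<phi> (conj_act G h c)))"
    proof (rule sum.cong[OF refl])
      fix h assume "h \<in> {h. r h \<noteq> 0}"
      then have h: "h \<in> carrier Gab" using fin_supp_in[OF r] by blast
      show "pairing (\<lambda>x. r h * ?d (conj_act G h a) (conj_act G h b) x) \<phi> =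
          r h * pairing (?d a b) (\<lambda>c. \<phi> (conj_act G h c))"
        unfolding pairing_scale pd[OF 2(2,3)] pd[OF conj_act_closed[OF h 2(2)] conj_act_closed[OF h 2(3)]]
          conj_act_hom[OF h 2(2,3)] ..
    qed
    finally show "pairing (algebra_act G r (?d a b)) \<phi> =
        pairing (\<Sum>h\<in>{h. r h \<noteq> 0}. (\<lambda>x. r h * ?d (conj_act G h a) (conj_act G h b) x)) \<phi>"
      unfolding pairing_algebra_act[OF r dS[OF 2(2,3)]] by (simp add: pairing_def[of r])
  qed
  moreover have "(\<Sum>h\<in>{h. r h \<noteq> 0}. (\<lambda>x. r h * ?d (conj_act G h a) (conj_act G h b) x)) \<in> tensor_relations SQ"
    by (intro cfun.subspace_sum[OF subspace_tensor_relations] cfun.subspace_scale[OF subspace_tensor_relations]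
        dR conj_act_closed) (use fin_supp_in[OF r] 2 in auto)
  ultimately have d: "algebra_act G r (?d a b) \<in> tensor_relations SQ" by simp
  have fS: "f \<in> fin_supp (carrier SQ)" using tensor_relations_fin_supp[OF Q.is_monoid] 2 by blast
  have "algebra_act G r (\<lambda>x. f x + c * ?d a b x) = algebra_act G r f + (\<lambda>x. c * algebra_act G r (?d a b) x)"
    by (simp only: algebra_act_add[OF r fS fin_supp_scale[OF dS[OF 2(2,3)]]]
        algebra_act_scale[OF r dS[OF 2(2,3)]] plus_fun_def)
  also have "\<dots> \<in> tensor_relations SQ"
    by (intro cfun.subspace_add[OF subspace_tensor_relations] 2 cfun.subspace_scale[OF subspace_tensor_relations] d)
  finally show ?case by (simp add: algebra_simps)
qed

end

section \<open>The Alexander module through representatives\<close>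

lemma coset_cl_eq_iff:
  "coset_cl Q f = coset_cl Q g \<longleftrightarrow> (\<lambda>x. f x - g x) \<in> tensor_relations Q"
proof
  let ?R = "tensor_relations Q"
  assume eq: "coset_cl Q f = coset_cl Q g"
  have "f \<in> coset_cl Q f"
    unfolding coset_cl_def using tensor_relations.intros(1)[of Q] by force
  then obtain s where "s \<in> ?R" "f = (\<lambda>x. g x + s x)" unfolding eq by (auto simp: coset_cl_def)
  then show "(\<lambda>x. f x - g x) \<in> ?R" by simp
next
  let ?R = "tensor_relations Q"
  note R = subspace_tensor_relations[of Q]
  assume d: "(\<lambda>x. f x - g x) \<in> ?R"
  have "coset_cl Q f \<subseteq> coset_cl Q g" if d: "(\<lambda>x. f x - g x) \<in> ?R" for f g
  proof
    fix k assume "k \<in> coset_cl Q f"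
    then obtain s where s: "s \<in> ?R" "k = (\<lambda>x. f x + s x)" by (auto simp: coset_cl_def)
    have "k = (\<lambda>x. g x + ((\<lambda>x. f x - g x) + s) x)" using s by (simp add: fun_eq_iff)
    moreover have "(\<lambda>x. f x - g x) + s \<in> ?R" by (rule cfun.subspace_add[OF R d s(1)])
    ultimately show "k \<in> coset_cl Q g" unfolding coset_cl_def by blast
  qed
  moreover have "(\<lambda>x. g x - f x) \<in> ?R"
    using cfun.subspace_scale[OF R d, of "-1"] by simp
  ultimately show "coset_cl Q f = coset_cl Q g" using d by blast
qed

context group
begin

abbreviation "AM \<equiv> alexander_module G"
abbreviation "GA \<equiv> group_algebra (abelianization G)"
abbreviation "TR \<equiv> tensor_relations (second_quotient G)"
abbreviation "FS \<equiv> fin_supp (carrier (second_quotient G))"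

lemma AM_carrier: "carrier AM = coset_cl SQ ` FS"
  by (auto simp: alexander_module_def Let_def coset_cl_def)

lemma AM_zero: "\<zero>\<^bsub>AM\<^esub> = coset_cl SQ (\<lambda>x. 0)"
  by (auto simp: alexander_module_def Let_def coset_cl_def)

lemma AM_add: "coset_cl SQ f \<oplus>\<^bsub>AM\<^esub> coset_cl SQ g = coset_cl SQ (\<lambda>x. f x + g x)"
proof -
  note R = subspace_tensor_relations[of SQ]
  have "{(\<lambda>x. k x + l x) | k l. k \<in> coset_cl SQ f \<and> l \<in> coset_cl SQ g} = coset_cl SQ (\<lambda>x. f x + g x)"
  proof (intro equalityI subsetI)
    fix h assume "h \<in> {(\<lambda>x. k x + l x) | k l. k \<in> coset_cl SQ f \<and> l \<in> coset_cl SQ g}"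
    then obtain s t where st: "s \<in> TR" "t \<in> TR" "h = (\<lambda>x. (f x + s x) + (g x + t x))"
      by (auto simp: coset_cl_def)
    then have "h = (\<lambda>x. (f x + g x) + (s + t) x)" by (simp add: fun_eq_iff)
    then show "h \<in> coset_cl SQ (\<lambda>x. f x + g x)"
      unfolding coset_cl_def using cfun.subspace_add[OF R st(1,2)] by blast
  next
    fix h assume "h \<in> coset_cl SQ (\<lambda>x. f x + g x)"
    then obtain s where s: "s \<in> TR" "h = (\<lambda>x. (f x + s x) + (g x + 0))"
      by (auto simp: coset_cl_def algebra_simps)
    then show "h \<in> {(\<lambda>x. k x + l x) | k l. k \<in> coset_cl SQ f \<and> l \<in> coset_cl SQ g}"
      unfolding coset_cl_def using tensor_relations.intros(1)[of SQ] by fastforce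
  qed
  then show ?thesis by (simp add: alexander_module_def Let_def)
qed

lemma AM_smult:
  assumes r: "r \<in> fin_supp (carrier Gab)" and f: "f \<in> FS"
  shows "r \<odot>\<^bsub>AM\<^esub> coset_cl SQ f = coset_cl SQ (algebra_act G r f)"
proof -
  interpret Q: comm_group SQ by (rule comm_group_SQ)
  note R = subspace_tensor_relations[of SQ]
  have act: "algebra_act G r (\<lambda>x. f x + s x) = (\<lambda>x. algebra_act G r f x + algebra_act G r s x)"
    if "s \<in> TR" for s
    using algebra_act_add[OF r f] tensor_relations_fin_supp[OF Q.is_monoid] that by blast
  have "{(\<lambda>x. algebra_act G r k x + s x) | k s. k \<in> coset_cl SQ f \<and> s \<in> TR} =
      coset_cl SQ (algebra_act G r f)"
  proof (intro equalityI subsetI)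
    fix h assume "h \<in> {(\<lambda>x. algebra_act G r k x + s x) | k s. k \<in> coset_cl SQ f \<and> s \<in> TR}"
    then obtain s t where st: "s \<in> TR" "t \<in> TR" "h = (\<lambda>x. algebra_act G r (\<lambda>x. f x + s x) x + t x)"
      by (auto simp: coset_cl_def)
    then have "h = (\<lambda>x. algebra_act G r f x + (algebra_act G r s + t) x)"
      by (simp add: act fun_eq_iff)
    then show "h \<in> coset_cl SQ (algebra_act G r f)"
      unfolding coset_cl_def
      using cfun.subspace_add[OF R algebra_act_tensor_relations[OF r st(1)] st(2)] by blast
  next
    fix h assume "h \<in> coset_cl SQ (algebra_act G r f)"
    then obtain s where s: "s \<in> TR" "h = (\<lambda>x. algebra_act G r f x + s x)" by (auto simp: coset_cl_def)
    have "f \<in> coset_cl SQ f" unfolding coset_cl_def using tensor_relations.intros(1)[of SQ] by force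
    then show "h \<in> {(\<lambda>x. algebra_act G r k x + s x) | k s. k \<in> coset_cl SQ f \<and> s \<in> TR}" using s by blast
  qed
  then show ?thesis by (simp add: alexander_module_def Let_def)
qed

text \<open>Enough structure for the finite sums that occur in \<open>presentation\<close>.\<close>

lemma AM_abelian_monoid: "abelian_monoid AM"
proof (rule abelian_monoidI)
  show "\<zero>\<^bsub>AM\<^esub> \<in> carrier AM" unfolding AM_zero AM_carrier by (intro imageI fin_supp_zero)
qed (auto simp: AM_carrier AM_zero AM_add algebra_simps intro!: imageI fin_supp_add)

lemma AM_finsum:
  assumes "finite I" "\<And>i. i \<in> I \<Longrightarrow> g i \<in> FS"
  shows "(\<Oplus>\<^bsub>AM\<^esub>i\<in>I. coset_cl SQ (g i)) = coset_cl SQ (\<lambda>x. \<Sum>i\<in>I. g i x)"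
proof -
  interpret M: abelian_monoid AM by (rule AM_abelian_monoid)
  show ?thesis using assms
  proof (induction I rule: finite_induct)
    case empty
    then show ?case by (simp add: AM_zero)
  next
    case (insert i I)
    have "(\<Oplus>\<^bsub>AM\<^esub>i\<in>insert i I. coset_cl SQ (g i)) = coset_cl SQ (g i) \<oplus>\<^bsub>AM\<^esub> (\<Oplus>\<^bsub>AM\<^esub>i\<in>I. coset_cl SQ (g i))"
      using insert.hyps insert.prems by (intro M.finsum_insert) (auto simp: AM_carrier)
    then show ?case using insert by (simp add: AM_add)
  qed
qed

text \<open>A lift to finitely supported functions of the sum of the \<open>s j \<odot> e j\<close>,
  where \<open>f j\<close> represents the generator \<open>e j\<close>.\<close>

definition comb :: "nat \<Rightarrow> (nat \<Rightarrow> 'a set \<Rightarrow> complex) \<Rightarrow> (nat \<Rightarrow> 'a set \<Rightarrow> complex) \<Rightarrow> 'a set \<Rightarrow> complex"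
  where "comb n f s = (\<lambda>x. \<Sum>j<n. algebra_act G (s j) (f j) x)"

lemma comb_closed:
  assumes "\<And>j. j < n \<Longrightarrow> f j \<in> FS" "\<And>j. j < n \<Longrightarrow> s j \<in> carrier GA"
  shows "comb n f s \<in> FS"
proof -
  have "(\<Sum>j<n. algebra_act G (s j) (f j)) \<in> FS"
    by (rule cfun.subspace_sum[OF subspace_fin_supp]) (use assms algebra_act_closed in auto)
  moreover have "(\<Sum>j<n. algebra_act G (s j) (f j)) = comb n f s"
    by (auto simp: comb_def fun_eq_iff sum_fun_apply)
  ultimately show ?thesis by simp
qed

text \<open>Choosing representatives of the generators replaces equations in the module by
  congruences modulo \<open>TR\<close>, so that later arguments deal with functions instead of
  classes.\<close>

lemma alexander_presentationE:
  assumes pres: "presentation GA AM m n \<Phi>"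
  obtains f where "\<And>j. j < n \<Longrightarrow> f j \<in> FS"
    "\<And>g. g \<in> FS \<Longrightarrow> \<exists>s. (\<forall>j<n. s j \<in> carrier GA) \<and> (\<lambda>x. g x - comb n f s x) \<in> TR"
    "\<And>s. (\<And>j. j < n \<Longrightarrow> s j \<in> carrier GA) \<Longrightarrow> comb n f s \<in> TR \<longleftrightarrow>
      (\<exists>t\<in>{..<m} \<rightarrow> carrier GA. \<forall>j<n. s j = (\<Oplus>\<^bsub>GA\<^esub>i\<in>{..<m}. t i \<otimes>\<^bsub>GA\<^esub> \<Phi> i j))"
proof -
  interpret M: abelian_monoid AM by (rule AM_abelian_monoid)
  obtain e where E: "(\<forall>j<n. e j \<in> carrier AM) \<and>
      (\<forall>v\<in>carrier AM. \<exists>s\<in>{..<n} \<rightarrow> carrier GA. v = (\<Oplus>\<^bsub>AM\<^esub>j\<in>{..<n}. s j \<odot>\<^bsub>AM\<^esub> e j)) \<and>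
      (\<forall>s\<in>{..<n} \<rightarrow> carrier GA. (\<Oplus>\<^bsub>AM\<^esub>j\<in>{..<n}. s j \<odot>\<^bsub>AM\<^esub> e j) = \<zero>\<^bsub>AM\<^esub> \<longleftrightarrow>
        (\<exists>t\<in>{..<m} \<rightarrow> carrier GA. \<forall>j<n. s j = (\<Oplus>\<^bsub>GA\<^esub>i\<in>{..<m}. t i \<otimes>\<^bsub>GA\<^esub> \<Phi> i j)))"
    using pres[unfolded presentation_def, THEN conjunct2] by (rule exE)
  note e = E[THEN conjunct1, rule_format]
    and span = E[THEN conjunct2, THEN conjunct1, THEN bspec]
    and rel = E[THEN conjunct2, THEN conjunct2, THEN bspec]
  have "\<exists>f. f \<in> FS \<and> e j = coset_cl SQ f" if "j < n" for j
    using e[OF that] by (auto simp: AM_carrier)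
  then obtain f where f: "\<And>j. j < n \<Longrightarrow> f j \<in> FS" "\<And>j. j < n \<Longrightarrow> e j = coset_cl SQ (f j)"
    by metis
  have fs: "(\<Oplus>\<^bsub>AM\<^esub>j\<in>{..<n}. s j \<odot>\<^bsub>AM\<^esub> e j) = coset_cl SQ (comb n f s)"
    if s: "\<And>j. j < n \<Longrightarrow> s j \<in> carrier GA" for s
  proof -
    have "(\<Oplus>\<^bsub>AM\<^esub>j\<in>{..<n}. s j \<odot>\<^bsub>AM\<^esub> e j) = (\<Oplus>\<^bsub>AM\<^esub>j\<in>{..<n}. coset_cl SQ (algebra_act G (s j) (f j)))"
      using f s AM_smult algebra_act_closed by (intro M.finsum_cong') (auto simp: AM_carrier)
    also have "\<dots> = coset_cl SQ (comb n f s)"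
      unfolding comb_def using f s algebra_act_closed by (intro AM_finsum) auto
    finally show ?thesis .
  qed
  show thesis
  proof (rule that[of f])
    show "f j \<in> FS" if "j < n" for j using f(1)[OF that] .
    show "\<exists>s. (\<forall>j<n. s j \<in> carrier GA) \<and> (\<lambda>x. g x - comb n f s x) \<in> TR" if g: "g \<in> FS" for g
    proof -
      obtain s where s: "s \<in> {..<n} \<rightarrow> carrier GA" "coset_cl SQ g = (\<Oplus>\<^bsub>AM\<^esub>j\<in>{..<n}. s j \<odot>\<^bsub>AM\<^esub> e j)"
        using span[of "coset_cl SQ g"] g by (auto simp: AM_carrier)
      then have "coset_cl SQ g = coset_cl SQ (comb n f s)" using fs[of s] by (metis PiE lessThan_iff)
      then show ?thesis using s(1) unfolding coset_cl_eq_iff by blast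
    qed
    show "comb n f s \<in> TR \<longleftrightarrow>
      (\<exists>t\<in>{..<m} \<rightarrow> carrier GA. \<forall>j<n. s j = (\<Oplus>\<^bsub>GA\<^esub>i\<in>{..<m}. t i \<otimes>\<^bsub>GA\<^esub> \<Phi> i j))"
      if s: "\<And>j. j < n \<Longrightarrow> s j \<in> carrier GA" for s
    proof -
      have "comb n f s \<in> TR \<longleftrightarrow> coset_cl SQ (comb n f s) = \<zero>\<^bsub>AM\<^esub>"
        unfolding AM_zero coset_cl_eq_iff by simp
      also have "\<dots> \<longleftrightarrow> (\<exists>t\<in>{..<m} \<rightarrow> carrier GA. \<forall>j<n. s j = (\<Oplus>\<^bsub>GA\<^esub>i\<in>{..<m}. t i \<otimes>\<^bsub>GA\<^esub> \<Phi> i j))"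
        using rel[of s] fs[of s] s by auto
      finally show ?thesis .
    qed
  qed
qed

section \<open>Evaluation of the group algebra at a character\<close>

lemma characters_D1:
  assumes \<theta>: "\<theta> \<in> characters G" and d: "d \<in> D1"
  shows "\<theta> d = 1"
proof -
  let ?K = "{x\<in>carrier G. \<theta> x = 1}"
  have "subgroup ?K G"
  proof (rule subgroupI)
    show "?K \<noteq> {}" using characters_one[OF is_group \<theta>] by blast
  qed (use characters_inv[OF is_group \<theta>] characters_mult[OF \<theta>] in auto)
  moreover have "commutator x y \<in> ?K" if "x \<in> carrier G" "y \<in> carrier G" for x y
  proof -
    have "\<theta> (commutator x y) = \<theta> x * \<theta> y * inverse (\<theta> x) * inverse (\<theta> y)"
      using that by (simp add: commutator_def characters_mult[OF \<theta>] characters_inv[OF is_group \<theta>])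
    then show ?thesis
      using that characters_nonzero[OF \<theta> that(1)] characters_nonzero[OF \<theta> that(2)]
      by (simp add: field_simps)
  qed
  ultimately show ?thesis using derived_subset[of ?K] d by blast
qed

text \<open>Justifies the use of \<open>the_elem\<close> in \<open>eval_char\<close>: a character is
  constant on the cosets of \<open>G'\<close>.\<close>

lemma characters_coset:
  assumes \<theta>: "\<theta> \<in> characters G" and g: "g \<in> carrier G"
  shows "the_elem (\<theta> ` (D1 #> g)) = \<theta> g"
proof -
  have "\<theta> x = \<theta> g" if "x \<in> D1 #> g" for x
    using that characters_mult[OF \<theta> D1_closed g] characters_D1[OF \<theta>] unfolding rcos_mem by auto
  moreover have "g \<in> D1 #> g" using rcos_self[OF g D1_subgroup] .
  ultimately have "\<theta> ` (D1 #> g) = {\<theta> g}" by blast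
  then show ?thesis by simp
qed

context
  fixes \<theta> :: "'a \<Rightarrow> complex"
  assumes \<theta>: "\<theta> \<in> characters G"
begin

lemma eval_char_mult:
  assumes f: "f \<in> carrier GA" and g: "g \<in> carrier GA"
  shows "eval_char \<theta> (f \<otimes>\<^bsub>GA\<^esub> g) = eval_char \<theta> f * eval_char \<theta> g"
proof -
  interpret A: comm_group Gab by (rule comm_group_Gab)
  have fg: "f \<in> fin_supp (carrier Gab)" "g \<in> fin_supp (carrier Gab)" using f g by auto
  have m: "the_elem (\<theta> ` (a \<otimes>\<^bsub>Gab\<^esub> b)) = the_elem (\<theta> ` a) * the_elem (\<theta> ` b)"
    if "a \<in> carrier Gab" "b \<in> carrier Gab" for a b
    using that characters_mult[OF \<theta>] by (auto simp: carrier_Gab Gab_mult characters_coset[OF \<theta>])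
  have "eval_char \<theta> (f \<otimes>\<^bsub>GA\<^esub> g) = pairing f (\<lambda>a. pairing g (\<lambda>b. the_elem (\<theta> ` a) * the_elem (\<theta> ` b)))"
    unfolding eval_char_pairing A.pairing_mult[OF fg]
    by (intro pairing_cong) (simp add: m fin_supp_in[OF fg(1)] fin_supp_in[OF fg(2)])
  also have "\<dots> = eval_char \<theta> f * eval_char \<theta> g"
    by (simp only: pairing_scale_right pairing_scale_right' eval_char_pairing)
  finally show ?thesis .
qed

lemma eval_char_add:
  "f \<in> carrier GA \<Longrightarrow> g \<in> carrier GA \<Longrightarrow> eval_char \<theta> (f \<oplus>\<^bsub>GA\<^esub> g) = eval_char \<theta> f + eval_char \<theta> g"
  using pairing_add[of f "carrier Gab" g] by (simp add: eval_char_pairing)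

lemma eval_char_zero: "eval_char \<theta> \<zero>\<^bsub>GA\<^esub> = 0"
  by (simp add: eval_char_pairing)

lemma eval_char_scale: "eval_char \<theta> (\<lambda>x. c * f x) = c * eval_char \<theta> f"
  by (simp add: eval_char_pairing pairing_scale)

lemma eval_char_delta: "g \<in> carrier G \<Longrightarrow> eval_char \<theta> (delta (D1 #> g)) = \<theta> g"
  by (simp add: eval_char_pairing characters_coset[OF \<theta>])

lemma eval_char_one: "eval_char \<theta> \<one>\<^bsub>GA\<^esub> = 1"
  using eval_char_delta[OF one_closed] characters_one[OF is_group \<theta>] by (simp add: Gab_one)

lemma eval_char_finsum:
  assumes "finite I" "\<And>i. i \<in> I \<Longrightarrow> g i \<in> carrier GA"
  shows "eval_char \<theta> (\<Oplus>\<^bsub>GA\<^esub>i\<in>I. g i) = (\<Sum>i\<in>I. eval_char \<theta> (g i))"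
proof -
  interpret S: cring GA by (rule cring_group_algebra[OF comm_group_Gab])
  show ?thesis using assms
  proof (induction I rule: finite_induct)
    case empty
    then show ?case unfolding S.finsum_empty using eval_char_zero by simp
  next
    case (insert i I)
    have "(\<Oplus>\<^bsub>GA\<^esub>i\<in>insert i I. g i) = g i \<oplus>\<^bsub>GA\<^esub> (\<Oplus>\<^bsub>GA\<^esub>i\<in>I. g i)"
      using insert.hyps insert.prems by (intro S.finsum_insert) auto
    moreover have "(\<Oplus>\<^bsub>GA\<^esub>i\<in>I. g i) \<in> carrier GA" by (rule S.finsum_closed) (use insert.prems in blast)
    ultimately show ?case using insert eval_char_add by simp
  qed
qed

text \<open>A homomorphism from \<open>G'\<close> to a commutative group is trivial on
  \<open>G''\<close>, so the representative chosen by \<open>tilde\<close> is immaterial.\<close>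

lemma tilde_coset:
  assumes u: "u \<in> ahom G D1" and x: "x \<in> D1"
  shows "tilde u (D2 #> x) = u x"
proof -
  have "D2 \<subseteq> {x\<in>D1. u x = 0}"
  proof -
    have "D2 = generate G (\<Union>h1\<in>D1. \<Union>h2\<in>D1. {h1 \<otimes> h2 \<otimes> inv h1 \<otimes> inv h2})"
      by (simp add: derived_def)
    also have "\<dots> \<subseteq> {x\<in>D1. u x = 0}"
    proof (rule generate_subgroup_incl[OF _ kernel_ahom_subgroup[OF D1_subgroup u]], clarify)
      fix a b assume ab: "a \<in> D1" "b \<in> D1"
      note cl = subgroup.m_closed[OF D1_subgroup] subgroup.m_inv_closed[OF D1_subgroup]
      show "a \<otimes> b \<otimes> inv a \<otimes> inv b \<in> D1 \<and> u (a \<otimes> b \<otimes> inv a \<otimes> inv b) = 0"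
        using ab cl ahom_mult[OF u] ahom_inv[OF is_group D1_subgroup u] by simp
    qed
    finally show ?thesis .
  qed
  then have eq: "u y = u x" if "y \<in> D2 #> x" for y
    using that ahom_mult[OF u _ x] unfolding rcos_mem by fastforce
  have "x \<in> D2 #> x" using rcos_self[OF D1_closed[OF x] D2_subgroup] .
  then have "(SOME y. y \<in> D2 #> x) \<in> D2 #> x" by (metis someI)
  then show ?thesis unfolding tilde_def by (rule eq)
qed

text \<open>An eigenhomomorphism \<open>u\<close> extends to a linear form on the module that is semilinear over the
  evaluation at \<open>\<theta>\<close>, and such a form is determined by its values on the generators.\<close>

lemma fdim_eigenhom_kernel:
  assumes pres: "presentation GA AM m n \<Phi>"
  shows "fdim (eigenhom G D1 \<theta>) =
    fdim {v. (\<forall>j\<ge>n. v j = 0) \<and> (\<forall>i<m. (\<Sum>j<n. eval_char \<theta> (\<Phi> i j) * v j) = 0)}"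
proof -
  interpret S: cring GA by (rule cring_group_algebra[OF comm_group_Gab])
  interpret A: comm_group Gab by (rule comm_group_Gab)
  interpret Q: comm_group SQ by (rule comm_group_SQ)
  note R = subspace_tensor_relations[of SQ]
  let ?ev = "eval_char \<theta>"
  let ?K = "{v. (\<forall>j\<ge>n. v j = 0) \<and> (\<forall>i<m. (\<Sum>j<n. ?ev (\<Phi> i j) * v j) = 0)}"
  have \<Phi>: "\<Phi> i j \<in> carrier GA" if "i < m" "j < n" for i j
    using pres that by (simp add: presentation_def)
  obtain f where f: "\<And>j. j < n \<Longrightarrow> f j \<in> FS"
    and span: "\<And>g. g \<in> FS \<Longrightarrow> \<exists>s. (\<forall>j<n. s j \<in> carrier GA) \<and> (\<lambda>x. g x - comb n f s x) \<in> TR"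
    and rel: "\<And>s. (\<And>j. j < n \<Longrightarrow> s j \<in> carrier GA) \<Longrightarrow> comb n f s \<in> TR \<longleftrightarrow>
      (\<exists>t\<in>{..<m} \<rightarrow> carrier GA. \<forall>j<n. s j = (\<Oplus>\<^bsub>GA\<^esub>i\<in>{..<m}. t i \<otimes>\<^bsub>GA\<^esub> \<Phi> i j))"
    using alexander_presentationE[OF pres] by blast
  \<comment> \<open>The values on the generators of the linear form induced by \<open>u\<close>.
    They form a null vector because the rows of \<open>\<Phi>\<close> are relations.\<close>
  define T where "T = (\<lambda>u j. if j < n then pairing (f j) (tilde u) else 0)"
  interpret T: fun_linear T
    by unfold_locales
      (auto simp: T_def tilde_add tilde_scale pairing_add_right pairing_scale_right fun_eq_iff)
  have tadd: "tilde u (a \<otimes>\<^bsub>SQ\<^esub> b) = tilde u a + tilde u b"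
    if u: "u \<in> ahom G D1" and ab: "a \<in> carrier SQ" "b \<in> carrier SQ" for u a b
  proof -
    obtain x y where xy: "x \<in> D1" "y \<in> D1" "a = D2 #> x" "b = D2 #> y"
      using ab by (auto simp: carrier_SQ)
    show ?thesis
      unfolding xy(3,4) SQ_mult[OF xy(1,2)] tilde_coset[OF u xy(1)] tilde_coset[OF u xy(2)]
        tilde_coset[OF u subgroup.m_closed[OF D1_subgroup xy(1,2)]] by (rule ahom_mult[OF u xy(1,2)])
  qed
  \<comment> \<open>Equivariance of \<open>u\<close> in module terms: moving a coset by
    \<open>h\<close> multiplies the form by the value of \<open>\<theta>\<close> on
    \<open>h\<close>.\<close>
  have tact: "tilde u (conj_act G h c) = the_elem (\<theta> ` h) * tilde u c"
    if u: "u \<in> eigenhom G D1 \<theta>" and hc: "h \<in> carrier Gab" "c \<in> carrier SQ" for u h c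
  proof -
    obtain g x where gx: "g \<in> carrier G" "x \<in> D1" "h = D1 #> g" "c = D2 #> x"
      using hc by (auto simp: carrier_SQ carrier_Gab)
    note uA = eigenhomD[OF u]
    show ?thesis
      unfolding gx(3,4) conj_act_coset[OF gx(1,2)] tilde_coset[OF uA conj_in_D1[OF gx(1,2)]]
        tilde_coset[OF uA gx(2)] characters_coset[OF \<theta> gx(1)] by (rule eigenhom_conj[OF u gx(1,2)])
  qed
  have pact: "pairing (algebra_act G r g) (tilde u) = ?ev r * pairing g (tilde u)"
    if u: "u \<in> eigenhom G D1 \<theta>" and r: "r \<in> carrier GA" and g: "g \<in> FS" for u r g
  proof -
    have r': "r \<in> fin_supp (carrier Gab)" using r by simp
    have "pairing (algebra_act G r g) (tilde u) =
        pairing r (\<lambda>h. pairing g (\<lambda>c. the_elem (\<theta> ` h) * tilde u c))"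
      unfolding pairing_algebra_act[OF r' g]
      by (intro pairing_cong) (simp add: tact[OF u] fin_supp_in[OF r'] fin_supp_in[OF g])
    then show ?thesis by (simp only: pairing_scale_right pairing_scale_right' eval_char_pairing)
  qed
  have pcomb: "pairing (comb n f s) (tilde u) = (\<Sum>j<n. ?ev (s j) * pairing (f j) (tilde u))"
    if u: "u \<in> eigenhom G D1 \<theta>" and s: "\<And>j. j < n \<Longrightarrow> s j \<in> carrier GA" for u s
  proof -
    have "pairing (comb k f s) (tilde u) = (\<Sum>j<k. ?ev (s j) * pairing (f j) (tilde u))" if "k \<le> n" for k
      using that
    proof (induction k)
      case 0
      then show ?case by (simp add: comb_def)
    next
      case (Suc k)
      have k: "k < n" using Suc by simp
      have c: "comb k f s \<in> FS" by (rule comb_closed) (use f s Suc.prems in auto)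
      have a: "algebra_act G (s k) (f k) \<in> FS" using algebra_act_closed f[OF k] s[OF k] by simp
      have "comb (Suc k) f s = (\<lambda>x. comb k f s x + algebra_act G (s k) (f k) x)"
        by (simp add: comb_def)
      then show ?case using Suc pairing_add[OF c a] pact[OF u s[OF k] f[OF k]] by simp
    qed
    then show ?thesis by blast
  qed
  have prel: "pairing s (tilde u) = 0" if "u \<in> ahom G D1" "s \<in> TR" for u s
    using pairing_tensor_relations[OF Q.is_monoid tadd[OF that(1)] that(2)] .
  have pspan: "pairing g (tilde u) = (\<Sum>j<n. ?ev (s j) * pairing (f j) (tilde u))"
    if u: "u \<in> eigenhom G D1 \<theta>" and g: "g \<in> FS" and s: "\<And>j. j < n \<Longrightarrow> s j \<in> carrier GA"
      and d: "(\<lambda>x. g x - comb n f s x) \<in> TR" for u g s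
  proof -
    have "pairing (\<lambda>x. (g x - comb n f s x) + comb n f s x) (tilde u) =
        pairing (\<lambda>x. g x - comb n f s x) (tilde u) + pairing (comb n f s) (tilde u)"
      using d tensor_relations_fin_supp[OF Q.is_monoid] comb_closed[OF f s]
      by (intro pairing_add[of _ "carrier SQ"]) auto
    then show ?thesis using prel[OF eigenhomD[OF u] d] pcomb[OF u s] by simp
  qed
  have FSd: "delta (D2 #> x) \<in> FS" if "x \<in> D1" for x
    using that by (auto intro: fin_supp_delta simp: carrier_SQ)
  have "inj_on T (eigenhom G D1 \<theta>)"
  proof (rule inj_onI)
    fix u u' assume u: "u \<in> eigenhom G D1 \<theta>" and u': "u' \<in> eigenhom G D1 \<theta>" and eq: "T u = T u'"
    have "u x = u' x" if x: "x \<in> D1" for x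
    proof -
      obtain s where s: "\<forall>j<n. s j \<in> carrier GA" "(\<lambda>y. delta (D2 #> x) y - comb n f s y) \<in> TR"
        using span[OF FSd[OF x]] by blast
      have "pairing (f j) (tilde u) = pairing (f j) (tilde u')" if "j < n" for j
        using fun_cong[OF eq, of j] that by (simp add: T_def)
      then have "pairing (delta (D2 #> x)) (tilde u) = pairing (delta (D2 #> x)) (tilde u')"
        using pspan[OF u FSd[OF x] _ s(2)] pspan[OF u' FSd[OF x] _ s(2)] s(1) by simp
      then show ?thesis using tilde_coset[OF eigenhomD x] u u' by simp
    qed
    then show "u = u'"
      using ahom_outside[OF eigenhomD[OF u]] ahom_outside[OF eigenhomD[OF u']] by (metis ext)
  qed
  moreover have "T ` eigenhom G D1 \<theta> = ?K"
  proof
    show "T ` eigenhom G D1 \<theta> \<subseteq> ?K"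
    proof clarify
      fix u assume u: "u \<in> eigenhom G D1 \<theta>"
      have "(\<Sum>j<n. ?ev (\<Phi> i j) * T u j) = 0" if i: "i < m" for i
      proof -
        \<comment> \<open>The \<open>i\<close>-th unit vector as \<open>t\<close> exhibits the
          \<open>i\<close>-th row as a relation.\<close>
        have "comb n f (\<Phi> i) \<in> TR"
        proof (subst rel[OF \<Phi>[OF i]], simp, intro bexI[of _ "\<lambda>i'. if i = i' then \<one>\<^bsub>GA\<^esub> else \<zero>\<^bsub>GA\<^esub>"] allI impI)
          fix j assume j: "j < n"
          have "(\<Oplus>\<^bsub>GA\<^esub>i'\<in>{..<m}. (if i = i' then \<one>\<^bsub>GA\<^esub> else \<zero>\<^bsub>GA\<^esub>) \<otimes>\<^bsub>GA\<^esub> \<Phi> i' j) =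
              (\<Oplus>\<^bsub>GA\<^esub>i'\<in>{..<m}. if i = i' then \<Phi> i' j else \<zero>\<^bsub>GA\<^esub>)"
            by (rule S.finsum_cong') (use \<Phi>[OF _ j] S.l_one S.l_null in \<open>auto simp del: group_algebra_simps\<close>)
          also have "\<dots> = \<Phi> i j"
            by (rule S.finsum_singleton) (use i \<Phi>[OF _ j] in auto)
          finally show "\<Phi> i j = (\<Oplus>\<^bsub>GA\<^esub>i'\<in>{..<m}. (if i = i' then \<one>\<^bsub>GA\<^esub> else \<zero>\<^bsub>GA\<^esub>) \<otimes>\<^bsub>GA\<^esub> \<Phi> i' j)" ..
        qed (auto simp del: group_algebra_simps)
        then have "pairing (comb n f (\<Phi> i)) (tilde u) = 0" using prel[OF eigenhomD[OF u]] by blast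
        then show ?thesis using pcomb[OF u \<Phi>[OF i]] by (simp add: T_def)
      qed
      then show "(\<forall>j\<ge>n. T u j = 0) \<and> (\<forall>i<m. (\<Sum>j<n. ?ev (\<Phi> i j) * T u j) = 0)" by (simp add: T_def)
    qed
    show "?K \<subseteq> T ` eigenhom G D1 \<theta>"
    proof clarify
      fix v :: "nat \<Rightarrow> complex" assume v0: "\<forall>j\<ge>n. v j = 0" and v: "\<forall>i<m. (\<Sum>j<n. ?ev (\<Phi> i j) * v j) = 0"
      let ?ok = "\<lambda>g s. (\<forall>j<n. s j \<in> carrier GA) \<and> (\<lambda>x. g x - comb n f s x) \<in> TR"
      \<comment> \<open>The semilinear form that takes the value \<open>v j\<close> on the generator
        \<open>f j\<close>. The coefficients of \<open>g\<close> are chosen by \<open>SOME\<close>;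
        the facts \<open>zero\<close> and \<open>W\<close> show that the choice does not
        matter.\<close>
      define W where "W g = (\<Sum>j<n. ?ev ((SOME s. ?ok g s) j) * v j)" for g
      \<comment> \<open>Relations are combinations of the rows of \<open>\<Phi>\<close>, and
        \<open>v\<close> annihilates the evaluated rows.\<close>
      have zero: "(\<Sum>j<n. ?ev (s j) * v j) = 0" if s: "\<And>j. j < n \<Longrightarrow> s j \<in> carrier GA" "comb n f s \<in> TR" for s
      proof -
        obtain t where t: "t \<in> {..<m} \<rightarrow> carrier GA"
          "\<And>j. j < n \<Longrightarrow> s j = (\<Oplus>\<^bsub>GA\<^esub>i\<in>{..<m}. t i \<otimes>\<^bsub>GA\<^esub> \<Phi> i j)"
          using rel[OF s(1)] s(2) by auto
        have "?ev (s j) = (\<Sum>i<m. ?ev (t i) * ?ev (\<Phi> i j))" if j: "j < n" for j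
        proof -
          have tC: "t i \<in> carrier GA" if "i < m" for i using t(1) that by blast
          have "?ev (s j) = (\<Sum>i<m. ?ev (t i \<otimes>\<^bsub>GA\<^esub> \<Phi> i j))"
            unfolding t(2)[OF j] by (rule eval_char_finsum) (use tC \<Phi>[OF _ j] S.m_closed in auto)
          then show ?thesis using eval_char_mult[OF tC \<Phi>[OF _ j]] by simp
        qed
        then have "(\<Sum>j<n. ?ev (s j) * v j) = (\<Sum>j<n. \<Sum>i<m. ?ev (t i) * (?ev (\<Phi> i j) * v j))"
          by (simp add: sum_distrib_right mult.assoc)
        also have "\<dots> = (\<Sum>i<m. ?ev (t i) * (\<Sum>j<n. ?ev (\<Phi> i j) * v j))"
          by (subst sum.swap) (simp add: sum_distrib_left)
        finally show ?thesis using v by simp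
      qed
      have W: "W g = (\<Sum>j<n. ?ev (s j) * v j)" if g: "?ok g s" for g s
      proof -
        define s' where "s' = (SOME s. ?ok g s)"
        have s': "?ok g s'" unfolding s'_def by (rule someI[of "?ok g", OF g])
        \<comment> \<open>The difference of two coefficient vectors of the same \<open>g\<close> is
          a relation, so \<open>zero\<close> applies to it.\<close>
        let ?d = "\<lambda>j. s' j \<oplus>\<^bsub>GA\<^esub> (\<lambda>x. - 1 * s j x)"
        have neg: "(\<lambda>x. - 1 * s j x) \<in> carrier GA" if "j < n" for j
          using g that fin_supp_scale[of "s j" _ "-1"] by simp
        have dC: "?d j \<in> carrier GA" if "j < n" for j
          using s' that neg[OF that] S.add.m_closed by blast
        have "comb n f ?d = (\<lambda>x. comb n f s' x - comb n f s x)"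
        proof
          fix x
          have "algebra_act G (?d j) (f j) x = algebra_act G (s' j) (f j) x - algebra_act G (s j) (f j) x"
            if j: "j < n" for j
          proof -
            have C: "s' j \<in> fin_supp (carrier Gab)" "(\<lambda>x. - 1 * s j x) \<in> fin_supp (carrier Gab)"
                "s j \<in> fin_supp (carrier Gab)"
              using s' neg[OF j] g j by auto
            show ?thesis
              using fun_cong[OF algebra_act_add_left[OF C(1,2) f[OF j]], of x]
                fun_cong[OF algebra_act_scale_left[OF C(3) f[OF j], of "-1"], of x] by simp
          qed
          then show "comb n f ?d x = comb n f s' x - comb n f s x"
            by (simp add: comb_def sum_subtractf del: group_algebra_simps)
        qed
        also have "\<dots> = (\<lambda>x. g x - comb n f s x) + (\<lambda>x. - 1 * (g x - comb n f s' x))"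
          by (simp add: fun_eq_iff)
        also have "\<dots> \<in> TR"
          using g s' by (intro cfun.subspace_add[OF R] cfun.subspace_scale[OF R]) auto
        finally have dR: "comb n f ?d \<in> TR" .
        have "(\<Sum>j<n. ?ev (?d j) * v j) = 0" by (rule zero[of ?d, OF _ dR]) (rule dC)
        moreover have "?ev (?d j) = ?ev (s' j) - ?ev (s j)" if j: "j < n" for j
          using eval_char_add[of "s' j" "\<lambda>x. - 1 * s j x"] neg[OF j] s' j eval_char_scale[of "-1" "s j"] by simp
        ultimately have "(\<Sum>j<n. ?ev (s' j) * v j) = (\<Sum>j<n. ?ev (s j) * v j)"
          by (simp add: left_diff_distrib sum_subtractf del: group_algebra_simps)
        then show ?thesis by (simp add: W_def s'_def)
      qed
      have Wadd: "W (\<lambda>x. g x + h x) = W g + W h" if g: "g \<in> FS" and h: "h \<in> FS" for g h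
      proof -
        obtain s where s: "?ok g s" using span[OF g] by blast
        obtain t where t: "?ok h t" using span[OF h] by blast
        let ?d = "\<lambda>j. s j \<oplus>\<^bsub>GA\<^esub> t j"
        have c: "comb n f ?d x = comb n f s x + comb n f t x" for x
        proof -
          have "algebra_act G (?d j) (f j) x = algebra_act G (s j) (f j) x + algebra_act G (t j) (f j) x"
            if j: "j < n" for j
          proof -
            have C: "s j \<in> fin_supp (carrier Gab)" "t j \<in> fin_supp (carrier Gab)" using s t j by auto
            show ?thesis using fun_cong[OF algebra_act_add_left[OF C f[OF j]], of x] by simp
          qed
          then show ?thesis by (simp add: comb_def sum.distrib del: group_algebra_simps)
        qed
        have "(\<lambda>x. (g x + h x) - comb n f ?d x) = (\<lambda>x. g x - comb n f s x) + (\<lambda>x. h x - comb n f t x)"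
          by (simp add: fun_eq_iff c del: group_algebra_simps)
        also have "\<dots> \<in> TR" using s t by (intro cfun.subspace_add[OF R]) auto
        finally have "?ok (\<lambda>x. g x + h x) ?d" using s t S.add.m_closed by blast
        from W[OF this] have "W (\<lambda>x. g x + h x) = (\<Sum>j<n. (?ev (s j) + ?ev (t j)) * v j)"
          using eval_char_add s t by simp
        then show ?thesis using W[OF s] W[OF t] by (simp add: distrib_right sum.distrib)
      qed
      have Wact: "W (algebra_act G r g) = ?ev r * W g" if r: "r \<in> carrier GA" and g: "g \<in> FS" for r g
      proof -
        obtain s where s: "?ok g s" using span[OF g] by blast
        let ?d = "\<lambda>j. r \<otimes>\<^bsub>GA\<^esub> s j"
        have r': "r \<in> fin_supp (carrier Gab)" using r by simp
        have sum: "algebra_act G r (comb k f s) = comb k f ?d" if "k \<le> n" for k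
          using that
        proof (induction k)
          case 0
          then show ?case by (simp add: comb_def algebra_act_zero)
        next
          case (Suc k)
          have k: "k < n" using Suc by simp
          have sk: "s k \<in> fin_supp (carrier Gab)" using s k by simp
          have c: "comb k f s \<in> FS" by (rule comb_closed) (use f s Suc.prems in auto)
          have a: "algebra_act G (s k) (f k) \<in> FS" using algebra_act_closed[OF sk f[OF k]] .
          have "comb (Suc k) f s = (\<lambda>x. comb k f s x + algebra_act G (s k) (f k) x)"
            by (simp add: comb_def)
          then show ?case
            using Suc algebra_act_add[OF r' c a] algebra_act_mult[OF r' sk f[OF k]] by (simp add: comb_def)
        qed
        have c: "comb n f s \<in> FS" by (rule comb_closed) (use f s in auto)
        have "(\<lambda>x. algebra_act G r g x - comb n f ?d x) = algebra_act G r (\<lambda>x. g x - comb n f s x)"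
        proof -
          have "algebra_act G r (\<lambda>x. g x + - 1 * comb n f s x) =
              (\<lambda>x. algebra_act G r g x + - 1 * algebra_act G r (comb n f s) x)"
            by (simp only: algebra_act_add[OF r' g fin_supp_scale[OF c]] algebra_act_scale[OF r' c])
          then show ?thesis using sum[of n] by simp
        qed
        also have "\<dots> \<in> TR" using algebra_act_tensor_relations[OF r'] s by blast
        finally have "?ok (algebra_act G r g) ?d" using s r S.m_closed by blast
        from W[OF this] have "W (algebra_act G r g) = (\<Sum>j<n. (?ev r * ?ev (s j)) * v j)"
          using eval_char_mult[OF r] s by simp
        then show ?thesis using W[OF s] by (simp add: sum_distrib_left mult.assoc)
      qed
      have Wscale: "W (\<lambda>x. c * g x) = c * W g" if g: "g \<in> FS" for c g
      proof -
        have o: "delta \<one>\<^bsub>Gab\<^esub> \<in> fin_supp (carrier Gab)" by (rule fin_supp_delta) simp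
        \<comment> \<open>A scalar acts as the corresponding multiple of the unit of the group
          algebra.\<close>
        have "(\<lambda>x. c * g x) = algebra_act G (\<lambda>h. c * delta \<one>\<^bsub>Gab\<^esub> h) g"
          using algebra_act_scale_left[OF o g, of c] algebra_act_one[OF g] by simp
        then show ?thesis
          using Wact[of "\<lambda>h. c * delta \<one>\<^bsub>Gab\<^esub> h" g] g fin_supp_scale[OF o] eval_char_scale[of c "delta \<one>\<^bsub>Gab\<^esub>"]
            eval_char_one by simp
      qed
      have W0: "W s = 0" if "s \<in> TR" for s
      proof -
        have "comb n f (\<lambda>j. \<zero>\<^bsub>GA\<^esub>) = (\<lambda>x. 0)"
          by (simp add: comb_def algebra_act_def fun_eq_iff cong: if_cong)
        then have "?ok s (\<lambda>j. \<zero>\<^bsub>GA\<^esub>)" using that S.zero_closed by simp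
        from W[OF this] show ?thesis using eval_char_zero by simp
      qed
      \<comment> \<open>A linear form is the pairing with its values on the basis
        \<open>delta c\<close>; these values are what \<open>u\<close>, defined next,
        records.\<close>
      have Wpair: "W g = pairing g (\<lambda>c. W (delta c))" if g: "g \<in> FS" for g
      proof -
        have "W (\<lambda>x. \<Sum>a\<in>A. g a * delta a x) = (\<Sum>a\<in>A. g a * W (delta a))"
          if "finite A" "A \<subseteq> carrier SQ" for A
          using that
        proof (induction A rule: finite_induct)
          case empty
          then show ?case using W0[OF tensor_relations.intros(1)] by simp
        next
          case (insert a A)
          have d: "delta a \<in> FS" using insert by (intro fin_supp_delta) simp
          have "(\<Sum>a\<in>A. (\<lambda>x. g a * delta a x)) \<in> FS"
            using insert by (intro cfun.subspace_sum[OF subspace_fin_supp] fin_supp_scale fin_supp_delta) auto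
          moreover have "(\<Sum>a\<in>A. (\<lambda>x. g a * delta a x)) = (\<lambda>x. \<Sum>a\<in>A. g a * delta a x)"
            by (simp add: fun_eq_iff sum_fun_apply)
          ultimately have S: "(\<lambda>x. \<Sum>a\<in>A. g a * delta a x) \<in> FS" by simp
          show ?case using insert Wadd[OF fin_supp_scale[OF d, of "g a"] S] Wscale[OF d] by simp
        qed
        from this[of "{a. g a \<noteq> 0}"] have
          "W (\<lambda>x. \<Sum>a\<in>{a. g a \<noteq> 0}. g a * delta a x) = pairing g (\<lambda>c. W (delta c))"
          using fin_supp_finite[OF g] fin_supp_in[OF g] by (auto simp: pairing_def)
        moreover have "(\<lambda>x. \<Sum>a\<in>{a. g a \<noteq> 0}. g a * delta a x) = g"
        proof
          fix x
          have "(\<Sum>a\<in>{a. g a \<noteq> 0}. g a * delta a x) = (\<Sum>a\<in>{a. g a \<noteq> 0}. if x = a then g a else 0)"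
            by (rule sum.cong) (auto simp: delta_def)
          then show "(\<Sum>a\<in>{a. g a \<noteq> 0}. g a * delta a x) = g x" using fin_supp_finite[OF g] by simp
        qed
        ultimately show ?thesis by simp
      qed
      define u where "u = (\<lambda>x. if x \<in> D1 then W (delta (D2 #> x)) else 0)"
      have uA: "u \<in> ahom G D1"
      proof (rule ahomI)
        fix x y assume xy: "x \<in> D1" "y \<in> D1"
        let ?a = "D2 #> x" and ?b = "D2 #> y"
        have ab: "?a \<in> carrier SQ" "?b \<in> carrier SQ" using xy by (auto simp: carrier_SQ)
        note dS = fin_supp_delta[OF ab(1)] fin_supp_delta[OF ab(2)]
        let ?r = "\<lambda>z. delta (?a \<otimes>\<^bsub>SQ\<^esub> ?b) z - delta ?a z - delta ?b z"
        have r: "?r \<in> TR" using tensor_relations_basic[OF ab] .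
        then have rF: "?r \<in> FS" using tensor_relations_fin_supp[OF Q.is_monoid] by blast
        have "delta (?a \<otimes>\<^bsub>SQ\<^esub> ?b) = (\<lambda>z. (delta ?a z + delta ?b z) + ?r z)" by (simp add: fun_eq_iff)
        then have "W (delta (?a \<otimes>\<^bsub>SQ\<^esub> ?b)) = W (\<lambda>z. (delta ?a z + delta ?b z) + ?r z)"
          by (rule arg_cong)
        also have "\<dots> = W (delta ?a) + W (delta ?b) + W ?r"
          unfolding Wadd[OF fin_supp_add[OF dS] rF] Wadd[OF dS] ..
        finally show "u (x \<otimes> y) = u x + u y"
          using xy subgroup.m_closed[OF D1_subgroup xy] W0[OF r] by (simp add: u_def SQ_mult)
      qed (simp add: u_def)
      have uE: "u \<in> eigenhom G D1 \<theta>"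
        unfolding eigenhom_def
      proof (intro CollectI conjI ballI)
        show "u \<in> ahom G D1" by (rule uA)
        fix g x assume g: "g \<in> carrier G" and x: "x \<in> D1"
        let ?h = "D1 #> g" and ?c = "D2 #> x"
        have hc: "?h \<in> carrier Gab" "?c \<in> carrier SQ" using g x by (auto simp: carrier_SQ carrier_Gab)
        have "u (g \<otimes> x \<otimes> inv g) = W (delta (conj_act G ?h ?c))"
          using conj_in_D1[OF g x] by (simp add: u_def conj_act_coset[OF g x])
        also have "\<dots> = W (algebra_act G (delta ?h) (delta ?c))" by (simp add: algebra_act_delta[OF hc])
        also have "\<dots> = ?ev (delta ?h) * W (delta ?c)"
          by (rule Wact) (use fin_supp_delta[OF hc(1)] fin_supp_delta[OF hc(2)] in auto)
        finally show "u (g \<otimes> x \<otimes> inv g) = \<theta> g * u x" using x by (simp add: eval_char_delta[OF g] u_def)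
      qed
      have "T u = v"
      proof
        fix j
        show "T u j = v j"
        proof (cases "j < n")
          case False
          then show ?thesis using v0 by (simp add: T_def)
        next
          case True
          have tW: "tilde u c = W (delta c)" if "c \<in> carrier SQ" for c
            using that by (auto simp: carrier_SQ tilde_coset[OF uA]) (simp add: u_def)
          have "T u j = pairing (f j) (\<lambda>c. W (delta c))"
            using True tW fin_supp_in[OF f[OF True]] by (auto simp: T_def intro!: pairing_cong)
          also have "\<dots> = W (f j)" using Wpair[OF f[OF True]] by simp
          also have "\<dots> = v j"
          proof -
            \<comment> \<open>The \<open>j\<close>-th unit vector is an admissible choice of
              coefficients for \<open>f j\<close>.\<close>
            let ?s = "\<lambda>i. if i = j then \<one>\<^bsub>GA\<^esub> else \<zero>\<^bsub>GA\<^esub>"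
            have "comb n f ?s x = (\<Sum>i<n. if i = j then f i x else 0)" for x
              unfolding comb_def
            proof (rule sum.cong[OF refl])
              fix i assume "i \<in> {..<n}"
              then show "algebra_act G (?s i) (f i) x = (if i = j then f i x else 0)"
                using algebra_act_one[OF f] by (auto simp: algebra_act_def[of _ "\<lambda>x. 0"] cong: if_cong)
            qed
            then have "comb n f ?s = f j" using True by (simp add: fun_eq_iff)
            then have "?ok (f j) ?s" using tensor_relations.intros(1)[of SQ] S.one_closed S.zero_closed by auto
            from W[OF this] have "W (f j) = (\<Sum>i<n. ?ev (?s i) * v i)" .
            also have "\<dots> = (\<Sum>i<n. if i = j then v i else 0)"
              by (rule sum.cong) (auto simp: eval_char_one eval_char_zero simp del: group_algebra_simps)
            finally show ?thesis using True by simp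
          qed
          finally show ?thesis .
        qed
      qed
      then show "v \<in> T ` eigenhom G D1 \<theta>" using uE by blast
    qed
  qed
  ultimately show ?thesis using T.fdim_image[OF subspace_eigenhom, of G D1 \<theta>] by simp
qed

end

end

section \<open>Minors, nullspaces and the depth\<close>

text \<open>Has the shape of \<open>ring_det\<close> on a submatrix, signs included, so that
  evaluation at a character matches it term by term; \<open>cminor_det\<close> connects it with
  determinants of matrices.\<close>

definition cminor :: "nat \<Rightarrow> (nat \<Rightarrow> nat) \<Rightarrow> (nat \<Rightarrow> nat) \<Rightarrow> (nat \<Rightarrow> nat \<Rightarrow> complex) \<Rightarrow> complex"
  where "cminor p \<rho> \<sigma> B = (\<Sum>\<pi>\<in>{\<pi>. \<pi> permutes {..<p}}.
    if evenperm \<pi> then (\<Prod>i<p. B (\<rho> i) (\<sigma> (\<pi> i))) else - (\<Prod>i<p. B (\<rho> i) (\<sigma> (\<pi> i))))"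

lemma cminor_det: "cminor p \<rho> \<sigma> B = det (Matrix.mat p p (\<lambda>(i, j). B (\<rho> i) (\<sigma> j)))"
proof -
  have "(\<Prod>i = 0..<p. Matrix.mat p p (\<lambda>(i, j). B (\<rho> i) (\<sigma> j)) $$ (i, \<pi> i)) = (\<Prod>i<p. B (\<rho> i) (\<sigma> (\<pi> i)))"
    if "\<pi> permutes {0..<p}" for \<pi>
    unfolding atLeast0LessThan[symmetric] using permutes_in_image[OF that]
    by (intro prod.cong) auto
  then show ?thesis
    unfolding Determinant.det_def cminor_def
    by (auto intro!: sum.cong simp: sign_def atLeast0LessThan)
qed

lemma cminor_eq_0_iff_right:
  "cminor p \<rho> \<sigma> B = 0 \<longleftrightarrow> (\<exists>w. (\<exists>k<p. w k \<noteq> 0) \<and> (\<forall>i<p. (\<Sum>k<p. B (\<rho> i) (\<sigma> k) * w k) = 0))"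
proof -
  let ?M = "Matrix.mat p p (\<lambda>(i, j). B (\<rho> i) (\<sigma> j))"
  have "cminor p \<rho> \<sigma> B = 0 \<longleftrightarrow> (\<exists>v. v \<in> carrier_vec p \<and> v \<noteq> 0\<^sub>v p \<and> ?M *\<^sub>v v = 0\<^sub>v p)"
    unfolding cminor_det by (rule det_0_iff_vec_prod_zero_field) simp
  also have "\<dots> \<longleftrightarrow> (\<exists>w. (\<exists>k<p. w k \<noteq> 0) \<and> (\<forall>i<p. (\<Sum>k<p. B (\<rho> i) (\<sigma> k) * w k) = 0))"
  proof
    assume "\<exists>v. v \<in> carrier_vec p \<and> v \<noteq> 0\<^sub>v p \<and> ?M *\<^sub>v v = 0\<^sub>v p"
    then obtain v where v: "v \<in> carrier_vec p" "v \<noteq> 0\<^sub>v p" "?M *\<^sub>v v = 0\<^sub>v p" by blast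
    have "\<exists>k<p. vec_index v k \<noteq> 0" using v(1,2) by (auto simp: vec_eq_iff)
    moreover have "(\<Sum>k<p. B (\<rho> i) (\<sigma> k) * vec_index v k) = 0" if i: "i < p" for i
    proof -
      have "vec_index (?M *\<^sub>v v) i = 0" using v(3) i by simp
      then show ?thesis using i v(1) by (simp add: scalar_prod_def lessThan_atLeast0)
    qed
    ultimately show "\<exists>w. (\<exists>k<p. w k \<noteq> 0) \<and> (\<forall>i<p. (\<Sum>k<p. B (\<rho> i) (\<sigma> k) * w k) = 0)" by blast
  next
    assume "\<exists>w. (\<exists>k<p. w k \<noteq> 0) \<and> (\<forall>i<p. (\<Sum>k<p. B (\<rho> i) (\<sigma> k) * w k) = 0)"
    then obtain w where w: "\<exists>k<p. w k \<noteq> 0" "\<forall>i<p. (\<Sum>k<p. B (\<rho> i) (\<sigma> k) * w k) = 0" by blast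
    let ?v = "Matrix.vec p w"
    have "?v \<noteq> 0\<^sub>v p" using w(1) by (metis index_vec index_zero_vec(1))
    moreover have "?M *\<^sub>v ?v = 0\<^sub>v p"
      using w(2) by (intro eq_vecI) (auto simp: scalar_prod_def lessThan_atLeast0)
    ultimately show "\<exists>v. v \<in> carrier_vec p \<and> v \<noteq> 0\<^sub>v p \<and> ?M *\<^sub>v v = 0\<^sub>v p" by (intro exI[of _ ?v]) auto
  qed
  finally show ?thesis .
qed

lemma cminor_transpose: "cminor p \<rho> \<sigma> B = cminor p \<sigma> \<rho> (\<lambda>j i. B i j)"
proof -
  let ?M = "Matrix.mat p p (\<lambda>(i, j). B (\<rho> i) (\<sigma> j))"
  have "transpose_mat ?M = Matrix.mat p p (\<lambda>(i, j). B (\<rho> j) (\<sigma> i))" by (rule eq_matI) auto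
  moreover have "Determinant.det (transpose_mat ?M) = Determinant.det ?M" by (rule Determinant.det_transpose[of _ p]) simp
  ultimately show ?thesis unfolding cminor_det by simp
qed

text \<open>Vectors of length \<open>n\<close> are encoded as functions that vanish from
  \<open>n\<close> on, which makes \<open>fdim\<close> applicable.\<close>

definition nullspace :: "nat \<Rightarrow> nat \<Rightarrow> (nat \<Rightarrow> nat \<Rightarrow> complex) \<Rightarrow> (nat \<Rightarrow> complex) set"
  where "nullspace m n B = {v. (\<forall>j\<ge>n. v j = 0) \<and> (\<forall>i<m. (\<Sum>j<n. B i j * v j) = 0)}"

lemma subspace_nullspace: "cfun.subspace (nullspace m n B)"
  unfolding nullspace_def
proof (rule cfun.subspaceI)
  fix c and v :: "nat \<Rightarrow> complex" assume "v \<in> {v. (\<forall>j\<ge>n. v j = 0) \<and> (\<forall>i<m. (\<Sum>j<n. B i j * v j) = 0)}"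
  then have "(\<Sum>j<n. B i j * (c * v j)) = 0" if "i < m" for i
    using that sum_distrib_left[of c "\<lambda>j. B i j * v j" "{..<n}"] by (simp add: mult.left_commute)
  then show "(\<lambda>x. c * v x) \<in> {v. (\<forall>j\<ge>n. v j = 0) \<and> (\<forall>i<m. (\<Sum>j<n. B i j * v j) = 0)}"
    using \<open>v \<in> _\<close> by simp
qed (auto simp: distrib_left sum.distrib)

text \<open>A null vector is determined by its entries outside the chosen columns: if these vanish,
  the others form a null vector of an invertible square submatrix.\<close>

lemma fdim_nullspace_le:
  assumes \<rho>: "\<rho> ` {..<p} \<subseteq> {..<m}" and \<sigma>: "inj_on \<sigma> {..<p}" "\<sigma> ` {..<p} \<subseteq> {..<n}"
    and nz: "cminor p \<rho> \<sigma> B \<noteq> 0"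
  shows "fdim (nullspace m n B) \<le> enat (n - p)"
proof -
  let ?T = "{..<n} - \<sigma> ` {..<p}"
  let ?L = "\<lambda>(f :: nat \<Rightarrow> complex) x. if x \<in> ?T then f x else 0"
  interpret L: fun_linear ?L by (rule restrict_linear)
  have "v = 0" if v: "v \<in> nullspace m n B" "?L v = 0" for v
  proof -
    have vT: "v j = 0" if "j \<in> ?T" for j using fun_cong[OF v(2), of j] that by simp
    have "(\<Sum>k<p. B (\<rho> i) (\<sigma> k) * v (\<sigma> k)) = 0" if i: "i < p" for i
    proof -
      have "\<rho> i < m" using \<rho> i by blast
      then have "0 = (\<Sum>j<n. B (\<rho> i) j * v j)" using v(1) by (simp add: nullspace_def)
      also have "\<dots> = (\<Sum>j\<in>\<sigma> ` {..<p}. B (\<rho> i) j * v j)"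
        by (rule sum.mono_neutral_right) (use \<sigma> vT in auto)
      also have "\<dots> = (\<Sum>k<p. B (\<rho> i) (\<sigma> k) * v (\<sigma> k))" by (simp add: sum.reindex[OF \<sigma>(1)])
      finally show ?thesis by simp
    qed
    then have "\<not> (\<exists>k<p. v (\<sigma> k) \<noteq> 0)"
      using nz[unfolded cminor_eq_0_iff_right, THEN not_ex[THEN iffD1], THEN spec, of "\<lambda>k. v (\<sigma> k)"] by blast
    then have "v j = 0" for j
      using vT[of j] v(1) by (cases "j < n"; cases "j \<in> \<sigma> ` {..<p}") (auto simp: nullspace_def)
    then show ?thesis by (simp add: fun_eq_iff)
  qed
  then have "inj_on ?L (nullspace m n B)"
    using L.inj_on_iff_eq_0[OF subspace_nullspace[of m n B]] by blast
  then have "fdim (nullspace m n B) = fdim (?L ` nullspace m n B)"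
    using L.fdim_image[OF subspace_nullspace] by simp
  also have "\<dots> \<le> enat (card ?T)"
    by (rule fdim_finite_support[OF _ _ L.subspace_image[OF subspace_nullspace]]) auto
  also have "card ?T = n - p"
    using \<sigma> card_Diff_subset[of "\<sigma> ` {..<p}" "{..<n}"] by (simp add: card_image)
  finally show ?thesis .
qed

text \<open>A dual system of the nullspace leaves a set of linearly independent columns, and a dual system of
  their span selects the rows of a nonvanishing minor.\<close>

lemma nonzero_minor_exists:
  assumes d: "fdim (nullspace m n B) = enat d" and p: "p \<le> n - d"
  shows "\<exists>\<rho> \<sigma>. strict_mono_on {..<p} \<rho> \<and> \<rho> ` {..<p} \<subseteq> {..<m} \<and>
    strict_mono_on {..<p} \<sigma> \<and> \<sigma> ` {..<p} \<subseteq> {..<n} \<and> cminor p \<rho> \<sigma> B \<noteq> 0"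
proof -
  let ?K = "nullspace m n B"
  obtain S g where S: "dual_system S g" "card S = d" "\<forall>s\<in>S. g s \<in> ?K"
    using dual_system_exists[OF subspace_nullspace, of d m n B] d by auto
  have fin: "finite S" using S by (simp add: dual_system_def)
  have Sn: "S \<subseteq> {..<n}"
  proof
    fix s assume s: "s \<in> S"
    then have "g s s \<noteq> 0" using S(1) by (simp add: dual_system_def)
    then show "s \<in> {..<n}" using S(3) s by (auto simp: nullspace_def not_le[symmetric])
  qed
  \<comment> \<open>A nonzero null vector vanishing on \<open>S\<close> would extend the dual system
    beyond the dimension \<open>d\<close>. Hence the columns outside \<open>S\<close> are
    independent.\<close>
  have K0: "v = 0" if v: "v \<in> ?K" "\<And>s. s \<in> S \<Longrightarrow> v s = 0" for v
  proof (rule ccontr)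
    assume "v \<noteq> 0"
    then obtain S' g' where "dual_system S' g'" "card S' = Suc d" "\<forall>s\<in>S'. g' s \<in> ?K"
      using dual_system_extend[OF subspace_nullspace S(1) _ v(1) _ v(2)] S by metis
    then have "enat (Suc d) \<le> enat d" using fdim_ge_dual_system[of S' g' ?K] d by simp
    then show False by simp
  qed
  have "card ({..<n} - S) = n - d" using card_Diff_subset[OF fin Sn] S(2) by simp
  then obtain T where T: "T \<subseteq> {..<n} - S" "card T = p" "finite T"
    using p by (metis obtain_subset_with_card_n)
  \<comment> \<open>The columns, cut off at \<open>m\<close> so that every function in their span
    vanishes beyond the last row.\<close>
  define b where "b t = (\<lambda>i. if i < m then B i t else 0)" for t
  have indep: "\<forall>t\<in>T. c t = 0" if c: "\<And>i. (\<Sum>t\<in>T. c t * b t i) = 0" for c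
  proof -
    define v where "v = (\<lambda>j. if j \<in> T then c j else 0)"
    have "(\<Sum>j<n. B i j * v j) = 0" if "i < m" for i
    proof -
      have "(\<Sum>j<n. B i j * v j) = (\<Sum>j\<in>T. B i j * v j)"
        by (rule sum.mono_neutral_right) (use T in \<open>auto simp: v_def\<close>)
      also have "\<dots> = (\<Sum>t\<in>T. c t * b t i)" using that by (intro sum.cong) (auto simp: v_def b_def)
      finally show ?thesis using c by simp
    qed
    then have "v \<in> ?K" using T(1) by (auto simp: nullspace_def v_def)
    then have "v = 0" by (rule K0) (use T(1) in \<open>auto simp: v_def\<close>)
    then show ?thesis by (auto simp: v_def fun_eq_iff split: if_splits)
  qed
  have inj: "inj_on b T"
  proof (rule inj_onI, rule ccontr)
    fix s t assume st: "s \<in> T" "t \<in> T" "b s = b t" "s \<noteq> t"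
    \<comment> \<open>Two equal columns would satisfy a relation with coefficients \<open>1\<close>
      and \<open>-1\<close>.\<close>
    let ?c = "\<lambda>x. if x = s then 1 else if x = t then -1 else (0::complex)"
    have "(\<Sum>x\<in>T. ?c x * b x i) = 0" for i
    proof -
      have "(\<Sum>x\<in>T. ?c x * b x i) = (\<Sum>x\<in>{s, t}. ?c x * b x i)"
        by (rule sum.mono_neutral_right) (use T st in auto)
      also have "\<dots> = 0" using st by simp
      finally show ?thesis .
    qed
    then have "?c s = 0" using indep[of ?c] st(1) by blast
    then show False by simp
  qed
  have "cfun.independent (b ` T)"
  proof (rule cfun.independent_if_scalars_zero)
    show "finite (b ` T)" using T by simp
    fix u f assume 0: "(\<Sum>f\<in>b ` T. (\<lambda>x. u f * f x)) = 0" and f: "f \<in> b ` T"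
    have "(\<Sum>t\<in>T. u (b t) * b t i) = 0" for i
    proof -
      have "(\<Sum>t\<in>T. (\<lambda>x. u (b t) * b t x)) = 0" using 0 by (simp add: sum.reindex[OF inj])
      from fun_cong[OF this, of i] show ?thesis by (simp add: sum_fun_apply)
    qed
    then show "u f = 0" using indep[of "\<lambda>t. u (b t)"] f by blast
  qed
  \<comment> \<open>Independence of the \<open>p\<close> columns yields \<open>p\<close> row indices
    at which functions in their span take prescribed values.\<close>
  then have "enat p \<le> fdim (cfun.span (b ` T))"
    using fdim_ge[of "b ` T" "cfun.span (b ` T)"] T card_image[OF inj] cfun.span_superset[of "b ` T"] by auto
  then obtain R h where R: "dual_system R h" "card R = p" "\<forall>r\<in>R. h r \<in> cfun.span (b ` T)"
    using dual_system_exists[OF cfun.subspace_span] by blast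
  have finR: "finite R" using R by (simp add: dual_system_def)
  have Rm: "R \<subseteq> {..<m}"
  proof
    fix r assume r: "r \<in> R"
    have "cfun.span (b ` T) \<subseteq> {f. \<forall>i\<ge>m. f i = 0}"
      by (rule cfun.span_minimal, force simp: b_def, rule cfun.subspaceI) auto
    moreover have "h r r \<noteq> 0" using R(1) r by (simp add: dual_system_def)
    ultimately show "r \<in> {..<m}" using R(3) r by (auto simp: not_le[symmetric])
  qed
  obtain \<rho> where \<rho>: "bij_betw \<rho> {..<p} R" "strict_mono_on {..<p} \<rho>"
    using ex_bij_betw_strict_mono_card[OF finR] R(2) by metis
  obtain \<sigma> where \<sigma>: "bij_betw \<sigma> {..<p} T" "strict_mono_on {..<p} \<sigma>"
    using ex_bij_betw_strict_mono_card[OF T(3)] T(2) by metis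
  have "cminor p \<rho> \<sigma> B \<noteq> 0"
  proof
    assume "cminor p \<rho> \<sigma> B = 0"
    then have "cminor p \<sigma> \<rho> (\<lambda>j i. B i j) = 0" using cminor_transpose by metis
    then obtain w where w: "\<exists>k<p. w k \<noteq> 0" "\<And>i. i < p \<Longrightarrow> (\<Sum>k<p. B (\<rho> k) (\<sigma> i) * w k) = 0"
      unfolding cminor_eq_0_iff_right by blast
    have \<rho>m: "\<rho> k < m" if "k < p" for k using \<rho>(1) Rm that by (auto simp: bij_betw_def)
    \<comment> \<open>A vanishing minor gives a linear form in the rows of \<open>R\<close> that
      kills the columns and hence their span; on \<open>h (\<rho> k)\<close> it takes the value
      \<open>w k\<close>, which is nonzero for some \<open>k\<close>.\<close>
    have "cfun.span (b ` T) \<subseteq> {f. (\<Sum>k<p. f (\<rho> k) * w k) = 0}"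
    proof (rule cfun.span_minimal)
      show "b ` T \<subseteq> {f. (\<Sum>k<p. f (\<rho> k) * w k) = 0}"
      proof clarify
        fix t assume "t \<in> T"
        then obtain i where i: "i < p" "t = \<sigma> i" using \<sigma>(1) by (auto simp: bij_betw_def)
        then show "(\<Sum>k<p. b t (\<rho> k) * w k) = 0" using w(2)[OF i(1)] \<rho>m by (simp add: b_def)
      qed
      show "cfun.subspace {f. (\<Sum>k<p. f (\<rho> k) * w k) = 0}"
      proof (rule cfun.subspaceI)
        fix c f assume "f \<in> {f. (\<Sum>k<p. f (\<rho> k) * w k) = 0}"
        then show "(\<lambda>x. c * f x) \<in> {f. (\<Sum>k<p. f (\<rho> k) * w k) = 0}"
          using sum_distrib_left[of c "\<lambda>k. f (\<rho> k) * w k" "{..<p}"] by (simp add: mult.assoc)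
      qed (auto simp: distrib_right sum.distrib)
    qed
    then have hw: "(\<Sum>k<p. h r (\<rho> k) * w k) = 0" if "r \<in> R" for r using R(3) that by blast
    obtain k where k: "k < p" "w k \<noteq> 0" using w(1) by blast
    have kR: "\<rho> k \<in> R" using \<rho>(1) k by (auto simp: bij_betw_def)
    have "(\<Sum>i<p. h (\<rho> k) (\<rho> i) * w i) = (\<Sum>i<p. if i = k then w i else 0)"
    proof (rule sum.cong[OF refl])
      fix i assume i: "i \<in> {..<p}"
      have "\<rho> i \<in> R" "\<rho> k = \<rho> i \<longleftrightarrow> i = k"
        using \<rho>(1) i k inj_on_eq_iff[of \<rho> "{..<p}" k i] by (auto simp: bij_betw_def)
      then show "h (\<rho> k) (\<rho> i) * w i = (if i = k then w i else 0)"
        using R(1) kR by (simp add: dual_system_def)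
    qed
    then show False using hw[OF kR] k by simp
  qed
  then show ?thesis using \<rho> \<sigma> Rm T(1) by (intro exI[of _ \<rho>] exI[of _ \<sigma>]) (auto simp: bij_betw_def)
qed

context group
begin

lemma eval_char_uminus:
  assumes \<theta>: "\<theta> \<in> characters G" and f: "f \<in> carrier GA"
  shows "eval_char \<theta> (\<ominus>\<^bsub>GA\<^esub> f) = - eval_char \<theta> f"
proof -
  interpret S: cring GA by (rule cring_group_algebra[OF comm_group_Gab])
  have "eval_char \<theta> (\<ominus>\<^bsub>GA\<^esub> f \<oplus>\<^bsub>GA\<^esub> f) = 0"
    using S.l_neg[OF f] eval_char_zero[OF \<theta>] by simp
  moreover have "eval_char \<theta> (\<ominus>\<^bsub>GA\<^esub> f \<oplus>\<^bsub>GA\<^esub> f) = eval_char \<theta> (\<ominus>\<^bsub>GA\<^esub> f) + eval_char \<theta> f"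
    by (rule eval_char_add[OF \<theta> S.a_inv_closed[OF f] f])
  ultimately show ?thesis by (simp add: eq_neg_iff_add_eq_0)
qed

lemma eval_char_finprod:
  assumes \<theta>: "\<theta> \<in> characters G" and I: "finite I" "\<And>i. i \<in> I \<Longrightarrow> g i \<in> carrier GA"
  shows "eval_char \<theta> (\<Otimes>\<^bsub>GA\<^esub>i\<in>I. g i) = (\<Prod>i\<in>I. eval_char \<theta> (g i))"
proof -
  interpret S: cring GA by (rule cring_group_algebra[OF comm_group_Gab])
  show ?thesis using I
  proof (induction I rule: finite_induct)
    case empty
    then show ?case unfolding S.finprod_empty using eval_char_one[OF \<theta>] by simp
  next
    case (insert i I)
    have "(\<Otimes>\<^bsub>GA\<^esub>i\<in>insert i I. g i) = g i \<otimes>\<^bsub>GA\<^esub> (\<Otimes>\<^bsub>GA\<^esub>i\<in>I. g i)"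
      using insert.hyps insert.prems by (intro S.finprod_insert) auto
    moreover have "(\<Otimes>\<^bsub>GA\<^esub>i\<in>I. g i) \<in> carrier GA" by (rule S.finprod_closed) (use insert.prems in blast)
    ultimately show ?case using insert eval_char_mult[OF \<theta>] by simp
  qed
qed

context
  fixes m n :: nat and \<Phi> :: "nat \<Rightarrow> nat \<Rightarrow> 'a set \<Rightarrow> complex"
  assumes \<Phi>: "\<And>i j. i < m \<Longrightarrow> j < n \<Longrightarrow> \<Phi> i j \<in> carrier GA"
begin

text \<open>Evaluation is a ring homomorphism and therefore commutes with determinants.\<close>

lemma
  assumes \<rho>: "\<rho> ` {..<p} \<subseteq> {..<m}" and \<sigma>: "\<sigma> ` {..<p} \<subseteq> {..<n}"
  shows ring_det_closed: "ring_det GA p (\<lambda>i j. \<Phi> (\<rho> i) (\<sigma> j)) \<in> carrier GA"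
    and eval_char_ring_det: "\<theta> \<in> characters G \<Longrightarrow> eval_char \<theta> (ring_det GA p (\<lambda>i j. \<Phi> (\<rho> i) (\<sigma> j))) =
      cminor p \<rho> \<sigma> (\<lambda>i j. eval_char \<theta> (\<Phi> i j))"
proof -
  interpret S: cring GA by (rule cring_group_algebra[OF comm_group_Gab])
  have C: "\<Phi> (\<rho> i) (\<sigma> (\<pi> i)) \<in> carrier GA" if "\<pi> permutes {..<p}" "i \<in> {..<p}" for \<pi> i
    using \<Phi> \<rho> \<sigma> permutes_in_image[OF that(1), of i] that(2) by (auto simp: subset_iff)
  have P: "(\<Otimes>\<^bsub>GA\<^esub>i\<in>{..<p}. \<Phi> (\<rho> i) (\<sigma> (\<pi> i))) \<in> carrier GA" if "\<pi> permutes {..<p}" for \<pi>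
    by (rule S.finprod_closed) (use C[OF that] in blast)
  let ?t = "\<lambda>\<pi>. if evenperm \<pi> then (\<Otimes>\<^bsub>GA\<^esub>i\<in>{..<p}. \<Phi> (\<rho> i) (\<sigma> (\<pi> i)))
    else \<ominus>\<^bsub>GA\<^esub> (\<Otimes>\<^bsub>GA\<^esub>i\<in>{..<p}. \<Phi> (\<rho> i) (\<sigma> (\<pi> i)))"
  have tC: "?t \<pi> \<in> carrier GA" if "\<pi> permutes {..<p}" for \<pi>
    using P[OF that] S.a_inv_closed by presburger
  show "ring_det GA p (\<lambda>i j. \<Phi> (\<rho> i) (\<sigma> j)) \<in> carrier GA"
    unfolding ring_det_def by (rule S.finsum_closed) (use tC in blast)
  assume \<theta>: "\<theta> \<in> characters G"
  have "eval_char \<theta> (ring_det GA p (\<lambda>i j. \<Phi> (\<rho> i) (\<sigma> j))) =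
      (\<Sum>\<pi>\<in>{\<pi>. \<pi> permutes {..<p}}. eval_char \<theta> (?t \<pi>))"
    unfolding ring_det_def
    by (rule eval_char_finsum[OF \<theta>]) (use tC finite_permutations[of "{..<p}"] in auto)
  also have "\<dots> = cminor p \<rho> \<sigma> (\<lambda>i j. eval_char \<theta> (\<Phi> i j))"
    unfolding cminor_def
  proof (rule sum.cong[OF refl])
    fix \<pi> assume "\<pi> \<in> {\<pi>. \<pi> permutes {..<p}}"
    then have \<pi>: "\<pi> permutes {..<p}" by simp
    show "eval_char \<theta> (?t \<pi>) = (if evenperm \<pi> then (\<Prod>i<p. eval_char \<theta> (\<Phi> (\<rho> i) (\<sigma> (\<pi> i))))
        else - (\<Prod>i<p. eval_char \<theta> (\<Phi> (\<rho> i) (\<sigma> (\<pi> i)))))"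
      using eval_char_uminus[OF \<theta> P[OF \<pi>]]
        eval_char_finprod[OF \<theta>, of "{..<p}" "\<lambda>i. \<Phi> (\<rho> i) (\<sigma> (\<pi> i))"] C[OF \<pi>] by simp
  qed
  finally show "eval_char \<theta> (ring_det GA p (\<lambda>i j. \<Phi> (\<rho> i) (\<sigma> j))) =
      cminor p \<rho> \<sigma> (\<lambda>i j. eval_char \<theta> (\<Phi> i j))" .
qed

lemma minors_closed: "minors GA m n \<Phi> p \<subseteq> carrier GA"
  unfolding minors_def using ring_det_closed by blast

text \<open>The kernel of the evaluation is an ideal, so vanishing can be tested on
  generators.\<close>

lemma eval_char_genideal_iff:
  assumes \<theta>: "\<theta> \<in> characters G" and Y: "Y \<subseteq> carrier GA"
  shows "(\<forall>f\<in>Idl\<^bsub>GA\<^esub> Y. eval_char \<theta> f = 0) \<longleftrightarrow> (\<forall>f\<in>Y. eval_char \<theta> f = 0)"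
proof
  interpret S: cring GA by (rule cring_group_algebra[OF comm_group_Gab])
  show "\<forall>f\<in>Idl\<^bsub>GA\<^esub> Y. eval_char \<theta> f = 0 \<Longrightarrow> \<forall>f\<in>Y. eval_char \<theta> f = 0"
    using S.genideal_self[OF Y] by blast
  assume 0: "\<forall>f\<in>Y. eval_char \<theta> f = 0"
  let ?I = "{f\<in>carrier GA. eval_char \<theta> f = 0}"
  have "subgroup ?I (add_monoid GA)"
  proof (rule S.add.subgroupI)
    show "?I \<noteq> {}" using eval_char_zero[OF \<theta>] S.zero_closed by blast
    fix a assume a: "a \<in> ?I"
    then show "\<ominus>\<^bsub>GA\<^esub> a \<in> ?I"
      using eval_char_uminus[OF \<theta>, of a] S.a_inv_closed by simp
    fix b assume "b \<in> ?I"
    then show "a \<oplus>\<^bsub>GA\<^esub> b \<in> ?I" using a eval_char_add[OF \<theta>, of a b] S.add.m_closed by simp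
  qed blast
  then have "ideal ?I GA"
    by (rule idealI[OF S.ring_axioms]) (use eval_char_mult[OF \<theta>] S.m_closed in auto)
  then have "Idl\<^bsub>GA\<^esub> Y \<subseteq> ?I" by (rule S.genideal_minimal) (use 0 Y in blast)
  then show "\<forall>f\<in>Idl\<^bsub>GA\<^esub> Y. eval_char \<theta> f = 0" by blast
qed

text \<open>With nullity \<open>d\<close> the evaluated matrix has rank \<open>n - d\<close>, so all
  minors of order \<open>n - k + 1\<close> vanish exactly when that order exceeds
  \<open>n - d\<close>, that is when \<open>k \<le> d\<close>.\<close>

lemma depth_eq_fdim_nullspace:
  assumes \<theta>: "\<theta> \<in> characters G"
  shows "enat (depth G m n \<Phi> \<theta>) = fdim (nullspace m n (\<lambda>i j. eval_char \<theta> (\<Phi> i j)))"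
proof -
  interpret S: cring GA by (rule cring_group_algebra[OF comm_group_Gab])
  let ?B = "\<lambda>i j. eval_char \<theta> (\<Phi> i j)"
  have "fdim (nullspace m n ?B) \<le> enat (card {..<n})"
    by (rule fdim_finite_support[OF _ _ subspace_nullspace]) (auto simp: nullspace_def)
  then obtain d where d: "fdim (nullspace m n ?B) = enat d" "d \<le> n"
    by (cases "fdim (nullspace m n ?B)") auto
  \<comment> \<open>A nonzero minor of order \<open>n - d\<close> has to fit into \<open>m\<close>
    rows. This reconciles the zero ideal prescribed for \<open>k \<le> n - m\<close> with the
    nullity.\<close>
  have nm: "n - m \<le> d"
  proof (rule ccontr)
    assume "\<not> n - m \<le> d"
    obtain \<rho> where \<rho>: "strict_mono_on {..<n - d} \<rho>" "\<rho> ` {..<n - d} \<subseteq> {..<m}"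
      using nonzero_minor_exists[OF d(1) order_refl] by blast
    have "card (\<rho> ` {..<n - d}) = n - d" using strict_mono_on_imp_inj_on[OF \<rho>(1)] by (simp add: card_image)
    then have "n - d \<le> m" using card_mono[OF _ \<rho>(2)] by simp
    then show False using \<open>\<not> n - m \<le> d\<close> by simp
  qed
  have "\<theta> \<in> char_variety G m n \<Phi> k \<longleftrightarrow> k \<le> d" for k
  proof -
    \<comment> \<open>The three branches of \<open>fitting_ideal\<close>; in the last one the order
      \<open>n - k + 1\<close> lies between \<open>1\<close> and \<open>m\<close>.\<close>
    consider "k \<le> n - m" | "n < k" | "n - m < k" "k \<le> n" by linarith
    then show ?thesis
    proof cases
      case 1
      then show ?thesis
        using nm \<theta> eval_char_zero[OF \<theta>]
        by (simp add: char_variety_def fitting_ideal_def del: group_algebra_simps)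
    next
      case 2
      then have "\<not> k \<le> n - m" by linarith
      then have "\<theta> \<notin> char_variety G m n \<Phi> k"
        using 2 eval_char_one[OF \<theta>] S.one_closed unfolding char_variety_def fitting_ideal_def
        by (metis (mono_tags, lifting) mem_Collect_eq zero_neq_one)
      then show ?thesis using 2 d(2) by simp
    next
      case 3
      let ?p = "n - k + 1"
      have "\<theta> \<in> char_variety G m n \<Phi> k \<longleftrightarrow> (\<forall>f\<in>minors GA m n \<Phi> ?p. eval_char \<theta> f = 0)"
      proof -
        have "fitting_ideal GA m n \<Phi> k = Idl\<^bsub>GA\<^esub> (minors GA m n \<Phi> ?p)"
          using 3 by (simp add: fitting_ideal_def)
        then show ?thesis
          using \<theta> eval_char_genideal_iff[OF \<theta> minors_closed[of ?p]] unfolding char_variety_def by simp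
      qed
      also have "\<dots> \<longleftrightarrow> k \<le> d"
      proof
        assume 0: "\<forall>f\<in>minors GA m n \<Phi> ?p. eval_char \<theta> f = 0"
        show "k \<le> d"
        proof (rule ccontr)
          assume "\<not> k \<le> d"
          then have "?p \<le> n - d" using 3 by linarith
          from nonzero_minor_exists[OF d(1) this] obtain \<rho> \<sigma> where
            rs: "strict_mono_on {..<?p} \<rho>" "\<rho> ` {..<?p} \<subseteq> {..<m}"
              "strict_mono_on {..<?p} \<sigma>" "\<sigma> ` {..<?p} \<subseteq> {..<n}" "cminor ?p \<rho> \<sigma> ?B \<noteq> 0" by blast
          then have "ring_det GA ?p (\<lambda>i j. \<Phi> (\<rho> i) (\<sigma> j)) \<in> minors GA m n \<Phi> ?p"
            unfolding minors_def by blast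
          then show False using 0 eval_char_ring_det[OF rs(2,4) \<theta>] rs(5) by simp
        qed
      next
        assume kd: "k \<le> d"
        show "\<forall>f\<in>minors GA m n \<Phi> ?p. eval_char \<theta> f = 0"
        proof (rule ballI, rule ccontr)
          fix f assume "f \<in> minors GA m n \<Phi> ?p" and nz: "eval_char \<theta> f \<noteq> 0"
          then obtain \<rho> \<sigma> where f: "f = ring_det GA ?p (\<lambda>i j. \<Phi> (\<rho> i) (\<sigma> j))"
            and rs: "strict_mono_on {..<?p} \<rho>" "\<rho> ` {..<?p} \<subseteq> {..<m}"
              "strict_mono_on {..<?p} \<sigma>" "\<sigma> ` {..<?p} \<subseteq> {..<n}"
            unfolding minors_def by blast
          have "fdim (nullspace m n ?B) \<le> enat (n - ?p)"
            using fdim_nullspace_le[OF rs(2) strict_mono_on_imp_inj_on[OF rs(3)] rs(4)]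
              nz eval_char_ring_det[OF rs(2,4) \<theta>] f by metis
          then have "d \<le> n - ?p" using d(1) by simp
          then show False using kd 3 by linarith
        qed
      qed
      finally show ?thesis .
    qed
  qed
  then have "{k. \<theta> \<in> char_variety G m n \<Phi> k} = {..d}" by auto
  moreover have "Max {..d} = d" by (rule Max_eqI) auto
  ultimately show ?thesis by (simp add: depth_def d(1))
qed

end

end

section \<open>The rank of a normal subgroup with finite abelian quotient\<close>

text \<open>Composition with the projection is bijective because homomorphisms to \<complex> are
  trivial on commutators.\<close>

lemma fdim_ahom_Gab:
  assumes "group H"
  shows "fdim (ahom (abelianization H) (carrier (abelianization H))) = fdim (ahom H (carrier H))"
proof -
  interpret group H by fact
  let ?L = "\<lambda>(F :: 'a set \<Rightarrow> complex) x. if x \<in> carrier H then F (D1 #>\<^bsub>H\<^esub> x) else 0"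
  let ?W = "ahom Gab (carrier Gab)"
  interpret L: fun_linear ?L by unfold_locales auto
  have "inj_on ?L ?W"
  proof (rule inj_onI)
    fix F F' assume F: "F \<in> ?W" "F' \<in> ?W" and eq: "?L F = ?L F'"
    have "F c = F' c" if "c \<in> carrier Gab" for c
    proof -
      obtain x where "x \<in> carrier H" "c = D1 #>\<^bsub>H\<^esub> x" using \<open>c \<in> _\<close> unfolding carrier_Gab by blast
      then show ?thesis using fun_cong[OF eq, of x] by simp
    qed
    then show "F = F'" using ahom_outside[OF F(1)] ahom_outside[OF F(2)] by (metis ext)
  qed
  moreover have "?L ` ?W = ahom H (carrier H)"
  proof
    show "?L ` ?W \<subseteq> ahom H (carrier H)"
    proof clarify
      fix F assume F: "F \<in> ?W"
      show "?L F \<in> ahom H (carrier H)"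
      proof (rule ahomI)
        fix x y assume xy: "x \<in> carrier H" "y \<in> carrier H"
        have "D1 #>\<^bsub>H\<^esub> x \<in> carrier Gab" "D1 #>\<^bsub>H\<^esub> y \<in> carrier Gab" using xy carrier_Gab by auto
        from ahom_mult[OF F this] show "?L F (x \<otimes>\<^bsub>H\<^esub> y) = ?L F x + ?L F y"
          using xy by (simp add: Gab_mult)
      qed simp
    qed
    show "ahom H (carrier H) \<subseteq> ?L ` ?W"
    proof
      fix f assume f: "f \<in> ahom H (carrier H)"
      have fD: "f d = 0" if d: "d \<in> D1" for d
      proof -
        have "commutator x y \<in> {x\<in>carrier H. f x = 0}" if "x \<in> carrier H" "y \<in> carrier H" for x y
          using that ahom_mult[OF f] ahom_inv[OF is_group subgroup_self f] by (simp add: commutator_def)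
        from derived_subset[OF kernel_ahom_subgroup[OF subgroup_self f] this] show ?thesis using d by blast
      qed
      define F where "F = (\<lambda>c. if c \<in> carrier Gab then the_elem (f ` c) else 0)"
      have Fc: "F (D1 #>\<^bsub>H\<^esub> x) = f x" if x: "x \<in> carrier H" for x
      proof -
        have "f y = f x" if "y \<in> D1 #>\<^bsub>H\<^esub> x" for y
          using that ahom_mult[OF f D1_closed x] fD unfolding rcos_mem by auto
        moreover have "x \<in> D1 #>\<^bsub>H\<^esub> x" by (rule rcos_self[OF x D1_subgroup])
        ultimately have "f ` (D1 #>\<^bsub>H\<^esub> x) = {f x}" by blast
        then show ?thesis using x by (simp add: F_def carrier_Gab)
      qed
      have "F \<in> ?W"
      proof (rule ahomI)
        fix a b assume "a \<in> carrier Gab" "b \<in> carrier Gab"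
        then obtain x y where xy: "x \<in> carrier H" "y \<in> carrier H" "a = D1 #>\<^bsub>H\<^esub> x" "b = D1 #>\<^bsub>H\<^esub> y"
          unfolding carrier_Gab by blast
        then show "F (a \<otimes>\<^bsub>Gab\<^esub> b) = F a + F b"
          using Fc ahom_mult[OF f xy(1,2)] by (simp add: Gab_mult)
      qed (simp add: F_def)
      moreover have "?L F = f" using Fc ahom_outside[OF f] by (auto simp: fun_eq_iff)
      ultimately show "f \<in> ?L ` ?W" by blast
    qed
  qed
  ultimately show ?thesis using L.fdim_image[OF subspace_ahom, of Gab "carrier Gab"] by simp
qed

lemma abelian_rank_abelianization:
  assumes "group H"
  shows "abelian_rank (abelianization H) = fdim (ahom H (carrier H))"
  using abelian_rank_eq_fdim[OF group.comm_group_Gab[OF assms]] fdim_ahom_Gab[OF assms] by simp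

text \<open>Transport of structure along an injective homomorphism; applied to the one induced by
  the covering, it replaces the group of \<open>Y\<close> by \<open>N\<close>.\<close>

lemma fdim_ahom_image:
  assumes H: "group H" and h: "h \<in> hom H G" "inj_on h (carrier H)"
  shows "fdim (ahom G (h ` carrier H)) = fdim (ahom H (carrier H))"
proof -
  interpret group H by fact
  let ?L = "\<lambda>(f :: _ \<Rightarrow> complex) x. if x \<in> carrier H then f (h x) else 0"
  let ?W = "ahom G (h ` carrier H)"
  interpret L: fun_linear ?L by unfold_locales auto
  have hm: "h (x \<otimes>\<^bsub>H\<^esub> y) = h x \<otimes>\<^bsub>G\<^esub> h y" if "x \<in> carrier H" "y \<in> carrier H" for x y
    using h(1) that by (simp add: hom_def)
  have "inj_on ?L ?W"
  proof (rule inj_onI)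
    fix F F' assume F: "F \<in> ?W" "F' \<in> ?W" and eq: "?L F = ?L F'"
    have "F c = F' c" if "c \<in> h ` carrier H" for c
    proof -
      obtain x where "x \<in> carrier H" "c = h x" using \<open>c \<in> _\<close> by blast
      then show ?thesis using fun_cong[OF eq, of x] by simp
    qed
    then show "F = F'" using ahom_outside[OF F(1)] ahom_outside[OF F(2)] by (metis ext)
  qed
  moreover have "?L ` ?W = ahom H (carrier H)"
  proof
    show "?L ` ?W \<subseteq> ahom H (carrier H)"
      using ahom_mult[of _ G "h ` carrier H"] hm by (auto intro!: ahomI)
    show "ahom H (carrier H) \<subseteq> ?L ` ?W"
    proof
      fix f assume f: "f \<in> ahom H (carrier H)"
      define F where "F = (\<lambda>c. if c \<in> h ` carrier H then f (inv_into (carrier H) h c) else 0)"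
      have Fh: "F (h x) = f x" if "x \<in> carrier H" for x
        using that inv_into_f_f[OF h(2) that] by (simp add: F_def)
      have "F \<in> ?W"
      proof (rule ahomI)
        fix a b assume "a \<in> h ` carrier H" "b \<in> h ` carrier H"
        then obtain x y where xy: "x \<in> carrier H" "y \<in> carrier H" "a = h x" "b = h y" by blast
        then show "F (a \<otimes>\<^bsub>G\<^esub> b) = F a + F b"
          using Fh ahom_mult[OF f xy(1,2)] hm[OF xy(1,2), symmetric] by simp
      qed (simp add: F_def)
      moreover have "?L F = f" using Fh ahom_outside[OF f] by (auto simp: fun_eq_iff)
      ultimately show "f \<in> ?L ` ?W" by blast
    qed
  qed
  ultimately show ?thesis using L.fdim_image[OF subspace_ahom, of G "h ` carrier H"] by simp
qed

context finite_abelian_quotient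
begin

lemma inflate_mult:
  assumes "\<xi> \<in> characters (G Mod N)" "g \<in> carrier G" "h \<in> carrier G"
  shows "inflate G N \<xi> (g \<otimes> h) = inflate G N \<xi> g * inflate G N \<xi> h"
  using assms characters_mult[OF assms(1) coset_closed[OF assms(2)] coset_closed[OF assms(3)]] coset_mult[OF assms(2,3)]
  by (simp add: inflate_def)

lemma inflate_in_characters:
  assumes \<xi>: "\<xi> \<in> characters (G Mod N)"
  shows "inflate G N \<xi> \<in> characters G"
  using inflate_mult[OF \<xi>] characters_nonzero[OF \<xi> coset_closed]
  by (auto simp: characters_def hom_def) (auto simp: inflate_def)

lemma inflate_normal:
  assumes \<xi>: "\<xi> \<in> characters (G Mod N)" and x: "x \<in> N"
  shows "inflate G N \<xi> x = 1"
proof -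
  have "N #> x = N" using x by (rule rcos_const[OF is_group])
  then show ?thesis using mem_carrier[OF x] characters_one[OF factorgroup_is_group \<xi>] by (simp add: inflate_def)
qed

text \<open>The trivial character contributes the homomorphisms of \<open>G\<close>. Any other one
  differs from \<open>1\<close> at some \<open>g\<close>, so its eigenspace restricts isomorphically
  to \<open>G'\<close>, where its dimension is the nullity of the evaluated matrix.\<close>

theorem fdim_ahom_normal_subgroup:
  assumes pres: "presentation (group_algebra (abelianization G)) (alexander_module G) m n \<Phi>"
  shows "fdim (ahom G N) = fdim (ahom G (carrier G)) +
    (\<Sum>\<xi>\<in>characters (G Mod N) - {trivial_char (G Mod N)}. enat (depth G m n \<Phi> (inflate G N \<xi>)))"
proof -
  let ?X = "characters (G Mod N)" and ?triv = "trivial_char (G Mod N)"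
  let ?f = "\<lambda>\<xi>. fdim (eigenhom G N (inflate G N \<xi>))"
  have fin: "finite ?X" using finite_characters[OF factorgroup_is_group fin_quot] .
  have one: "?triv \<in> ?X" using trivial_char_in[OF factorgroup_is_group] .
  have f1: "?f ?triv = fdim (ahom G (carrier G))"
    by (rule fdim_eigenhom_trivial) (simp add: inflate_def trivial_char_def coset_closed)
  have f: "?f \<xi> = enat (depth G m n \<Phi> (inflate G N \<xi>))" if \<xi>: "\<xi> \<in> ?X - {?triv}" for \<xi>
  proof -
    have \<xi>X: "\<xi> \<in> ?X" using \<xi> by blast
    have "\<exists>c\<in>carrier (G Mod N). \<xi> c \<noteq> 1"
    proof (rule ccontr)
      assume "\<not> ?thesis"
      then have "\<xi> = ?triv" using \<xi>X by (auto simp: trivial_char_def characters_def extensional_def fun_eq_iff)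
      then show False using \<xi> by blast
    qed
    then obtain g where g: "g \<in> carrier G" "\<xi> (N #> g) \<noteq> 1" by (auto simp: carrier_FactGroup)
    then have g1: "inflate G N \<xi> g \<noteq> 1" by (simp add: inflate_def)
    have \<theta>: "inflate G N \<xi> \<in> characters G" by (rule inflate_in_characters[OF \<xi>X])
    have \<Phi>: "\<Phi> i j \<in> carrier (group_algebra (abelianization G))" if "i < m" "j < n" for i j
      using pres that by (simp add: presentation_def)
    have "?f \<xi> = fdim (eigenhom G (derived G (carrier G)) (inflate G N \<xi>))"
      by (rule fdim_eigenhom_nontrivial[where \<theta> = "inflate G N \<xi>", OF inflate_normal[OF \<xi>X] g(1) g1])
    also have "\<dots> = fdim (nullspace m n (\<lambda>i j. eval_char (inflate G N \<xi>) (\<Phi> i j)))"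
      unfolding nullspace_def by (rule fdim_eigenhom_kernel[OF \<theta> pres])
    also have "\<dots> = enat (depth G m n \<Phi> (inflate G N \<xi>))"
      by (rule depth_eq_fdim_nullspace[OF \<Phi> \<theta>, symmetric])
    finally show ?thesis .
  qed
  have "fdim (ahom G N) = ?f ?triv + (\<Sum>\<xi>\<in>?X - {?triv}. ?f \<xi>)"
    unfolding fdim_ahom_decomposition by (rule sum.remove[OF fin one])
  also have "(\<Sum>\<xi>\<in>?X - {?triv}. ?f \<xi>) =
      (\<Sum>\<xi>\<in>?X - {?triv}. enat (depth G m n \<Phi> (inflate G N \<xi>)))"
    by (rule sum.cong[OF refl f])
  finally show ?thesis unfolding f1 .
qed

end

section \<open>The orbifold fundamental group\<close>

text \<open>The reparametrization waits at the start for half of the time and then runs through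
  \<open>p\<close> at double speed.\<close>

lemma homotopic_paths_const_left:
  assumes p: "path p" "path_image p \<subseteq> S"
  shows "homotopic_paths S ((\<lambda>t. pathstart p) +++ p) p"
proof (rule homotopic_paths_sym, rule homotopic_paths_reparametrize[OF p, of "\<lambda>t. max 0 (2 * t - 1)"])
  show "continuous_on {0..1} (\<lambda>t::real. max 0 (2 * t - 1))" by (intro continuous_intros)
qed (auto simp: joinpaths_def pathstart_def)

lemma homotopic_paths_inverse_right:
  assumes p: "path p" "path_image p \<subseteq> S"
  shows "homotopic_paths S (p +++ reversepath p) (\<lambda>t. pathstart p)"
proof (rule homotopic_paths_sym, unfold homotopic_paths)
  \<comment> \<open>The tent function: \<open>p \<circ> \<phi>\<close> runs along \<open>p\<close>
    and back, and scaling \<open>\<phi>\<close> by \<open>s\<close> pulls the turning point back to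
    the start.\<close>
  define \<phi> where "\<phi> = (\<lambda>t::real. 1 - \<bar>2 * t - 1\<bar>)"
  have \<phi>: "0 \<le> \<phi> t" "\<phi> t \<le> 1" if "t \<in> {0..1}" for t using that by (auto simp: \<phi>_def)
  have in01: "s * \<phi> t \<in> {0..1}" if "s \<in> {0..1}" "t \<in> {0..1}" for s t
    using that \<phi>[OF that(2)] by (auto simp: mult_le_one)
  define h where "h = (\<lambda>(s, t). p (s * \<phi> t))"
  have "continuous_on ({0..1} \<times> {0..1}) (\<lambda>x. p (fst x * \<phi> (snd x)))"
  proof (rule continuous_on_compose2[of "{0..1}" p])
    show "continuous_on {0..1} p" using p(1) by (simp add: path_def)
    show "continuous_on ({0..1} \<times> {0..1}) (\<lambda>x. fst x * \<phi> (snd x))"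
      unfolding \<phi>_def by (intro continuous_intros)
  qed (use in01 in auto)
  then have "continuous_on ({0..1} \<times> {0..1}) h" by (simp add: h_def case_prod_unfold)
  moreover have "h \<in> {0..1} \<times> {0..1} \<rightarrow> S"
    using p(2) in01 by (auto simp: h_def path_image_def)
  moreover have "h (1, x) = (p +++ reversepath p) x" if "x \<in> {0..1}" for x
    by (auto simp: h_def \<phi>_def joinpaths_def reversepath_def algebra_simps)
  ultimately show "\<exists>h. continuous_on ({0..1} \<times> {0..1}) h \<and> h \<in> {0..1} \<times> {0..1} \<rightarrow> S \<and>
      (\<forall>x\<in>{0..1}. h (0, x) = pathstart p) \<and> (\<forall>x\<in>{0..1}. h (1, x) = (p +++ reversepath p) x) \<and>
      (\<forall>t\<in>{0..1::real}. pathstart (h \<circ> Pair t) = pathstart (\<lambda>t. pathstart p) \<and>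
        pathfinish (h \<circ> Pair t) = pathfinish (\<lambda>t. pathstart p))"
    by (intro exI[of _ h]) (auto simp: h_def \<phi>_def pathstart_def pathfinish_def)
qed

text \<open>The hypotheses make \<open>\<gamma>\<close> a member of its own class.\<close>

lemma hclass_eq_iff:
  assumes "path \<gamma>" "path_image \<gamma> \<subseteq> S"
  shows "hclass S \<gamma> = hclass S \<delta> \<longleftrightarrow> homotopic_paths S \<gamma> \<delta>"
proof
  assume "hclass S \<gamma> = hclass S \<delta>"
  then have "\<gamma> \<in> hclass S \<delta>" using assms by (auto simp: hclass_def)
  then show "homotopic_paths S \<gamma> \<delta>" by (auto simp: hclass_def intro: homotopic_paths_sym)
next
  assume "homotopic_paths S \<gamma> \<delta>"
  then show "hclass S \<gamma> = hclass S \<delta>"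
    by (auto simp: hclass_def intro: homotopic_paths_trans homotopic_paths_sym)
qed

lemma loop_at_join: "loop_at S x \<gamma> \<Longrightarrow> loop_at S x \<delta> \<Longrightarrow> loop_at S x (\<gamma> +++ \<delta>)"
  by (simp add: loop_at_def path_image_join)

lemma loop_at_const: "x \<in> S \<Longrightarrow> loop_at S x (\<lambda>t. x)"
  by (auto simp: loop_at_def path_def pathstart_def pathfinish_def path_image_def)

text \<open>The product is defined through all pairs of representatives; since homotopies can be
  concatenated, this is a single class.\<close>

lemma pi1_mult:
  assumes "loop_at S x \<gamma>" "loop_at S x \<delta>"
  shows "hclass S \<gamma> \<otimes>\<^bsub>pi1 S x\<^esub> hclass S \<delta> = hclass S (\<gamma> +++ \<delta>)"
proof -
  have fs: "pathfinish \<gamma> = pathstart \<delta>" using assms by (simp add: loop_at_def)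
  have "{\<eta>. \<exists>\<gamma>'\<in>hclass S \<gamma>. \<exists>\<delta>'\<in>hclass S \<delta>. homotopic_paths S (\<gamma>' +++ \<delta>') \<eta>} = hclass S (\<gamma> +++ \<delta>)"
  proof (intro equalityI subsetI)
    fix \<eta> assume "\<eta> \<in> {\<eta>. \<exists>\<gamma>'\<in>hclass S \<gamma>. \<exists>\<delta>'\<in>hclass S \<delta>. homotopic_paths S (\<gamma>' +++ \<delta>') \<eta>}"
    then obtain \<gamma>' \<delta>' where h: "homotopic_paths S \<gamma> \<gamma>'" "homotopic_paths S \<delta> \<delta>'"
      "homotopic_paths S (\<gamma>' +++ \<delta>') \<eta>" by (auto simp: hclass_def)
    show "\<eta> \<in> hclass S (\<gamma> +++ \<delta>)"
      using homotopic_paths_trans[OF homotopic_paths_join[OF h(1,2) fs] h(3)] by (simp add: hclass_def)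
  next
    fix \<eta> assume "\<eta> \<in> hclass S (\<gamma> +++ \<delta>)"
    moreover have "\<gamma> \<in> hclass S \<gamma>" "\<delta> \<in> hclass S \<delta>" using assms by (auto simp: hclass_def loop_at_def)
    ultimately show "\<eta> \<in> {\<eta>. \<exists>\<gamma>'\<in>hclass S \<gamma>. \<exists>\<delta>'\<in>hclass S \<delta>. homotopic_paths S (\<gamma>' +++ \<delta>') \<eta>}"
      unfolding hclass_def[of _ "\<gamma> +++ \<delta>"] by blast
  qed
  then show ?thesis by (simp add: pi1_def)
qed

lemma group_pi1:
  assumes x: "x \<in> S"
  shows "group (pi1 S x)"
proof (rule groupI)
  have one: "\<one>\<^bsub>pi1 S x\<^esub> = hclass S (\<lambda>t. x)" by (simp add: pi1_def)
  have carr: "carrier (pi1 S x) = hclass S ` {\<gamma>. loop_at S x \<gamma>}" by (simp add: pi1_def)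
  show "\<one>\<^bsub>pi1 S x\<^esub> \<in> carrier (pi1 S x)" unfolding one carr using loop_at_const[OF x] by blast
  fix a assume "a \<in> carrier (pi1 S x)"
  then obtain \<alpha> where \<alpha>: "a = hclass S \<alpha>" "loop_at S x \<alpha>" unfolding carr by blast
  show "\<one>\<^bsub>pi1 S x\<^esub> \<otimes>\<^bsub>pi1 S x\<^esub> a = a"
  proof -
    have "homotopic_paths S ((\<lambda>t. x) +++ \<alpha>) \<alpha>"
      using homotopic_paths_const_left[of \<alpha> S] \<alpha>(2) by (simp add: loop_at_def)
    then show ?thesis
      unfolding one \<alpha>(1) pi1_mult[OF loop_at_const[OF x] \<alpha>(2)]
      using loop_at_join[OF loop_at_const[OF x] \<alpha>(2)] by (subst hclass_eq_iff) (auto simp: loop_at_def)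
  qed
  show "\<exists>b\<in>carrier (pi1 S x). b \<otimes>\<^bsub>pi1 S x\<^esub> a = \<one>\<^bsub>pi1 S x\<^esub>"
  proof
    have r: "loop_at S x (reversepath \<alpha>)" using \<alpha>(2) by (simp add: loop_at_def)
    then show "hclass S (reversepath \<alpha>) \<in> carrier (pi1 S x)" unfolding carr by blast
    have "homotopic_paths S (reversepath \<alpha> +++ \<alpha>) (\<lambda>t. x)"
      using homotopic_paths_inverse_right[of "reversepath \<alpha>" S] r by (simp add: loop_at_def)
    then show "hclass S (reversepath \<alpha>) \<otimes>\<^bsub>pi1 S x\<^esub> a = \<one>\<^bsub>pi1 S x\<^esub>"
      unfolding one \<alpha>(1) pi1_mult[OF r \<alpha>(2)]
      using loop_at_join[OF r \<alpha>(2)] by (subst hclass_eq_iff) (auto simp: loop_at_def)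
  qed
  fix b assume "b \<in> carrier (pi1 S x)"
  then obtain \<beta> where \<beta>: "b = hclass S \<beta>" "loop_at S x \<beta>" unfolding carr by blast
  show "a \<otimes>\<^bsub>pi1 S x\<^esub> b \<in> carrier (pi1 S x)"
    unfolding \<alpha>(1) \<beta>(1) pi1_mult[OF \<alpha>(2) \<beta>(2)] carr using loop_at_join[OF \<alpha>(2) \<beta>(2)] by blast
  fix c assume "c \<in> carrier (pi1 S x)"
  then obtain \<gamma> where \<gamma>: "c = hclass S \<gamma>" "loop_at S x \<gamma>" unfolding carr by blast
  have "homotopic_paths S (\<alpha> +++ (\<beta> +++ \<gamma>)) ((\<alpha> +++ \<beta>) +++ \<gamma>)"
    using \<alpha>(2) \<beta>(2) \<gamma>(2) by (intro homotopic_paths_assoc) (auto simp: loop_at_def)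
  then have "homotopic_paths S ((\<alpha> +++ \<beta>) +++ \<gamma>) (\<alpha> +++ (\<beta> +++ \<gamma>))" by (rule homotopic_paths_sym)
  then show "a \<otimes>\<^bsub>pi1 S x\<^esub> b \<otimes>\<^bsub>pi1 S x\<^esub> c = a \<otimes>\<^bsub>pi1 S x\<^esub> (b \<otimes>\<^bsub>pi1 S x\<^esub> c)"
    unfolding \<alpha>(1) \<beta>(1) \<gamma>(1) pi1_mult[OF \<alpha>(2) \<beta>(2)] pi1_mult[OF \<beta>(2) \<gamma>(2)]
      pi1_mult[OF loop_at_join[OF \<alpha>(2) \<beta>(2)] \<gamma>(2)] pi1_mult[OF \<alpha>(2) loop_at_join[OF \<beta>(2) \<gamma>(2)]]
    using loop_at_join[OF loop_at_join[OF \<alpha>(2) \<beta>(2)] \<gamma>(2)]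
    by (subst hclass_eq_iff) (auto simp: loop_at_def)
qed

lemma holo_translate:
  assumes "holo S g"
  shows "holo {w. w + z \<in> S} (\<lambda>w. g (w + z))"
  unfolding holo_def
proof
  fix w assume "w \<in> {w. w + z \<in> S}"
  then obtain g' where g': "(g has_derivative g') (at (w + z))" "\<forall>c v. g' (c *s v) = c * g' v"
    using assms unfolding holo_def by blast
  have "((\<lambda>w. w + z) has_derivative (\<lambda>h. h)) (at w)"
    by (auto intro!: derivative_eq_intros)
  from has_derivative_compose[OF this g'(1)]
  show "\<exists>f'. ((\<lambda>w. g (w + z)) has_derivative f') (at w) \<and> (\<forall>c v. f' (c *s v) = c * f' v)"
    using g'(2) by blast
qed

text \<open>\<open>reg_ring\<close> asks for a chart centred at the point in question, so a chart
  has to be recentred at the points of its domain.\<close>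

lemma smooth_chart_translate:
  assumes q: "smooth_chart X B q" and z: "z \<in> B"
  shows "smooth_chart X {w. w + z \<in> B} (\<lambda>w. q (w + z))"
proof -
  let ?B = "{w. w + z \<in> B}"
  have B: "open B" "connected B" and cont: "continuous_on B q"
    and op: "\<And>S. open S \<Longrightarrow> S \<subseteq> B \<Longrightarrow> rel_open X (q ` S)"
    and inj: "\<And>v w. v \<in> B \<Longrightarrow> w \<in> B \<Longrightarrow> q v = q w \<longleftrightarrow> w = v"
    and hol: "\<And>V f. rel_open X V \<Longrightarrow> V \<subseteq> q ` B \<Longrightarrow> holo_on V f \<longleftrightarrow> holo {z\<in>B. q z \<in> V} (f \<circ> q)"
    using q unfolding quotient_chart_def by simp_all
  have tr: "?B = (\<lambda>v. v - z) ` B"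
    by (auto simp: image_iff intro!: bexI[of _ "_ + z"])
  have B': "open ?B" unfolding tr using open_translation_subtract[OF B(1), of z] by simp
  have C': "connected ?B" unfolding tr
    by (rule connected_continuous_image[OF _ B(2)]) (intro continuous_intros)
  have im: "(\<lambda>w. q (w + z)) ` S = q ` ((\<lambda>w. w + z) ` S)" for S by auto
  have imB: "(\<lambda>w. w + z) ` ?B = B" unfolding tr by (auto simp: image_iff)
  show ?thesis
    unfolding quotient_chart_def
  proof (intro conjI allI impI ballI)
    show "small_abelian {Finite_Cartesian_Product.mat 1 :: complex^'b^'b}"
      using q unfolding quotient_chart_def by blast
    show "open ?B" "connected ?B" by fact+
    show "0 \<in> ?B" using z by simp
    show "continuous_on ?B (\<lambda>w. q (w + z))"
      by (rule continuous_on_compose2[OF cont]) (auto intro!: continuous_intros)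
    show "rel_open X ((\<lambda>w. q (w + z)) ` S)" if S: "open S \<and> S \<subseteq> ?B" for S
    proof -
      have "(\<lambda>w. w + z) ` S = (\<lambda>w. z + w) ` S" by (simp add: add.commute)
      then have "open ((\<lambda>w. w + z) ` S)" using S open_translation[of S z] by simp
      then show ?thesis unfolding im using S by (intro op) auto
    qed
    show "a *v w \<in> ?B" if "a \<in> {Finite_Cartesian_Product.mat 1}" "w \<in> ?B" for a w using that by simp
    show "q (v + z) = q (w + z) \<longleftrightarrow> (\<exists>a\<in>{Finite_Cartesian_Product.mat 1}. w = a *v v)"
      if "v \<in> ?B" "w \<in> ?B" for v w
      using that inj[of "v + z" "w + z"] by auto
    show "holo_on V f \<longleftrightarrow> holo {w \<in> ?B. q (w + z) \<in> V} (f \<circ> (\<lambda>w. q (w + z)))"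
      if V: "rel_open X V \<and> V \<subseteq> (\<lambda>w. q (w + z)) ` ?B" for V f
    proof -
      have "V \<subseteq> q ` B" using V unfolding im imB by blast
      then have "holo_on V f \<longleftrightarrow> holo {z\<in>B. q z \<in> V} (f \<circ> q)" using hol V by blast
      also have "\<dots> \<longleftrightarrow> holo {w \<in> ?B. q (w + z) \<in> V} (f \<circ> (\<lambda>w. q (w + z)))"
      proof
        assume "holo {z\<in>B. q z \<in> V} (f \<circ> q)"
        from holo_translate[OF this, of z]
        show "holo {w \<in> ?B. q (w + z) \<in> V} (f \<circ> (\<lambda>w. q (w + z)))" by (simp add: o_def)
      next
        assume "holo {w \<in> ?B. q (w + z) \<in> V} (f \<circ> (\<lambda>w. q (w + z)))"
        \<comment> \<open>Translating back by \<open>- z\<close> gives the converse.\<close>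
        from holo_translate[OF this, of "- z"]
        show "holo {z\<in>B. q z \<in> V} (f \<circ> q)" by (simp add: o_def)
      qed
      finally show ?thesis .
    qed
  qed
qed

text \<open>The small circle avoids \<open>D\<close> because its \<open>i\<close>-th coordinate is
  nonzero, avoids the other components by the choice of the chart, and consists of smooth points by
  recentring that chart. This is what puts the relators into the fundamental group.\<close>

lemma meridian_loop:
  fixes X :: "('n::finite, 'd::finite) orbi"
  assumes D: "D \<in> comps X" and \<eta>: "meridian X x D \<eta>"
  shows "loop_at (reg_ring X) x \<eta>"
proof -
  obtain B :: "(complex^'d) set" and q i r \<alpha> \<delta> where
    ch: "adapted_chart (pts X) D B q i" and oth: "\<forall>E\<in>comps X - {D}. q ` B \<inter> E = {}"
    and r: "0 < r" "\<forall>c::complex. cmod c \<le> r \<longrightarrow> axis i c \<in> B"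
    and \<delta>: "\<delta> = (\<lambda>t. q (axis i (complex_of_real r * cis (2 * pi * t))))"
    and \<alpha>: "path \<alpha>" "path_image \<alpha> \<subseteq> reg_ring X" "pathstart \<alpha> = x" "pathfinish \<alpha> = pathstart \<delta>"
    and \<eta>_eq: "\<eta> = \<alpha> +++ (\<delta> +++ reversepath \<alpha>)"
    using \<eta> unfolding meridian_def by blast
  have sm: "smooth_chart (pts X) B q" and DB: "{z\<in>B. q z \<in> D} = {z\<in>B. z $ i = 0}"
    using ch unfolding adapted_chart_def by blast+
  have "open B" and cont: "continuous_on B q" and "rel_open (pts X) (q ` B)"
    using sm unfolding quotient_chart_def by blast+
  then have qX: "q ` B \<subseteq> pts X" unfolding rel_open_def by blast
  define z where "z t = axis i (complex_of_real r * cis (2 * pi * t))" for t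
  have zB: "z t \<in> B" for t unfolding z_def using r by (simp add: norm_mult)
  have zi: "vec_nth (z t) i \<noteq> 0" for t unfolding z_def using r(1) by simp
  have \<delta>_reg: "\<delta> t \<in> reg_ring X" for t
  proof -
    have "q (z t) \<notin> D" using DB zB[of t] zi[of t] by blast
    moreover have "q (z t) \<notin> E" if "E \<in> comps X - {D}" for E using oth that zB[of t] by blast
    ultimately have "q (z t) \<in> orb_ring X" unfolding orb_ring_def using qX zB[of t] by blast
    moreover have "smooth_chart (pts X) {w. w + z t \<in> B} (\<lambda>w. q (w + z t))"
      by (rule smooth_chart_translate[OF sm zB])
    ultimately show ?thesis unfolding reg_ring_def \<delta> z_def by (auto intro!: exI)
  qed
  have "continuous_on UNIV z"
  proof -
    have "z = (\<lambda>t. \<chi> j. if j = i then complex_of_real r * cis (2 * pi * t) else 0)"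
      by (simp add: z_def axis_def fun_eq_iff vec_eq_iff)
    moreover have "continuous_on UNIV (\<lambda>t. \<chi> j. if j = i then complex_of_real r * cis (2 * pi * t) else 0)"
    proof (rule continuous_on_vec_lambda)
      fix j
      show "continuous_on UNIV (\<lambda>t. if j = i then complex_of_real r * cis (2 * pi * t) else 0)"
        by (cases "j = i") (auto intro!: continuous_intros)
    qed
    ultimately show ?thesis by simp
  qed
  then have "continuous_on {0..1} (\<lambda>t. q (z t))"
    by (intro continuous_on_compose2[OF cont]) (use zB continuous_on_subset in blast)+
  then have p\<delta>: "path \<delta>" by (simp add: path_def \<delta> z_def)
  have "pathfinish \<delta> = pathstart \<delta>" by (simp add: \<delta> pathstart_def pathfinish_def)
  moreover have "path_image \<delta> \<subseteq> reg_ring X" using \<delta>_reg by (auto simp: path_image_def)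
  ultimately show ?thesis
    unfolding \<eta>_eq loop_at_def using \<alpha> p\<delta> by (simp add: path_image_join)
qed

text \<open>The family of normal subgroups that is intersected contains \<open>carrier G\<close>,
  hence is nonempty.\<close>

lemma normal_closure_normal:
  assumes G: "group G" and S: "S \<subseteq> carrier G"
  shows "normal_closure G S \<lhd> G"
proof -
  interpret group G by fact
  let ?\<N> = "{N. N \<lhd> G \<and> S \<subseteq> N}"
  have ne: "carrier G \<in> ?\<N>" using normal_self S by blast
  have sub: "subgroup (\<Inter>?\<N>) G"
    by (rule subgroups_Inter) (use ne normal_imp_subgroup in auto)
  have "g \<otimes>\<^bsub>G\<^esub> h \<otimes>\<^bsub>G\<^esub> inv\<^bsub>G\<^esub> g \<in> \<Inter>?\<N>" if "g \<in> carrier G" "h \<in> \<Inter>?\<N>" for g h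
  proof
    fix N assume N: "N \<in> ?\<N>"
    then have "h \<in> N" using that(2) by blast
    then show "g \<otimes>\<^bsub>G\<^esub> h \<otimes>\<^bsub>G\<^esub> inv\<^bsub>G\<^esub> g \<in> N"
      using N normal.inv_op_closed2[of N G g h] that(1) by simp
  qed
  then show ?thesis unfolding normal_closure_def using sub by (simp add: normal_inv_iff)
qed

text \<open>The relators are powers of classes of loops in \<open>reg_ring X\<close>, so their
  normal closure is a normal subgroup and the quotient is a group.\<close>

lemma group_orb_pi1:
  assumes x: "x \<in> reg_ring X"
  shows "group (orb_pi1 X x)"
proof -
  let ?P = "pi1 (reg_ring X) x"
  interpret group ?P by (rule group_pi1[OF x])
  have "orb_relators X x \<subseteq> carrier ?P"
  proof
    fix a assume "a \<in> orb_relators X x"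
    then obtain \<eta> D where a: "a = hclass (reg_ring X) \<eta> [^]\<^bsub>?P\<^esub> idx X D" "D \<in> comps X" "meridian X x D \<eta>"
      unfolding orb_relators_def by blast
    have "hclass (reg_ring X) \<eta> \<in> carrier ?P"
      using meridian_loop[OF a(2,3)] by (auto simp: pi1_def)
    then show "a \<in> carrier ?P" unfolding a(1) by (rule nat_pow_closed)
  qed
  then have "normal_closure ?P (orb_relators X x) \<lhd> ?P" by (rule normal_closure_normal[OF is_group])
  then show ?thesis unfolding orb_pi1_def by (rule normal.factorgroup_is_group)
qed

theorem theorem5p1:
  fixes X :: "('n::finite, 'd::finite) orbi" and Y :: "('m::finite, 'd) orbi"
    and x :: "'n cproj" and y :: "'m cproj"
    and \<pi> :: "'m cproj \<Rightarrow> 'n cproj" and N :: "(real \<Rightarrow> 'n cproj) set set set"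
    and m n :: nat and \<Phi> :: "nat \<Rightarrow> nat \<Rightarrow> (real \<Rightarrow> 'n cproj) set set set \<Rightarrow> complex"
  assumes dim: "CARD('d) = 1 \<or> CARD('d) = 2"
    and X: "nc_orbifold X" and Y: "nc_orbifold Y"
    and base: "x \<in> reg_ring X" "y \<in> reg_ring Y" "\<pi> y = x"
    and cov: "abelian_galois_covering Y y X x \<pi> N"
    and pres: "presentation (group_algebra (abelianization (orb_pi1 X x)))
                 (alexander_module (orb_pi1 X x)) m n \<Phi>"
  shows "b1_orb Y y = b1_orb X x +
    (\<Sum>\<xi>\<in>characters (orb_pi1 X x Mod N) - {trivial_char (orb_pi1 X x Mod N)}.
       enat (null_orb X x m n \<Phi> (inflate (orb_pi1 X x) N \<xi>)))"
proof -
  let ?G = "orb_pi1 X x" and ?H = "orb_pi1 Y y"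
  obtain h where h: "h \<in> hom ?H ?G" "inj_on h (carrier ?H)" "N = h ` carrier ?H"
    using cov unfolding abelian_galois_covering_def induced_hom_def by blast
  have G: "group ?G" and H: "group ?H" using base by (simp_all add: group_orb_pi1)
  interpret finite_abelian_quotient N ?G
    using cov unfolding abelian_galois_covering_def finite_abelian_quotient_def finite_abelian_quotient_axioms_def
    by blast
  \<comment> \<open>\<open>N\<close> is an isomorphic copy of the group of \<open>Y\<close>, so the
    Betti number upstairs is read off from a subgroup of the group downstairs.\<close>
  have "b1_orb Y y = fdim (ahom ?G N)"
    unfolding b1_orb_def abelian_rank_abelianization[OF H] h(3) by (rule fdim_ahom_image[OF H h(1,2), symmetric])
  also have "\<dots> = fdim (ahom ?G (carrier ?G)) +
    (\<Sum>\<xi>\<in>characters (?G Mod N) - {trivial_char (?G Mod N)}. enat (depth ?G m n \<Phi> (inflate ?G N \<xi>)))"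
    by (rule fdim_ahom_normal_subgroup[OF pres])
  finally show ?thesis
    by (simp only: b1_orb_def abelian_rank_abelianization[OF G] null_orb_def)
qed

end
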